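(* Suppose $\pi$ is a nongeneric depth zero supercuspidal irreducible representation of $G=\mathrm{GSp}(4,F)$. Then $\pi^{\mathrm{Kl}(\mathfrak p^n)}=0$ for all $n\ge0$.
   Context: $F$ is a finite extension of $\mathbb Q_p$ with ring of integers $\mathfrak o$, maximal ideal $\mathfrak p$, residue field $\mathbb F_q$. $J=\begin{bmatrix}&&&1\\&&1&\\&-1&&\\-1&&&\end{bmatrix}$, $G=\mathrm{GSp}(4,F)=\{g\in\mathrm{GL}(4,F):{}^tgJg=\mu(g)J\}$, $Z$ its center, $G^0=\{g\in G:\mu(g)\in\mathfrak o^\times\}$. For $n\ge0$, $$\mathrm{Kl}(\mathfrak p^n)=\begin{bmatrix}\mathfrak o&\mathfrak o&\mathfrak o&\mathfrak o\\ \mathfrak p^n&\mathfrak o&\mathfrak o&\mathfrak o\\ \mathfrak p^n&\mathfrak o&\mathfrak o&\mathfrak o\\ \mathfrak p^n&\mathfrak p^n&\mathfrak p^n&\mathfrak o\end{bmatrix}\cap G^0,$$ with $\mathfrak p^0=\mathfrak o$. Let $K=\mathrm{GSp}(4,\mathfrak o)$, $\mathrm K(\mathfrak p)=\begin{bmatrix}\mathfrak o&\mathfrak o&\mathfrak o&\mathfrak p^{-1}\\ \mathfrak p&\mathfrak o&\mathfrak o&\mathfrak o\\ \mathfrak p&\mathfrak o&\mathfrak o&\mathfrak o\\ \mathfrak p&\mathfrak p&\mathfrak p&\mathfrak o\end{bmatrix}\cap G^0$, and let $K^+$, $\mathrm K(\mathfrak p)^+$ be their pro-unipotent radicals (so $K/K^+=\mathrm{GSp}(4,\mathbb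 F_q)$). The depth zero supercuspidal irreducible representations of $G$ are exactly those of one of two forms: $\text{c-Ind}_{ZK}^G(\sigma)$, where $\sigma$ is an irreducible representation of $ZK$ with $\sigma|_K$ an inflation of an irreducible cuspidal representation of $K/K^+$; or $\text{c-Ind}_{N_G(\mathrm K(\mathfrak p))}^G(\tau)$, where $\tau$ is an irreducible representation of the normalizer $N_G(\mathrm K(\mathfrak p))$ with $\tau|_{\mathrm K(\mathfrak p)}$ an inflation of a cuspidal representation of $\mathrm K(\mathfrak p)/\mathrm K(\mathfrak p)^+$. Here $\text{c-Ind}$ denotes smooth compact induction (functions with compact support modulo the inducing subgroup, $f(hg)=\rho(h)f(g)$, right translation action). Nongeneric means admitting no nonzero Whittaker functional. *)

theory Defs
  imports
    "HOL-Analysis.Analysis"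
    "HOL-Algebra.Coset"
    "HOL-Algebra.Group_Action"
    "HOL-Library.Function_Algebras"
begin

section \<open>The field\<close>

definition padic_abs :: "nat \<Rightarrow> rat \<Rightarrow> real" where
  "padic_abs p r = (if r = 0 then 0 else
     real p powi (int (multiplicity (int p) (snd (quotient_of r)))
                  - int (multiplicity (int p) (fst (quotient_of r)))))"

definition Qp_closure :: "'f::{field_char_0, metric_space} set" where
  "Qp_closure = closure (range of_rat)"

text \<open>
  The field \<open>'f\<close> is a finite extension of \<open>\<rat>\<^sub>p\<close>, and \<open>dist x 0\<close> is the unique
  absolute value that extends the \<open>p\<close>-adic one. The field \<open>\<rat>\<^sub>p\<close>, i.e. the
  completion of \<open>\<rat>\<close> for the \<open>p\<close>-adic absolute value, appears as the closure of \<open>\<rat>\<close>,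
  which is required to be complete.
  The ultrametric inequality is not listed: it follows from the triangle inequality and
  multiplicativity, since the absolute value is at most 1 on the integers.
\<close>
definition finite_extension_of_Qp :: "nat \<Rightarrow> 'f::{field_char_0, metric_space} itself \<Rightarrow> bool" where
  "finite_extension_of_Qp p _ \<longleftrightarrow> prime p \<and>
     (\<forall>x y :: 'f. dist x y = dist (x - y) 0) \<and>
     (\<forall>x y :: 'f. dist (x * y) 0 = dist x 0 * dist y 0) \<and>
     (\<forall>r. dist (of_rat r :: 'f) 0 = padic_abs p r) \<and>
     complete (Qp_closure :: 'f set) \<and>
     (\<exists>B :: 'f set. finite B \<and>
        (\<forall>x. \<exists>c. (\<forall>b\<in>B. c b \<in> Qp_closure) \<and> x = (\<Sum>b\<in>B. c b * b)))"

definition int_ring :: "'f::{field_char_0, metric_space} set" where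
  "int_ring = {x. dist x 0 \<le> 1}"

definition max_ideal :: "'f::{field_char_0, metric_space} set" where
  "max_ideal = {x. dist x 0 < 1}"

definition int_units :: "'f::{field_char_0, metric_space} set" where
  "int_units = {x \<in> int_ring. \<exists>y\<in>int_ring. x * y = 1}"

definition ideal_mult :: "'f::{field_char_0, metric_space} set \<Rightarrow> 'f set \<Rightarrow> 'f set" where
  "ideal_mult A B = {\<Sum>i<n. a i * b i | (n::nat) a b. \<forall>i<n. a i \<in> A \<and> b i \<in> B}"

primrec max_ideal_pow :: "nat \<Rightarrow> 'f::{field_char_0, metric_space} set" where
  "max_ideal_pow 0 = int_ring"
| "max_ideal_pow (Suc n) = ideal_mult max_ideal (max_ideal_pow n)"

text \<open>The fractional ideal \<open>\<pp>\<^sup>k\<close>; for negative \<open>k\<close> it is the inverse of \<open>\<pp>\<^sup>-\<^sup>k\<close>.\<close>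
definition frac_ideal :: "int \<Rightarrow> 'f::{field_char_0, metric_space} set" where
  "frac_ideal k = (if 0 \<le> k then max_ideal_pow (nat k)
     else {x. \<forall>y\<in>max_ideal_pow (nat (- k)). x * y \<in> int_ring})"


section \<open>The group and its subgroups\<close>

text \<open>The type \<open>4\<close> has the elements \<open>1\<close>, \<open>2\<close>, \<open>3\<close> and \<open>4 = 0\<close>; \<^const>\<open>vector\<close> lists the
  entries in the order \<open>1\<close>, \<open>2\<close>, \<open>3\<close>, \<open>4\<close>.\<close>

definition Jmat :: "'f::{field_char_0, metric_space}^4^4" where
  "Jmat = vector [vector [ 0,  0, 0, 1],
                  vector [ 0,  0, 1, 0],
                  vector [ 0, -1, 0, 0],
                  vector [-1,  0, 0, 0]]"

definition GSp :: "('f::{field_char_0, metric_space}^4^4) monoid" where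
  "GSp = \<lparr>carrier = {g. invertible g \<and> (\<exists>m. transpose g ** Jmat ** g = mat m ** Jmat)},
          monoid.mult = (**), one = mat 1\<rparr>"

definition similitude :: "'f::{field_char_0, metric_space}^4^4 \<Rightarrow> 'f" where
  "similitude g = (THE m. transpose g ** Jmat ** g = mat m ** Jmat)"

definition GSp0 :: "('f::{field_char_0, metric_space}^4^4) set" where
  "GSp0 = {g \<in> carrier GSp. similitude g \<in> int_units}"

definition pattern :: "int^4^4 \<Rightarrow> ('f::{field_char_0, metric_space}^4^4) set" where
  "pattern E = {A. \<forall>i j. A $ i $ j \<in> frac_ideal (E $ i $ j)}"

definition Kl :: "nat \<Rightarrow> ('f::{field_char_0, metric_space}^4^4) set" where
  "Kl n = pattern (vector [vector [    0,     0,     0, 0],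
                           vector [int n,     0,     0, 0],
                           vector [int n,     0,     0, 0],
                           vector [int n, int n, int n, 0]]) \<inter> GSp0"

text \<open>\<open>GSp(4, \<oo>)\<close> and its pro-unipotent radical, the kernel of reduction modulo \<open>\<pp>\<close>.\<close>

definition Kmax :: "('f::{field_char_0, metric_space}^4^4) set" where
  "Kmax = pattern 0 \<inter> GSp0"

definition Kmax_plus :: "('f::{field_char_0, metric_space}^4^4) set" where
  "Kmax_plus = {g \<in> Kmax. g - mat 1 \<in> pattern (\<chi> i j. 1)}"

text \<open>
  The paramodular group and its pro-unipotent radical.
  With \<open>a = (-1/2, 0, 0, 1/2)\<close>, the \<open>(i,j)\<close> entry of an element of \<open>K(\<pp>)\<close> has valuation at
  least \<open>a\<^sub>i - a\<^sub>j\<close>; the pro-unipotent radical consists of those \<open>g\<close> for which the entries of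
  \<open>g - 1\<close> have valuation strictly greater than \<open>a\<^sub>i - a\<^sub>j\<close>. It is the kernel of
  the map onto the reductive quotient \<open>{(g, h) \<in> GL(2,\<F>\<^sub>q)\<^sup>2. det g = det h}\<close> obtained from the
  entries with indices in \<open>{1,4}\<close> and in \<open>{2,3}\<close>, respectively.
\<close>

definition Kpara :: "('f::{field_char_0, metric_space}^4^4) set" where
  "Kpara = pattern (vector [vector [0, 0, 0, -1],
                            vector [1, 0, 0,  0],
                            vector [1, 0, 0,  0],
                            vector [1, 1, 1,  0]]) \<inter> GSp0"

definition Kpara_plus :: "('f::{field_char_0, metric_space}^4^4) set" where
  "Kpara_plus = {g \<in> Kpara. g - mat 1 \<in>
     pattern (vector [vector [1, 0, 0, 0],
                      vector [1, 1, 1, 0],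
                      vector [1, 1, 1, 0],
                      vector [2, 1, 1, 1]])}"

definition center_of :: "('a, 'b) monoid_scheme \<Rightarrow> 'a set" where
  "center_of G = {z \<in> carrier G. \<forall>g\<in>carrier G. z \<otimes>\<^bsub>G\<^esub> g = g \<otimes>\<^bsub>G\<^esub> z}"

definition ZK :: "('f::{field_char_0, metric_space}^4^4) set" where
  "ZK = center_of GSp <#>\<^bsub>GSp\<^esub> Kmax"

text \<open>The elements of \<open>H\<close> that agree with the identity matrix outside the positions in \<open>S\<close>.\<close>
definition supported_on :: "(4 \<times> 4) set \<Rightarrow> ('f::{field_char_0, metric_space}^4^4) set \<Rightarrow> ('f^4^4) set" where
  "supported_on S H = {g \<in> H. \<forall>i j. (i, j) \<notin> S \<longrightarrow> g $ i $ j = mat 1 $ i $ j}"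

abbreviation siegel_pos :: "(4 \<times> 4) set" where
  "siegel_pos \<equiv> {(1,3), (1,4), (2,3), (2,4)}"

abbreviation klingen_pos :: "(4 \<times> 4) set" where
  "klingen_pos \<equiv> {(1,2), (1,3), (1,4), (2,4), (3,4)}"

abbreviation borel_pos :: "(4 \<times> 4) set" where
  "borel_pos \<equiv> {(1,2), (1,3), (1,4), (2,3), (2,4), (3,4)}"


section \<open>Complex representations\<close>

class complex_space = ab_group_add +
  fixes scaleC :: "complex \<Rightarrow> 'a \<Rightarrow> 'a"
  assumes scaleC_add_right: "scaleC a (x + y) = scaleC a x + scaleC a y"
    and scaleC_add_left: "scaleC (a + b) x = scaleC a x + scaleC b x"
    and scaleC_scaleC: "scaleC a (scaleC b x) = scaleC (a * b) x"
    and scaleC_one: "scaleC 1 x = x"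

global_interpretation complex_space: vector_space "scaleC :: complex \<Rightarrow> 'a \<Rightarrow> 'a::complex_space"
  by unfold_locales (simp_all add: scaleC_add_right scaleC_add_left scaleC_scaleC scaleC_one)

instantiation complex :: complex_space
begin
definition scaleC_complex :: "complex \<Rightarrow> complex \<Rightarrow> complex" where
  "scaleC_complex a x = a * x"
instance
  by standard (simp_all add: scaleC_complex_def algebra_simps)
end

instantiation "fun" :: (type, complex_space) complex_space
begin
definition scaleC_fun :: "complex \<Rightarrow> ('a \<Rightarrow> 'b) \<Rightarrow> 'a \<Rightarrow> 'b" where
  "scaleC_fun a f = (\<lambda>x. scaleC a (f x))"
instance
  by standard (simp_all add: scaleC_fun_def fun_eq_iff
      scaleC_add_right scaleC_add_left scaleC_scaleC scaleC_one)
end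

definition linear_on :: "'v::complex_space set \<Rightarrow> ('v \<Rightarrow> 'w::complex_space) \<Rightarrow> bool" where
  "linear_on V T \<longleftrightarrow> (\<forall>v\<in>V. \<forall>w\<in>V. T (v + w) = T v + T w) \<and>
                     (\<forall>a. \<forall>v\<in>V. T (scaleC a v) = scaleC a (T v))"

text \<open>The representation space is a subspace of its type; only the values of \<open>act\<close> on group
  elements and vectors of that subspace are relevant.\<close>
record ('g, 'v) rep =
  rspace :: "'v set"
  act :: "'g \<Rightarrow> 'v \<Rightarrow> 'v"

definition is_rep :: "('g, 'b) monoid_scheme \<Rightarrow> ('g, 'v::complex_space) rep \<Rightarrow> bool" where
  "is_rep G \<rho> \<longleftrightarrow> complex_space.subspace (rspace \<rho>) \<and>
     (\<forall>g\<in>carrier G. act \<rho> g ` rspace \<rho> \<subseteq> rspace \<rho> \<and> linear_on (rspace \<rho>) (act \<rho> g)) \<and>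
     (\<forall>v\<in>rspace \<rho>. act \<rho> \<one>\<^bsub>G\<^esub> v = v) \<and>
     (\<forall>g\<in>carrier G. \<forall>h\<in>carrier G. \<forall>v\<in>rspace \<rho>. act \<rho> (g \<otimes>\<^bsub>G\<^esub> h) v = act \<rho> g (act \<rho> h v))"

definition irreducible_rep :: "('g, 'b) monoid_scheme \<Rightarrow> ('g, 'v::complex_space) rep \<Rightarrow> bool" where
  "irreducible_rep G \<rho> \<longleftrightarrow> is_rep G \<rho> \<and> rspace \<rho> \<noteq> {0} \<and>
     (\<forall>U. complex_space.subspace U \<and> U \<subseteq> rspace \<rho> \<and> (\<forall>g\<in>carrier G. act \<rho> g ` U \<subseteq> U)
        \<longrightarrow> U = {0} \<or> U = rspace \<rho>)"

definition smooth_rep ::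
    "('g::topological_space, 'b) monoid_scheme \<Rightarrow> ('g, 'v::complex_space) rep \<Rightarrow> bool" where
  "smooth_rep G \<rho> \<longleftrightarrow> is_rep G \<rho> \<and>
     (\<forall>v\<in>rspace \<rho>. openin (top_of_set (carrier G)) {g \<in> carrier G. act \<rho> g v = v})"

definition fixed_vectors :: "('g, 'v::complex_space) rep \<Rightarrow> 'g set \<Rightarrow> 'v set" where
  "fixed_vectors \<rho> H = {v \<in> rspace \<rho>. \<forall>h\<in>H. act \<rho> h v = v}"

definition isomorphic_reps :: "('g, 'b) monoid_scheme \<Rightarrow> ('g, 'v::complex_space) rep \<Rightarrow>
    ('g, 'w::complex_space) rep \<Rightarrow> bool" where
  "isomorphic_reps G \<rho> \<rho>' \<longleftrightarrow> (\<exists>T. linear_on (rspace \<rho>) T \<and> bij_betw T (rspace \<rho>) (rspace \<rho>') \<and>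
     (\<forall>g\<in>carrier G. \<forall>v\<in>rspace \<rho>. T (act \<rho> g v) = act \<rho>' g (T v)))"

text \<open>Smooth compact induction. Function types are total, so functions on \<open>G\<close> are extended
  by 0 outside the carrier.\<close>
definition cInd :: "('g::topological_space, 'b) monoid_scheme \<Rightarrow> 'g set \<Rightarrow>
    ('g, 'w::complex_space) rep \<Rightarrow> ('g, 'g \<Rightarrow> 'w) rep" where
  "cInd G H \<sigma> =
     \<lparr>rspace = {f. (\<forall>g\<in>carrier G. f g \<in> rspace \<sigma>) \<and> (\<forall>g. g \<notin> carrier G \<longrightarrow> f g = 0) \<and>
         (\<forall>h\<in>H. \<forall>g\<in>carrier G. f (h \<otimes>\<^bsub>G\<^esub> g) = act \<sigma> h (f g)) \<and>
         (\<exists>U. subgroup U G \<and> openin (top_of_set (carrier G)) U \<and>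
              (\<forall>u\<in>U. \<forall>g\<in>carrier G. f (g \<otimes>\<^bsub>G\<^esub> u) = f g)) \<and>
         (\<exists>C. compact C \<and> C \<subseteq> carrier G \<and> {g \<in> carrier G. f g \<noteq> 0} \<subseteq> H <#>\<^bsub>G\<^esub> C)},
      act = (\<lambda>g f x. if x \<in> carrier G then f (x \<otimes>\<^bsub>G\<^esub> g) else 0)\<rparr>"

text \<open>\<open>\<sigma>\<close>, restricted to \<open>H\<close>, is the inflation of the representation \<open>\<rho>\<close> of \<open>H/N\<close>.\<close>
definition is_inflation :: "('g, 'b) monoid_scheme \<Rightarrow> 'g set \<Rightarrow> ('g, 'w::complex_space) rep \<Rightarrow>
    ('g set, 'w) rep \<Rightarrow> bool" where
  "is_inflation H N \<sigma> \<rho> \<longleftrightarrow> rspace \<sigma> = rspace \<rho> \<and>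
     (\<forall>h\<in>carrier H. \<forall>v\<in>rspace \<sigma>. act \<sigma> h v = act \<rho> (N #>\<^bsub>H\<^esub> h) v)"


section \<open>Cuspidal representations of the reductive quotients\<close>

abbreviation sub_GSp :: "('f::{field_char_0, metric_space}^4^4) set \<Rightarrow> ('f^4^4) monoid" where
  "sub_GSp H \<equiv> GSp\<lparr>carrier := H\<rparr>"

text \<open>The conjugates in \<open>H/N\<close> of the image of a subgroup \<open>U\<close> of \<open>H\<close>.\<close>
definition quotient_conjugates ::
    "('f::{field_char_0, metric_space}^4^4) set \<Rightarrow> ('f^4^4) set \<Rightarrow> ('f^4^4) set \<Rightarrow> ('f^4^4) set set set" where
  "quotient_conjugates H N U =
     {(\<lambda>u. N #>\<^bsub>GSp\<^esub> (h \<otimes>\<^bsub>GSp\<^esub> u \<otimes>\<^bsub>GSp\<^esub> inv\<^bsub>GSp\<^esub> h)) ` U | h. h \<in> H}"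

text \<open>
  The unipotent radicals of the proper parabolic subgroups of \<open>K/K\<^sup>+ = GSp(4,\<F>\<^sub>q)\<close>: up to
  conjugacy, these parabolic subgroups are the Siegel and Klingen parabolic and the Borel subgroup.
\<close>
definition radicals_Kmax :: "('f::{field_char_0, metric_space}^4^4) set set set" where
  "radicals_Kmax = (\<Union>S\<in>{siegel_pos, klingen_pos, borel_pos}.
     quotient_conjugates Kmax Kmax_plus (supported_on S Kmax))"

text \<open>
  The unipotent radicals of the proper parabolic subgroups of
  \<open>K(\<pp>)/K(\<pp>)\<^sup>+ = {(g, h) \<in> GL(2,\<F>\<^sub>q)\<^sup>2. det g = det h}\<close>: up to conjugacy, these parabolic
  subgroups are obtained by taking upper triangular matrices in one of the two factors or in both.
\<close>
definition radicals_Kpara :: "('f::{field_char_0, metric_space}^4^4) set set set" where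
  "radicals_Kpara = (\<Union>S\<in>{{(1,4)}, {(2,3)}, {(1,4), (2,3)}}.
     quotient_conjugates Kpara Kpara_plus (supported_on S Kpara))"

text \<open>Cuspidality: for all unipotent radicals of proper parabolic subgroups there are no
  nonzero fixed vectors.\<close>
definition cuspidal_wrt :: "'g set set \<Rightarrow> ('g, 'w::complex_space) rep \<Rightarrow> bool" where
  "cuspidal_wrt \<N> \<rho> \<longleftrightarrow> (\<forall>U\<in>\<N>. fixed_vectors \<rho> U = {0})"


section \<open>Depth zero supercuspidal and generic representations\<close>

definition inducing_datum_Kmax ::
    "('f::{field_char_0, metric_space}^4^4, 'w::complex_space) rep \<Rightarrow> bool" where
  "inducing_datum_Kmax \<sigma> \<longleftrightarrow> smooth_rep (sub_GSp ZK) \<sigma> \<and> irreducible_rep (sub_GSp ZK) \<sigma> \<and>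
     (\<exists>\<rho>. irreducible_rep (sub_GSp Kmax Mod Kmax_plus) \<rho> \<and> cuspidal_wrt radicals_Kmax \<rho> \<and>
          is_inflation (sub_GSp Kmax) Kmax_plus \<sigma> \<rho>)"

definition inducing_datum_Kpara ::
    "('f::{field_char_0, metric_space}^4^4, 'w::complex_space) rep \<Rightarrow> bool" where
  "inducing_datum_Kpara \<tau> \<longleftrightarrow>
     smooth_rep (sub_GSp (normalizer GSp Kpara)) \<tau> \<and>
     irreducible_rep (sub_GSp (normalizer GSp Kpara)) \<tau> \<and>
     (\<exists>\<rho>. is_rep (sub_GSp Kpara Mod Kpara_plus) \<rho> \<and> cuspidal_wrt radicals_Kpara \<rho> \<and>
          is_inflation (sub_GSp Kpara) Kpara_plus \<tau> \<rho>)"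

text \<open>
  HOL cannot quantify over the type \<open>'w\<close> of the inducing representation inside a formula, so it is
  a parameter. A theorem assuming this predicate with \<open>'w\<close> a type variable covers all inducing
  representations.
\<close>
definition depth_zero_supercuspidal ::
    "'w::complex_space itself \<Rightarrow> ('f::{field_char_0, metric_space}^4^4, 'v::complex_space) rep \<Rightarrow> bool" where
  "depth_zero_supercuspidal _ \<pi> \<longleftrightarrow> smooth_rep GSp \<pi> \<and> irreducible_rep GSp \<pi> \<and>
     ((\<exists>\<sigma> :: ('f^4^4, 'w) rep. inducing_datum_Kmax \<sigma> \<and>
         isomorphic_reps GSp \<pi> (cInd GSp ZK \<sigma>)) \<or>
      (\<exists>\<tau> :: ('f^4^4, 'w) rep. inducing_datum_Kpara \<tau> \<and>
         isomorphic_reps GSp \<pi> (cInd GSp (normalizer GSp Kpara) \<tau>)))"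

definition nontrivial_additive_character :: "('f::{field_char_0, metric_space} \<Rightarrow> complex) \<Rightarrow> bool" where
  "nontrivial_additive_character \<psi> \<longleftrightarrow> continuous_on UNIV \<psi> \<and> (\<forall>x. cmod (\<psi> x) = 1) \<and>
     (\<forall>x y. \<psi> (x + y) = \<psi> x * \<psi> y) \<and> (\<exists>x. \<psi> x \<noteq> 1)"

text \<open>The nondegenerate characters of the group of unipotent upper triangular matrices in \<open>G\<close> are
  \<open>n \<mapsto> \<psi>(c\<^sub>1 n\<^sub>1\<^sub>2 + c\<^sub>2 n\<^sub>2\<^sub>3)\<close> with \<open>c\<^sub>1, c\<^sub>2 \<noteq> 0\<close>.\<close>
definition whittaker_functional ::
    "('f::{field_char_0, metric_space} \<Rightarrow> complex) \<Rightarrow> 'f \<Rightarrow> 'f \<Rightarrow>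
     ('f^4^4, 'v::complex_space) rep \<Rightarrow> ('v \<Rightarrow> complex) \<Rightarrow> bool" where
  "whittaker_functional \<psi> c1 c2 \<pi> l \<longleftrightarrow> linear_on (rspace \<pi>) l \<and>
     (\<forall>n\<in>supported_on borel_pos (carrier GSp). \<forall>v\<in>rspace \<pi>.
        l (act \<pi> n v) = \<psi> (c1 * n $ 1 $ 2 + c2 * n $ 2 $ 3) * l v)"

definition generic :: "('f::{field_char_0, metric_space}^4^4, 'v::complex_space) rep \<Rightarrow> bool" where
  "generic \<pi> \<longleftrightarrow> (\<exists>\<psi> c1 c2 l. nontrivial_additive_character \<psi> \<and> c1 \<noteq> 0 \<and> c2 \<noteq> 0 \<and>
     whittaker_functional \<psi> c1 c2 \<pi> l \<and> (\<exists>v\<in>rspace \<pi>. l v \<noteq> 0))"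

end

(*
  Idea. Let f be a vector of the compactly induced representation fixed by Kl(p^n). Besides the
  root group of e_1, Kl(p^n) contains the transvections along e_2 and e_3 with coefficients in o.
  For g in G one of the vectors g e_2, g e_3 is long with respect to the lattice norm attached to
  the maximal compact group, because their symplectic product is the multiplier of g. That maximal
  compact group has, up to scalars, only the orbits of e_1 and e_2 on nonzero vectors. Hence f(g)
  is fixed by a conjugate of a long root group of the reductive quotient.

  For K(p) such a root group is the unipotent radical of a parabolic subgroup, so f(g) = 0 by
  cuspidality. For K the nonzero vector fixed by the center of the Klingen radical is decomposed
  under the rest of the radical: cuspidality excludes the trivial character, SL(2) moves any other
  character to a standard one, and the remaining root group acts by a nontrivial character because
  a trivial one would give a vector fixed by the Siegel radical. So the inducing representation
  contains a vector with a nondegenerate character of the upper unipotent group, and summing over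
  unipotent cosets yields a Whittaker functional on the induced representation.
*)
theory Submission
  imports Defs "HOL-Number_Theory.Cong" "HOL-Algebra.Zassenhaus"
begin

section \<open>Finite extensions of the p-adic numbers\<close>

text \<open>A Whittaker functional involves a character of all of F, while cuspidality only sees the
  residue field. One character \<open>\<psi>\<close> of F, trivial on the maximal ideal with
  \<open>\<psi> 1 \<noteq> 1\<close>, serves both sides: its twists by integral scalars suffice for
  Fourier inversion on the residue field, and the character of the upper unipotent group built from
  it is trivial on the part inside K^+. A sum over cosets of that part therefore takes the place of
  a Haar integral, and compact support modulo ZK makes it finite.

  The field is given only as a normed field spanned finitely by the closure of the rationals.
  Discreteness of the valuation and finiteness of the residue field are derived by bounding the
  number of integral elements independent modulo p.

  The exponent n is harmless: transvections along e_2 and e_3 differ from the identity only at the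
  positions (2,3) and (3,2), where Kl(p^n) asks for integrality alone.\<close>

abbreviation nrm :: "'f::{field_char_0, metric_space} \<Rightarrow> real" where
  "nrm x \<equiv> dist x 0"

section \<open>The p-adic absolute value on the rationals\<close>

lemma padic_abs_of_int_le_1: "prime p \<Longrightarrow> padic_abs p (of_int k) \<le> 1"
  by (auto simp: padic_abs_def power_int_def prime_gt_0_nat Suc_le_eq
      intro!: power_le_one simp: inverse_le_1_iff one_le_power field_simps)

lemma padic_abs_p: "prime p \<Longrightarrow> padic_abs p (of_nat p) = 1 / real p"
  using multiplicity_same_power[of "int p" 1] prime_gt_1_nat[of p]
  by (simp add: padic_abs_def quotient_of_int[of "int p", simplified] power_int_def field_simps)

text \<open>The nonzero values are integral powers of p, and the largest of them below 1 is
  1/p.\<close>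

lemma padic_abs_less_1:
  assumes "prime p" "padic_abs p r < 1"
  shows "padic_abs p r \<le> 1 / real p"
proof (cases "r = 0")
  case False
  define k where "k = int (multiplicity (int p) (snd (quotient_of r)))
                  - int (multiplicity (int p) (fst (quotient_of r)))"
  have r: "padic_abs p r = real p powi k"
    using False by (simp add: padic_abs_def k_def)
  have p1: "real p > 1" using assms(1) prime_gt_1_nat by simp
  have "k < 0"
    using assms(2) p1 unfolding r
    by (metis less_le_not_le linorder_not_less one_le_power_int order_less_imp_le)
  hence "real p powi k \<le> real p powi (-1)"
    using p1 by (intro power_int_increasing) auto
  thus ?thesis by (simp add: r field_simps)
qed (simp add: padic_abs_def)

text \<open>The denominator b of a p-integral a/b is prime to p, so b k = a is solvable modulo p. In
  other words, the residue field of the p-integral rationals is Z/p.\<close>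

lemma padic_abs_residue:
  assumes "prime p" "padic_abs p r \<le> 1"
  shows "\<exists>k<p. padic_abs p (r - of_nat k) \<le> 1 / real p"
proof -
  obtain a b where q: "quotient_of r = (a, b)" by force
  have b0: "b > 0" and cop: "coprime a b" and rab: "r = of_int a / of_int b"
    using q quotient_of_denom_pos quotient_of_coprime quotient_of_div by blast+
  have p1: "real p > 1" using assms(1) prime_gt_1_nat by simp
  have pp: "prime (int p)" using assms(1) by simp
  have nb: "\<not> int p dvd b"
  proof
    assume d: "int p dvd b"
    hence na: "\<not> int p dvd a" using cop pp
      by (meson coprime_common_divisor not_prime_unit)
    have "multiplicity (int p) b > 0" 
      using d b0 pp by (simp add: prime_multiplicity_gt_zero_iff)
    moreover have "multiplicity (int p) a = 0" using na by (rule not_dvd_imp_multiplicity_0)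
    moreover have "r \<noteq> 0" using na rab b0 by auto
    ultimately have "padic_abs p r = real p powi int (multiplicity (int p) b)"
      "multiplicity (int p) b > 0"
      using q by (simp_all add: padic_abs_def)
    moreover have "real p ^ multiplicity (int p) b > 1"
      using p1 \<open>multiplicity (int p) b > 0\<close> by simp
    ultimately show False using assms(2) by simp
  qed
  have "coprime b (int p)"
    using prime_imp_coprime[OF pp nb] by (simp add: coprime_commute)
  then obtain c where c: "[b * c = 1] (mod int p)"
    using cong_solve_coprime_int by blast
  define k where "k = nat ((a * c) mod int p)"
  have k: "int k = (a * c) mod int p" "k < p"
    using p1 by (auto simp: k_def nat_less_iff)
  have "[int k = a * c] (mod int p)" by (simp add: k cong_def)
  hence "[b * int k = a * (b * c)] (mod int p)"
    by (metis cong_scalar_left mult.left_commute)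
  also have "[a * (b * c) = a * 1] (mod int p)"
    using c by (intro cong_scalar_left)
  finally have "int p dvd a - b * int k"
    by (simp add: cong_iff_dvd_diff dvd_diff_commute)
  then obtain m where m: "a - b * int k = int p * m" by blast
  define s where "s = r - of_nat k"
  have s: "s = of_int (int p * m) / of_int b"
    unfolding s_def m[symmetric] rab using b0 by (simp add: field_simps)
  obtain x y where xy: "quotient_of s = (x, y)" by force
  have y0: "y > 0" and cxy: "coprime x y" and sxy: "s = of_int x / of_int y"
    using xy quotient_of_denom_pos quotient_of_coprime quotient_of_div by blast+
  have "(of_int (x * b) :: rat) = of_int (int p * m * y)"
    using s sxy y0 b0 by (simp add: field_simps)
  hence eq: "x * b = int p * m * y" by (simp only: of_int_eq_iff)
  hence dx: "int p dvd x" using nb pp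
    by (metis dvd_mult2 dvd_triv_left mult.assoc prime_dvd_mult_iff)
  hence ny: "\<not> int p dvd y" using cxy pp
    by (meson coprime_common_divisor not_prime_unit)
  have "padic_abs p s \<le> 1 / real p"
  proof (cases "s = 0")
    case False
    hence "x \<noteq> 0" using sxy by auto
    hence "multiplicity (int p) x > 0" 
      using dx pp by (simp add: prime_multiplicity_gt_zero_iff)
    moreover have "multiplicity (int p) y = 0" using ny by (rule not_dvd_imp_multiplicity_0)
    ultimately have "padic_abs p s < 1"
      using False p1 by (simp add: padic_abs_def xy power_int_minus field_simps)
    thus ?thesis using assms(1) padic_abs_less_1 by blast
  qed (simp add: padic_abs_def)
  thus ?thesis using k unfolding s_def by blast
qed

section \<open>Nonarchimedean arithmetic in the field F\<close>

locale local_field =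
  fixes p :: nat and T :: "'f::{field_char_0, metric_space} itself"
  assumes fin_ext: "finite_extension_of_Qp p T"
begin

lemma prime_p: "prime p"
  and dist_nrm: "dist x y = nrm (x - y :: 'f)"
  and nrm_mult: "nrm (x * y :: 'f) = nrm x * nrm y"
  and nrm_of_rat: "nrm (of_rat r :: 'f) = padic_abs p r"
  and finite_spanning: "\<exists>B :: 'f set. finite B \<and>
        (\<forall>x. \<exists>c. (\<forall>b\<in>B. c b \<in> Qp_closure) \<and> x = (\<Sum>b\<in>B. c b * b))"
  using fin_ext unfolding finite_extension_of_Qp_def by blast+

lemma nrm_1: "nrm (1::'f) = 1"
  using nrm_mult[of 1 1] by (simp add: dist_commute)

lemma nrm_minus: "nrm (- x :: 'f) = nrm x"
proof -
  have "nrm (-1::'f) * nrm (-1::'f) = 1"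
    using nrm_mult[of "-1" "-1"] nrm_1 by simp
  hence "nrm (-1::'f) = 1"
    by (metis abs_of_nonneg power2_eq_square power2_eq_1_iff zero_le_dist abs_1 abs_minus)
  thus ?thesis using nrm_mult[of "-1" x] by simp
qed

lemma nrm_diff_commute: "nrm (x - y :: 'f) = nrm (y - x)"
  using nrm_minus[of "x - y"] by simp

lemma nrm_inverse: "nrm (inverse x :: 'f) = inverse (nrm x)"
proof (cases "x = 0")
  case False
  hence "nrm x * nrm (inverse x) = 1"
    by (metis nrm_1 nrm_mult right_inverse)
  thus ?thesis by (metis inverse_unique)
qed simp

lemma nrm_divide: "nrm (x / y :: 'f) = nrm x / nrm y"
  by (simp add: divide_inverse nrm_mult nrm_inverse)

lemma nrm_power: "nrm (x ^ n :: 'f) = nrm x ^ n"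
  by (induction n) (simp_all add: nrm_1 nrm_mult)

lemma nrm_triangle: "nrm (x + y :: 'f) \<le> nrm x + nrm y"
  using dist_triangle2[of x "- y" 0] by (simp add: dist_nrm[of x "-y"] nrm_minus)

lemma nrm_sum_triangle: "nrm (\<Sum>i\<in>A. f i :: 'f) \<le> (\<Sum>i\<in>A. nrm (f i))"
proof (induction A rule: infinite_finite_induct)
  case (insert x F)
  thus ?case using nrm_triangle[of "f x" "sum f F"] by simp
qed auto

lemma nrm_of_nat_le_1: "nrm (of_nat n :: 'f) \<le> 1"
  using padic_abs_of_int_le_1[OF prime_p, of "int n"] nrm_of_rat[of "of_nat n"] by simp

lemma nrm_p: "nrm (of_nat p :: 'f) = 1 / real p"
  using padic_abs_p[OF prime_p] nrm_of_rat[of "of_nat p"] by simp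

text \<open>\<open>|x + y|\<^sup>n\<close> is at most \<open>n + 1\<close> times the \<open>n\<close>-th power of the maximum, since binomial
  coefficients have absolute value at most 1.\<close>
lemma nrm_add_le:
  fixes x y :: 'f
  assumes "nrm x \<le> M" "nrm y \<le> M"
  shows "nrm (x + y) \<le> M"
proof (rule ccontr)
  assume "\<not> ?thesis"
  hence gt: "nrm (x + y) > M" by simp
  have M0: "M \<ge> 0" using assms(1) zero_le_dist order_trans by blast
  have bound: "nrm (x + y) ^ n \<le> (1 + real n) * M ^ n" for n
  proof -
    have "nrm (x + y) ^ n = nrm (\<Sum>k\<le>n. of_nat (n choose k) * x ^ k * y ^ (n - k))"
      by (simp add: nrm_power[symmetric] binomial_ring)
    also have "\<dots> \<le> (\<Sum>k\<le>n. nrm (of_nat (n choose k) * x ^ k * y ^ (n - k)))"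
      by (rule nrm_sum_triangle)
    also have "\<dots> \<le> (\<Sum>k\<le>n. M ^ n)"
    proof (rule sum_mono)
      fix k assume k: "k \<in> {..n}"
      have "nrm (of_nat (n choose k) * x ^ k * y ^ (n - k)) \<le> 1 * M ^ k * M ^ (n - k)"
        unfolding nrm_mult nrm_power using assms M0
        by (intro mult_mono nrm_of_nat_le_1 power_mono) auto
      thus "nrm (of_nat (n choose k) * x ^ k * y ^ (n - k)) \<le> M ^ n"
        using k by (simp flip: power_add)
    qed
    finally show ?thesis by simp
  qed
  show False
  proof (cases "M = 0")
    case True
    thus ?thesis using bound[of 1] gt by simp
  next
    case False
    define q where "q = nrm (x + y) / M"
    have q: "q > 1" using gt False M0 by (simp add: q_def)
    \<comment> \<open>A number above 1 has powers that outgrow the linear bound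
      \<open>1 + n\<close>; the limit below makes the contradiction explicit.\<close>
    have qb: "q ^ n \<le> 1 + real n" for n
    proof -
      have "q ^ n = nrm (x + y) ^ n / M ^ n"
        unfolding q_def by (rule power_divide)
      also have "\<dots> \<le> (1 + real n) * M ^ n / M ^ n"
        by (intro divide_right_mono bound) (simp add: M0)
      also have "\<dots> = 1 + real n" using False by simp
      finally show ?thesis .
    qed
    have q': "norm (inverse q) < 1"
      using q by (simp add: inverse_less_1_iff)
    have "(\<lambda>n. inverse q ^ n + of_nat n * inverse q ^ n) \<longlonglongrightarrow> 0 + 0"
      by (intro tendsto_add LIMSEQ_power_zero powser_times_n_limit_0 q')
    hence "(\<lambda>n. (1 + real n) / q ^ n) \<longlonglongrightarrow> 0"
      by (simp add: ring_distribs divide_inverse power_inverse)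
    hence "eventually (\<lambda>n. (1 + real n) / q ^ n < 1) sequentially"
      by (rule order_tendstoD) simp
    then obtain n where "(1 + real n) / q ^ n < 1"
      using eventually_happens'[OF sequentially_bot] by fast
    hence "1 + real n < q ^ n" using q by (simp add: divide_less_eq split: if_splits)
    thus False using qb[of n] by simp
  qed
qed

lemma nrm_add_less:
  "nrm x < M \<Longrightarrow> nrm y < M \<Longrightarrow> nrm (x + y :: 'f) < M"
  by (rule le_less_trans[OF nrm_add_le[of x "max (nrm x) (nrm y)" y]]) auto

lemma nrm_diff_le:
  "nrm x \<le> M \<Longrightarrow> nrm y \<le> M \<Longrightarrow> nrm (x - y :: 'f) \<le> M"
  using nrm_add_le[of x M "-y"] by (simp add: nrm_minus)

lemma nrm_diff_less:
  "nrm x < M \<Longrightarrow> nrm y < M \<Longrightarrow> nrm (x - y :: 'f) < M"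
  using nrm_add_less[of x M "-y"] by (simp add: nrm_minus)

lemma nrm_sum_le:
  assumes "\<And>i. i \<in> A \<Longrightarrow> nrm (f i :: 'f) \<le> M" "M \<ge> 0"
  shows "nrm (\<Sum>i\<in>A. f i) \<le> M"
  using assms by (induction A rule: infinite_finite_induct) (auto intro!: nrm_add_le)

lemma nrm_sum_less:
  assumes "\<And>i. i \<in> A \<Longrightarrow> nrm (f i :: 'f) < M" "M > 0"
  shows "nrm (\<Sum>i\<in>A. f i) < M"
  using assms by (induction A rule: infinite_finite_induct) (auto intro!: nrm_add_less)

text \<open>In an ultrametric the larger of two distinct norms decides the norm of a sum, so a
  perturbation smaller than x cannot change the norm of x.\<close>

lemma nrm_eq_of_close:
  assumes "nrm (x - y :: 'f) < nrm x"
  shows "nrm y = nrm x"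
proof (rule antisym)
  show "nrm y \<le> nrm x"
    using nrm_diff_le[of x "nrm x" "x - y"] assms by simp
  show "nrm x \<le> nrm y"
  proof (rule ccontr)
    assume "\<not> ?thesis"
    thus False using nrm_add_less[of "x - y" "nrm x" y] assms by simp
  qed
qed

end

section \<open>Discreteness of the valuation and finiteness of the residue field\<close>

lemma finite_has_max_value:
  fixes f :: "'a \<Rightarrow> 'b::linorder"
  assumes "finite S" "S \<noteq> {}"
  shows "\<exists>s\<in>S. \<forall>x\<in>S. f x \<le> f s"
proof -
  have "Max (f ` S) \<in> f ` S" using assms by simp
  then obtain s where "s \<in> S" "Max (f ` S) = f s" by blast
  moreover have "f x \<le> Max (f ` S)" if "x \<in> S" for x using assms(1) that by simp
  ultimately show ?thesis by auto
qed

context local_field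
begin

lemma p_gt_1: "real p > 1"
  using prime_p prime_gt_1_nat by simp

lemma padic_abs_1: "padic_abs p 1 = 1"
  using nrm_of_rat[of 1] nrm_1 by simp

lemma padic_abs_divide: "padic_abs p (a / b) = padic_abs p a / padic_abs p b"
  by (simp flip: nrm_of_rat add: of_rat_divide nrm_divide)

text \<open>Each coordinate is a limit of rationals. Approximating the coordinate of b within
  1/(p(|b| + 1)) keeps every term of the error at most 1/p, and the ultrametric inequality keeps the
  sum there.\<close>

lemma rational_span_dense:
  assumes "finite B" "\<forall>x::'f. \<exists>c. (\<forall>b\<in>B. c b \<in> Qp_closure) \<and> x = (\<Sum>b\<in>B. c b * b)"
  shows "\<exists>r. nrm (x - (\<Sum>b\<in>B. of_rat (r b) * b)) \<le> 1 / real p"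
proof -
  obtain c where c: "\<And>b. b \<in> B \<Longrightarrow> c b \<in> Qp_closure" "x = (\<Sum>b\<in>B. c b * b)"
    using assms(2) by blast
  have "\<forall>b\<in>B. \<exists>r. nrm (c b - of_rat r) * nrm b \<le> 1 / real p"
  proof
    fix b assume b: "b \<in> B"
    define e where "e = 1 / (real p * (nrm b + 1))"
    have pos: "nrm b + 1 > 0" by (simp add: add_nonneg_pos)
    hence e: "e > 0" using p_gt_1 by (simp add: e_def)
    obtain r where r: "dist (of_rat r) (c b) < e"
      using c(1)[OF b] e unfolding Qp_closure_def closure_approachable by blast
    hence "nrm (c b - of_rat r) \<le> e"
      by (simp add: dist_nrm[of "of_rat r"] nrm_diff_commute)
    hence "nrm (c b - of_rat r) * nrm b \<le> e * (nrm b + 1)"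
      using e by (intro mult_mono) auto
    also have "\<dots> = 1 / real p" using pos by (simp add: e_def)
    finally show "\<exists>r. nrm (c b - of_rat r) * nrm b \<le> 1 / real p" by blast
  qed
  then obtain r where r: "\<And>b. b \<in> B \<Longrightarrow> nrm (c b - of_rat (r b)) * nrm b \<le> 1 / real p"
    by metis
  have "x - (\<Sum>b\<in>B. of_rat (r b) * b) = (\<Sum>b\<in>B. (c b - of_rat (r b)) * b)"
    by (simp add: c(2) left_diff_distrib sum_subtractf)
  moreover have "nrm \<dots> \<le> 1 / real p"
    using r by (intro nrm_sum_le) (auto simp: nrm_mult)
  ultimately show ?thesis by (intro exI[of _ r]) simp
qed

text \<open>Linear independence over Z/p of the classes of S in o/po, with p-integral rationals
  lifting the scalars. Rational coefficients make it possible to work in vector spaces over the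
  rationals instead of over the set \<open>Qp_closure\<close>.\<close>

definition independent_mod_p :: "'f set \<Rightarrow> bool" where
  "independent_mod_p S \<longleftrightarrow> finite S \<and> (\<forall>s\<in>S. nrm s \<le> 1) \<and>
     (\<forall>q. (\<forall>s\<in>S. padic_abs p (q s) \<le> 1) \<and> nrm (\<Sum>s\<in>S. of_rat (q s) * s) \<le> 1 / real p
       \<longrightarrow> (\<forall>s\<in>S. padic_abs p (q s) < 1))"

text \<open>A nontrivial relation can be divided by a coefficient of maximal absolute value, which
  makes all coefficients p-integral and one of them 1. Replacing each \<open>e s\<close> by
  \<open>s\<close> costs at most 1/p, so independence modulo p would force that coefficient 1 below
  1.\<close>

lemma no_rational_relation:
  assumes S: "independent_mod_p S"
    and e: "\<And>s. s \<in> S \<Longrightarrow> nrm (s - e s) \<le> 1 / real p"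
    and rel: "(\<Sum>s\<in>S. of_rat (q s) * e s) = 0"
  shows "\<forall>s\<in>S. q s = 0"
proof (rule ccontr)
  assume "\<not> ?thesis"
  then obtain s1 where s1: "s1 \<in> S" "q s1 \<noteq> 0" by blast
  have fin: "finite S" using S by (simp add: independent_mod_p_def)
  obtain s0 where s0: "s0 \<in> S" "\<And>s. s \<in> S \<Longrightarrow> padic_abs p (q s) \<le> padic_abs p (q s0)"
    using finite_has_max_value[OF fin, of "\<lambda>s. padic_abs p (q s)"] s1(1) by blast
  have "padic_abs p (q s1) > 0"
    unfolding nrm_of_rat[symmetric] using s1 by simp
  hence pos: "padic_abs p (q s0) > 0" using s0(2)[OF s1(1)] by simp
  hence q0: "q s0 \<noteq> 0" by (auto simp: padic_abs_def)
  define r where "r s = q s / q s0" for s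
  have r: "padic_abs p (r s) \<le> 1" if "s \<in> S" for s
    using s0(2)[OF that] pos by (simp add: r_def padic_abs_divide)
  have "(\<Sum>s\<in>S. of_rat (r s) * e s) = (\<Sum>s\<in>S. of_rat (q s) * e s) / of_rat (q s0)"
    by (simp add: r_def of_rat_divide sum_divide_distrib)
  hence "(\<Sum>s\<in>S. of_rat (r s) * s) = (\<Sum>s\<in>S. of_rat (r s) * (s - e s))"
    by (simp add: rel right_diff_distrib sum_subtractf)
  moreover have "nrm \<dots> \<le> 1 / real p"
  proof (rule nrm_sum_le)
    fix s assume "s \<in> S"
    hence "padic_abs p (r s) * nrm (s - e s) \<le> 1 * (1 / real p)"
      by (intro mult_mono r e) auto
    thus "nrm (of_rat (r s) * (s - e s)) \<le> 1 / real p"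
      by (simp add: nrm_mult nrm_of_rat)
  qed simp
  ultimately have "padic_abs p (r s0) < 1"
    using S r s0(1) unfolding independent_mod_p_def by auto
  thus False using q0 by (simp add: r_def padic_abs_1)
qed

text \<open>The elements of S can be moved into the rational span of B by errors that vanish modulo
  p. They stay independent over the rationals, and that span has dimension at most
  \<open>card B\<close>.\<close>

lemma card_independent_mod_p:
  assumes B: "finite B" "\<forall>x::'f. \<exists>c. (\<forall>b\<in>B. c b \<in> Qp_closure) \<and> x = (\<Sum>b\<in>B. c b * b)"
    and S: "independent_mod_p S"
  shows "card S \<le> card B"
proof -
  interpret Qv: vector_space "\<lambda>(r::rat) (x::'f). of_rat r * x"
    by unfold_locales (simp_all add: algebra_simps of_rat_add of_rat_mult)
  have fin: "finite S" using S by (simp add: independent_mod_p_def)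
  obtain c where c: "\<And>s. nrm (s - (\<Sum>b\<in>B. of_rat (c s b) * b)) \<le> 1 / real p"
    using rational_span_dense[OF B] by metis
  define e where "e s = (\<Sum>b\<in>B. of_rat (c s b) * b)" for s
  note rel = no_rational_relation[OF S, of e, unfolded e_def, OF c, folded e_def]
  have span: "e s \<in> Qv.span B" for s
    unfolding e_def by (intro Qv.span_sum Qv.span_scale Qv.span_base)
  have inj: "inj_on e S"
  proof (rule inj_onI, rule ccontr)
    fix s t assume st: "s \<in> S" "t \<in> S" "e s = e t" "s \<noteq> t"
    define q :: "'f \<Rightarrow> rat" where "q = (\<lambda>_. 0)(s := 1, t := -1)"
    have "(\<Sum>x\<in>S. of_rat (q x) * e x) = (\<Sum>x\<in>{s,t}. of_rat (q x) * e x)"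
      using fin st by (intro sum.mono_neutral_right) (auto simp: q_def)
    also have "\<dots> = 0" using st by (simp add: q_def)
    finally have "q t = 0" using rel[of q] st by blast
    thus False by (simp add: q_def)
  qed
  have "Qv.independent (e ` S)"
  proof
    assume "Qv.dependent (e ` S)"
    then obtain u v where u: "v \<in> e ` S" "u v \<noteq> 0" "(\<Sum>v\<in>e ` S. of_rat (u v) * v) = 0"
      using Qv.dependent_finite[of "e ` S"] fin by auto
    have "(\<Sum>s\<in>S. of_rat ((u \<circ> e) s) * e s) = 0"
      using u(3) by (simp add: sum.reindex[OF inj])
    from rel[OF this] u(1,2) show False by auto
  qed
  hence "card (e ` S) \<le> card B"
    using Qv.independent_span_bound[OF B(1)] span by blast
  thus ?thesis by (simp add: card_image[OF inj])
qed

text \<open>A set S of maximal size independent modulo p spans o/po over Z/p: adjoining any further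
  integral x creates a relation in which x has a unit coefficient. Combinations of S with digits 0,
  ..., p - 1 then represent all classes.\<close>

lemma finite_residues_mod_p:
  "\<exists>R. finite R \<and> (\<forall>x::'f. nrm x \<le> 1 \<longrightarrow> (\<exists>r\<in>R. nrm (x - r) \<le> 1 / real p))"
proof -
  obtain B :: "'f set" where B: "finite B"
    "\<forall>x::'f. \<exists>c. (\<forall>b\<in>B. c b \<in> Qp_closure) \<and> x = (\<Sum>b\<in>B. c b * b)"
    using finite_spanning by blast
  have "independent_mod_p {}" by (simp add: independent_mod_p_def)
  moreover have "\<forall>S. independent_mod_p S \<longrightarrow> card S < Suc (card B)"
    using card_independent_mod_p[OF B] by (simp add: less_Suc_eq_le)
  ultimately obtain S where S: "independent_mod_p S"
    and max: "\<And>S'. independent_mod_p S' \<Longrightarrow> card S' \<le> card S"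
    using ex_has_greatest_nat[of independent_mod_p "{}" card "Suc (card B)"] by blast
  have fin: "finite S" and S1: "\<And>s. s \<in> S \<Longrightarrow> nrm s \<le> 1"
    using S by (auto simp: independent_mod_p_def)
  have comb: "\<exists>q. (\<forall>s\<in>S. padic_abs p (q s) \<le> 1) \<and>
      nrm (x - (\<Sum>s\<in>S. of_rat (q s) * s)) \<le> 1 / real p" if x: "nrm x \<le> 1" for x
  proof (cases "x \<in> S")
    case True
    define q :: "'f \<Rightarrow> rat" where "q = (\<lambda>_. 0)(x := 1)"
    have "(\<Sum>s\<in>S. of_rat (q s) * s) = (\<Sum>s\<in>{x}. of_rat (q s) * s)"
      using fin True by (intro sum.mono_neutral_right) (auto simp: q_def)
    hence "x - (\<Sum>s\<in>S. of_rat (q s) * s) = 0" by (simp add: q_def)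
    moreover have "\<forall>s\<in>S. padic_abs p (q s) \<le> 1"
      by (simp add: q_def padic_abs_1 padic_abs_def[of p 0])
    ultimately show ?thesis by (intro exI[of _ q]) auto
  next
    case False
    hence "\<not> independent_mod_p (insert x S)"
      using max[of "insert x S"] fin by auto
    then obtain q t where q: "\<And>s. s \<in> insert x S \<Longrightarrow> padic_abs p (q s) \<le> 1"
      and rel: "nrm (\<Sum>s\<in>insert x S. of_rat (q s) * s) \<le> 1 / real p"
      and t: "t \<in> insert x S" "\<not> padic_abs p (q t) < 1"
      using fin x S1 unfolding independent_mod_p_def by auto
    have rel': "nrm (of_rat (q x) * x + (\<Sum>s\<in>S. of_rat (q s) * s)) \<le> 1 / real p"
      using rel fin False by simp
    \<comment> \<open>If p divided the coefficient of x, the term of x could be dropped modulo p,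
      leaving a forbidden relation in S alone.\<close>
    have "\<not> padic_abs p (q x) < 1"
    proof
      assume less: "padic_abs p (q x) < 1"
      hence "padic_abs p (q x) * nrm x \<le> (1 / real p) * 1"
        using padic_abs_less_1[OF prime_p less] x by (intro mult_mono) auto
      hence "nrm (of_rat (q x) * x) \<le> 1 / real p"
        by (simp add: nrm_mult nrm_of_rat)
      from nrm_diff_le[OF rel' this] have "nrm (\<Sum>s\<in>S. of_rat (q s) * s) \<le> 1 / real p"
        by simp
      hence "\<forall>s\<in>S. padic_abs p (q s) < 1"
        using S q unfolding independent_mod_p_def by auto
      thus False using t less by auto
    qed
    hence qx: "padic_abs p (q x) = 1" using q[of x] by auto
    hence qx0: "q x \<noteq> 0" by (auto simp: padic_abs_def)
    define r where "r s = - (q s / q x)" for s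
    have "x - (\<Sum>s\<in>S. of_rat (r s) * s)
        = (of_rat (q x) * x + (\<Sum>s\<in>S. of_rat (q s) * s)) / of_rat (q x)"
      using qx0 by (simp add: r_def of_rat_divide of_rat_minus sum_negf add_divide_distrib
          sum_divide_distrib)
    moreover have "nrm \<dots> \<le> 1 / real p"
      using rel' by (simp add: nrm_divide nrm_of_rat qx)
    moreover have "padic_abs p (r s) \<le> 1" if "s \<in> S" for s
    proof -
      have "padic_abs p (r s) = nrm (of_rat (q s) / of_rat (q x) :: 'f)"
        unfolding r_def by (simp flip: nrm_of_rat add: of_rat_minus of_rat_divide nrm_minus)
      thus ?thesis using q[of s] that by (simp add: nrm_divide nrm_of_rat qx)
    qed
    ultimately show ?thesis by (intro exI[of _ r]) auto
  qed
  define R where "R = (\<lambda>b. \<Sum>s\<in>S. of_nat (b s) * s) ` (S \<rightarrow>\<^sub>E {..<p})"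
  have "finite R" unfolding R_def using fin by (intro finite_imageI finite_PiE) auto
  moreover have "\<exists>r\<in>R. nrm (x - r) \<le> 1 / real p" if x: "nrm x \<le> 1" for x
  proof -
    obtain q where q: "\<And>s. s \<in> S \<Longrightarrow> padic_abs p (q s) \<le> 1"
      "nrm (x - (\<Sum>s\<in>S. of_rat (q s) * s)) \<le> 1 / real p"
      using comb[OF x] by blast
    have "\<forall>s\<in>S. \<exists>k<p. padic_abs p (q s - of_nat k) \<le> 1 / real p"
      using padic_abs_residue[OF prime_p q(1)] by blast
    then obtain b0 where b0: "\<And>s. s \<in> S \<Longrightarrow> b0 s < p \<and> padic_abs p (q s - of_nat (b0 s)) \<le> 1 / real p"
      by metis
    define b where "b = restrict b0 S"
    have bR: "(\<Sum>s\<in>S. of_nat (b s) * s) \<in> R"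
      unfolding R_def b_def using b0 by (intro imageI) auto
    have b: "padic_abs p (q s - of_nat (b s)) \<le> 1 / real p" if "s \<in> S" for s
      using b0 that by (simp add: b_def)
    have "nrm (\<Sum>s\<in>S. of_rat (q s - of_nat (b s)) * s) \<le> 1 / real p"
    proof (rule nrm_sum_le)
      fix s assume s: "s \<in> S"
      have "padic_abs p (q s - of_nat (b s)) * nrm s \<le> (1 / real p) * 1"
        by (intro mult_mono b S1 s) auto
      thus "nrm (of_rat (q s - of_nat (b s)) * s) \<le> 1 / real p"
        by (simp add: nrm_mult nrm_of_rat)
    qed simp
    from nrm_add_le[OF q(2) this]
    have "nrm (x - (\<Sum>s\<in>S. of_nat (b s) * s)) \<le> 1 / real p"
      by (simp add: of_rat_diff left_diff_distrib sum_subtractf)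
    thus ?thesis using bR by blast
  qed
  ultimately show ?thesis by blast
qed

text \<open>An element of norm above 1/p has the same norm as its representative modulo p. Hence
  only finitely many values lie strictly between 1/p and 1, and 1/p itself is attained by p.\<close>

lemma uniformizer_exists:
  "\<exists>w::'f. 0 < nrm w \<and> nrm w < 1 \<and> (\<forall>x::'f. nrm x < 1 \<longrightarrow> nrm x \<le> nrm w)"
proof -
  obtain R where R: "finite R" "\<And>x::'f. nrm x \<le> 1 \<Longrightarrow> \<exists>r\<in>R. nrm (x - r) \<le> 1 / real p"
    using finite_residues_mod_p by blast
  define A where "A = insert (of_nat p) {r\<in>R. nrm r < 1}"
  have A: "finite A" "A \<noteq> {}" using R(1) by (auto simp: A_def)
  obtain w where w: "w \<in> A" "\<And>a. a \<in> A \<Longrightarrow> nrm a \<le> nrm w"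
    using finite_has_max_value[OF A, of nrm] by blast
  have p1: "1 / real p > 0" "1 / real p < 1" using p_gt_1 by auto
  have wp: "nrm w \<ge> 1 / real p"
    using w(2)[of "of_nat p"] by (simp add: A_def nrm_p)
  moreover have "nrm w < 1" using w(1) p1 by (auto simp: A_def nrm_p)
  moreover have "nrm x \<le> nrm w" if x: "nrm x < 1" for x :: 'f
  proof (cases "nrm x \<le> 1 / real p")
    case True
    thus ?thesis using wp by simp
  next
    case False
    obtain r where r: "r \<in> R" "nrm (x - r) \<le> 1 / real p" using R(2)[of x] x by auto
    hence "nrm r = nrm x" using False by (intro nrm_eq_of_close) auto
    thus ?thesis using w(2)[of r] r(1) x by (simp add: A_def)
  qed
  ultimately show ?thesis using p1 by (meson order_less_le_trans)
qed

text \<open>The choice depends only on the predicate \<open>nrm (x - y) < 1\<close>, which is the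
  same for all members of a class modulo the maximal ideal; so \<open>rep\<close> is constant on
  classes. The value \<open>rep 0\<close> may differ from 0.\<close>

definition rep :: "'f \<Rightarrow> 'f" where
  "rep x = (SOME y. nrm (x - y) < 1)"

lemma nrm_sub_rep: "nrm (x - rep x) < 1"
  unfolding rep_def by (rule someI[of _ x]) simp

lemma nrm_congruent:
  assumes "nrm (x - y :: 'f) < 1"
  shows "nrm (x - z) < 1 \<longleftrightarrow> nrm (y - z) < 1"
  using nrm_diff_less[of "x - z" 1 "x - y"] nrm_add_less[of "x - y" 1 "y - z"] assms by auto

lemma rep_eq_iff: "rep x = rep y \<longleftrightarrow> nrm (x - y) < 1"
proof
  assume eq: "rep x = rep y"
  show "nrm (x - y) < 1"
    using nrm_diff_less[OF nrm_sub_rep[of x] nrm_sub_rep[of y]] eq by simp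
next
  assume "nrm (x - y) < 1"
  hence "(\<lambda>z. nrm (x - z) < 1) = (\<lambda>z. nrm (y - z) < 1)"
    by (intro ext nrm_congruent)
  thus "rep x = rep y" by (simp add: rep_def)
qed

lemma nrm_rep_le: "nrm x \<le> 1 \<Longrightarrow> nrm (rep x) \<le> 1"
  using nrm_diff_le[of x 1 "x - rep x"] nrm_sub_rep[of x] by simp

definition residues :: "'f set" where
  "residues = rep ` {x. nrm x \<le> 1}"

lemma finite_residues: "finite residues"
proof -
  obtain R where R: "finite R" "\<And>x::'f. nrm x \<le> 1 \<Longrightarrow> \<exists>r\<in>R. nrm (x - r) \<le> 1 / real p"
    using finite_residues_mod_p by blast
  have "residues \<subseteq> rep ` R"
  proof
    fix y assume "y \<in> residues"
    then obtain x where x: "nrm x \<le> 1" "y = rep x" by (auto simp: residues_def)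
    obtain r where r: "r \<in> R" "nrm (x - r) \<le> 1 / real p" using R(2)[OF x(1)] by blast
    have "1 / real p < 1" using p_gt_1 by simp
    hence "y = rep r" using x r(2) by (simp add: rep_eq_iff)
    thus "y \<in> rep ` R" using r(1) by blast
  qed
  thus ?thesis using R(1) finite_surj by blast
qed

lemma residues_nrm_le: "x \<in> residues \<Longrightarrow> nrm x \<le> 1"
  by (auto simp: residues_def nrm_rep_le)

lemma rep_residues: "x \<in> residues \<Longrightarrow> rep x = x"
  unfolding residues_def using nrm_sub_rep by (auto simp: rep_eq_iff nrm_diff_commute)

lemma card_residues_pos: "card residues > 0"
  using finite_residues by (auto simp: card_gt_0_iff residues_def intro: exI[of _ 0])

text \<open>Translation by an integral element permutes the residue classes and g factors through
  them; \<open>rep\<close> corrects for x + y not being a chosen representative.\<close>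

lemma sum_residues_shift:
  fixes g :: "'f \<Rightarrow> 'b::comm_monoid_add"
  assumes g: "\<And>x y. nrm x \<le> 1 \<Longrightarrow> nrm y \<le> 1 \<Longrightarrow> nrm (x - y) < 1 \<Longrightarrow> g x = g y"
    and y: "nrm y \<le> 1"
  shows "(\<Sum>x\<in>residues. g (x + y)) = (\<Sum>x\<in>residues. g x)"
proof (rule sum.reindex_bij_witness[of _ "\<lambda>x. rep (x - y)" "\<lambda>x. rep (x + y)"])
  fix x assume x: "x \<in> residues"
  note x1 = residues_nrm_le[OF x]
  show "rep (rep (x + y) - y) = x" "rep (rep (x - y) + y) = x"
    using nrm_sub_rep[of "x + y"] nrm_sub_rep[of "x - y"] rep_residues[OF x]
    by (metis add_diff_cancel_right' diff_diff_eq2 diff_add_eq nrm_diff_commute rep_eq_iff)+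
  show "rep (x + y) \<in> residues" "rep (x - y) \<in> residues"
    unfolding residues_def using x1 y by (auto intro!: imageI nrm_add_le nrm_diff_le)
  show "g (rep (x + y)) = g (x + y)"
    using x1 y nrm_sub_rep[of "x + y"]
    by (intro g) (auto intro!: nrm_rep_le nrm_add_le simp: nrm_diff_commute)
qed

end

section \<open>Additive characters of F, extended one element at a time\<close>

text \<open>A graph of a unitary character of a subgroup; the last condition makes it single-valued.\<close>
definition character_graph :: "('a::ab_group_add \<times> complex) set \<Rightarrow> bool" where
  "character_graph M \<longleftrightarrow> (0, 1) \<in> M \<and>
     (\<forall>x z y w. (x, z) \<in> M \<longrightarrow> (y, w) \<in> M \<longrightarrow> (x - y, z / w) \<in> M) \<and>
     (\<forall>x z. (x, z) \<in> M \<longrightarrow> cmod z = 1) \<and> (\<forall>z. (0, z) \<in> M \<longrightarrow> z = 1)"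

lemma character_graph_diff:
  "character_graph M \<Longrightarrow> (x, z) \<in> M \<Longrightarrow> (y, w) \<in> M \<Longrightarrow> (x - y, z / w) \<in> M"
  and character_graph_0: "character_graph M \<Longrightarrow> (0, 1) \<in> M"
  and character_graph_norm: "character_graph M \<Longrightarrow> (x, z) \<in> M \<Longrightarrow> cmod z = 1"
  and character_graph_0D: "character_graph M \<Longrightarrow> (0, z) \<in> M \<Longrightarrow> z = 1"
  by (auto simp: character_graph_def)

lemma character_graph_unique:
  assumes "character_graph M" "(x, z) \<in> M" "(x, w) \<in> M"
  shows "z = w"
proof -
  have "z / w = 1" "cmod w = 1"
    using assms character_graph_diff[OF assms] by (auto simp: character_graph_def)
  thus ?thesis by (metis divide_eq_1_iff norm_zero zero_neq_one)
qed

lemma character_graph_uminus: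
  "character_graph M \<Longrightarrow> (x, z) \<in> M \<Longrightarrow> (- x, 1 / z) \<in> M"
  using character_graph_diff[of M 0 1 x z] by (simp add: character_graph_0)

lemma character_graph_add:
  assumes "character_graph M" "(x, z) \<in> M" "(y, w) \<in> M"
  shows "(x + y, z * w) \<in> M"
  using character_graph_diff[OF assms(1,2) character_graph_uminus[OF assms(1,3)]] by simp

lemma character_graph_of_int:
  fixes x :: "'a::ring_1"
  assumes M: "character_graph M" and x: "(x, z) \<in> M"
  shows "(of_int k * x, z powi k) \<in> M"
proof -
  have nat: "(of_nat n * x, z ^ n) \<in> M" for n
  proof (induction n)
    case (Suc n)
    thus ?case using character_graph_add[OF M x Suc] by (simp add: algebra_simps)
  qed (simp add: character_graph_0[OF M])
  show ?thesis
  proof (cases k)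
    case (nonneg n)
    thus ?thesis using nat[of n] by simp
  next
    case (neg n)
    thus ?thesis using character_graph_uminus[OF M nat[of "Suc n"]]
      by (simp add: power_int_minus field_simps del: of_nat_Suc power_Suc)
  qed
qed

lemma character_graph_Union:
  assumes "C \<noteq> {}" "subset.chain {M. character_graph M} C"
  shows "character_graph (\<Union>C)"
proof -
  have M: "character_graph M" if "M \<in> C" for M
    using assms(2) that by (auto simp: subset.chain_def)
  have two: "\<exists>M\<in>C. u \<in> M \<and> v \<in> M" if "u \<in> \<Union>C" "v \<in> \<Union>C" for u v
  proof -
    obtain A B where AB: "A \<in> C" "B \<in> C" "u \<in> A" "v \<in> B" using \<open>u \<in> _\<close> \<open>v \<in> _\<close> by blast
    hence "A \<subseteq> B \<or> B \<subseteq> A" using assms(2) by (auto simp: subset_chain_def)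
    thus ?thesis using AB by blast
  qed
  show ?thesis
    unfolding character_graph_def
  proof (intro conjI allI impI)
    show "(0, 1) \<in> \<Union>C" using assms(1) M by (auto simp: character_graph_def)
  next
    fix x z y w assume "(x, z) \<in> \<Union>C" "(y, w) \<in> \<Union>C"
    then obtain A where "A \<in> C" "(x, z) \<in> A" "(y, w) \<in> A" using two by blast
    thus "(x - y, z / w) \<in> \<Union>C" using character_graph_diff[OF M] by blast
  next
    fix x z assume "(x, z) \<in> \<Union>C"
    thus "cmod z = 1" using M character_graph_norm by blast
  next
    fix z assume "(0, z) \<in> \<Union>C"
    thus "z = 1" using M character_graph_0D by blast
  qed
qed

text \<open>If k a were in the domain for some k prime to p, Bezout would put a there as well. So
  only multiples of p matter for consistency, and any p-th root of the value at p a is an admissible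
  value at a.\<close>

lemma character_graph_extend:
  fixes a :: "'a::comm_ring_1"
  assumes p: "prime (p::nat)" and M: "character_graph M"
    and a: "\<And>z. (a, z) \<notin> M" and pa: "(of_nat p * a, w) \<in> M"
    and zeta: "\<zeta> ^ p = w"
  shows "\<exists>M'. character_graph M' \<and> M \<subseteq> M' \<and> (a, \<zeta>) \<in> M'"
proof -
  have p0: "p > 0" using p prime_gt_0_nat by simp
  have w1: "cmod w = 1" using character_graph_norm[OF M pa] .
  have z1: "cmod \<zeta> = 1"
  proof -
    have "cmod \<zeta> ^ p = 1" using zeta w1 by (simp flip: norm_power)
    hence "cmod \<zeta> ^ p = 1 ^ p" by simp
    thus ?thesis by (rule power_eq_imp_eq_base) (simp_all add: p0)
  qed
  hence z0: "\<zeta> \<noteq> 0" by auto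
  have dvd: "int p dvd k" if "(of_int k * a, v) \<in> M" for k v
  proof (rule ccontr)
    assume "\<not> int p dvd k"
    hence "coprime (int p) k" using p by (intro prime_imp_coprime) auto
    then obtain r s where rs: "r * int p + s * k = 1"
      by (metis bezout_int coprime_imp_gcd_eq_1)
    have "(of_int r * (of_nat p * a) + of_int s * (of_int k * a), w powi r * v powi s) \<in> M"
      by (intro character_graph_add M character_graph_of_int pa that)
    moreover have "of_int r * (of_nat p * a) + of_int s * (of_int k * a) = of_int (r * int p + s * k) * a"
      by (simp add: algebra_simps)
    ultimately show False using a by (simp add: rs)
  qed
  define M' where "M' = {(x + of_int k * a, z * \<zeta> powi k) | x z k. (x, z) \<in> M}"
  have in_M': "(x + of_int k * a, z * \<zeta> powi k) \<in> M'" if "(x, z) \<in> M" for x z k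
    using that unfolding M'_def by blast
  have "character_graph M'"
    unfolding character_graph_def
  proof (intro conjI allI impI)
    show "(0, 1) \<in> M'" using in_M'[OF character_graph_0[OF M], of 0] by simp
  next
    fix x z y u assume "(x, z) \<in> M'" "(y, u) \<in> M'"
    then obtain x' z' k y' u' l where *: "x = x' + of_int k * a" "z = z' * \<zeta> powi k" "(x', z') \<in> M"
      "y = y' + of_int l * a" "u = u' * \<zeta> powi l" "(y', u') \<in> M"
      unfolding M'_def by blast
    have "(x' - y' + of_int (k - l) * a, z' / u' * \<zeta> powi (k - l)) \<in> M'"
      by (intro in_M' character_graph_diff M *)
    also have "x' - y' + of_int (k - l) * a = x - y" by (simp add: * algebra_simps)
    also have "z' / u' * \<zeta> powi (k - l) = z / u" using z0 by (simp add: * power_int_diff)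
    finally show "(x - y, z / u) \<in> M'" .
  next
    fix x z assume "(x, z) \<in> M'"
    then obtain y v k where "z = v * \<zeta> powi k" "(y, v) \<in> M"
      unfolding M'_def by blast
    thus "cmod z = 1" using character_graph_norm[OF M] z1
      by (simp add: norm_mult norm_power_int)
  next
    fix z assume "(0, z) \<in> M'"
    then obtain x v k where *: "x + of_int k * a = 0" "z = v * \<zeta> powi k" "(x, v) \<in> M"
      unfolding M'_def by auto
    have x: "- x = of_int k * a" using *(1) by (rule minus_unique)
    have mem: "(of_int k * a, 1 / v) \<in> M" using character_graph_uminus[OF M *(3)] by (simp add: x)
    obtain m where k: "k = int p * m" using dvd[OF mem] by blast
    have "(of_int m * (of_nat p * a), w powi m) \<in> M" by (rule character_graph_of_int[OF M pa])
    hence "(of_int k * a, w powi m) \<in> M" by (simp add: k algebra_simps)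
    from character_graph_unique[OF M this mem] have "w powi m = 1 / v" .
    moreover have "w powi m = \<zeta> powi k"
      by (simp add: k power_int_mult zeta)
    moreover have "v \<noteq> 0" using character_graph_norm[OF M *(3)] by auto
    ultimately show "z = 1" by (simp add: *(2))
  qed
  moreover have "M \<subseteq> M'" using in_M'[of _ _ 0] by auto
  moreover have "(a, \<zeta>) \<in> M'" using in_M'[OF character_graph_0[OF M], of 1] by simp
  ultimately show ?thesis by blast
qed

context local_field
begin

text \<open>Start from the trivial character of the maximal ideal. It contains p but not 1, so 1 may
  be sent to a nontrivial p-th root of unity. A maximal extension is defined everywhere: some p^n a
  lies in the maximal ideal, and one can divide by p step by step because unit complex numbers have
  p-th roots.\<close>

lemma unramified_character_exists:
  "\<exists>\<psi> :: 'f \<Rightarrow> complex. (\<forall>x. cmod (\<psi> x) = 1) \<and> (\<forall>x y. \<psi> (x + y) = \<psi> x * \<psi> y) \<and>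
     (\<forall>x. nrm x < 1 \<longrightarrow> \<psi> x = 1) \<and> \<psi> 1 \<noteq> 1"
proof -
  define M0 where "M0 = {(x, 1 :: complex) | x :: 'f. nrm x < 1}"
  have M0: "character_graph M0"
    by (auto simp: character_graph_def M0_def intro: nrm_diff_less)
  define \<zeta> where "\<zeta> = cis (2 * pi / p)"
  have p2: "real p \<ge> 2" using prime_p prime_ge_2_nat by simp
  have zp: "\<zeta> ^ p = 1" 
  proof -
    have "real p * (2 * pi / p) = 2 * pi" using p2 by (simp del: of_nat_le_iff)
    hence "cis (real p * (2 * pi / p)) = 1" by (simp only: cis_2pi)
    thus ?thesis unfolding \<zeta>_def Complex.DeMoivre .
  qed
  have z1: "\<zeta> \<noteq> 1"
  proof
    assume "\<zeta> = 1"
    hence "cos (2 * pi / p) = 1" by (simp add: \<zeta>_def complex_eq_iff)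
    moreover have "cos (2 * pi / p) < cos 0"
      using p2 by (intro cos_monotone_0_pi) (auto simp: field_simps)
    ultimately show False by simp
  qed
  have "nrm (of_nat p * 1 :: 'f) < 1" using p_gt_1 by (simp add: nrm_p)
  hence "(of_nat p * 1, 1) \<in> M0" unfolding M0_def by blast
  moreover have "(1, z) \<notin> M0" for z by (simp add: M0_def nrm_1)
  ultimately obtain M1 where M1: "character_graph M1" "M0 \<subseteq> M1" "(1, \<zeta>) \<in> M1"
    using character_graph_extend[OF prime_p M0 _ _ zp] by blast
  define \<A> where "\<A> = {M. character_graph M \<and> M1 \<subseteq> M}"
  have "\<exists>M\<in>\<A>. \<forall>X\<in>\<A>. M \<subseteq> X \<longrightarrow> X = M"
  proof (rule subset_Zorn_nonempty)
    show "\<A> \<noteq> {}" using M1(1) by (auto simp: \<A>_def)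
    fix C assume C: "C \<noteq> {}" "subset.chain \<A> C"
    hence "subset.chain {M. character_graph M} C" by (auto simp: subset.chain_def \<A>_def)
    hence "character_graph (\<Union>C)" using C(1) by (intro character_graph_Union)
    moreover have "M1 \<subseteq> \<Union>C"
    proof -
      obtain X where "X \<in> C" using C(1) by blast
      thus ?thesis using C(2) by (auto simp: subset.chain_def \<A>_def)
    qed
    ultimately show "\<Union>C \<in> \<A>" by (simp add: \<A>_def)
  qed
  then obtain M where M: "character_graph M" "M1 \<subseteq> M"
    and max: "\<And>X. character_graph X \<Longrightarrow> M \<subseteq> X \<Longrightarrow> X = M"
    by (auto simp: \<A>_def)
  have step: "\<exists>z. (a, z) \<in> M" if pa: "(of_nat p * a, w) \<in> M" for a w
  proof (rule ccontr)
    assume na: "\<nexists>z. (a, z) \<in> M"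
    have p0: "p > 0" using prime_p prime_gt_0_nat by simp
    obtain \<eta> where eta: "\<eta> ^ p = w"
    proof -
      have "w = rcis (cmod w) (Arg w)" by (simp add: rcis_cmod_Arg)
      hence "w = cis (Arg w)" using character_graph_norm[OF M(1) pa] by (simp add: rcis_def)
      hence "cis (Arg w / p) ^ p = w" using p0 by (simp add: Complex.DeMoivre)
      thus ?thesis using that by blast
    qed
    obtain M' where M': "character_graph M'" "M \<subseteq> M'" "(a, \<eta>) \<in> M'"
      using character_graph_extend[OF prime_p M(1) _ pa eta] na by blast
    thus False using max[OF M'(1,2)] na by blast
  qed
  have total: "\<exists>z. (a, z) \<in> M" for a
  proof -
    have pw: "\<exists>z. (of_nat p ^ n * a, z) \<in> M \<Longrightarrow> \<exists>z. (a, z) \<in> M" for n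
    proof (induction n)
      case (Suc n)
      thus ?case using step[of "of_nat p ^ n * a"] by (auto simp: mult.assoc)
    qed simp
    have "(\<lambda>n. (1 / real p) ^ n * nrm a) \<longlonglongrightarrow> 0 * nrm a"
      using p_gt_1 by (intro tendsto_mult LIMSEQ_power_zero) auto
    hence "eventually (\<lambda>n. (1 / real p) ^ n * nrm a < 1) sequentially"
      by (intro order_tendstoD) auto
    then obtain n where "(1 / real p) ^ n * nrm a < 1"
      using eventually_happens'[OF sequentially_bot] by fast
    hence "nrm (of_nat p ^ n * a) < 1" by (simp add: nrm_mult nrm_power nrm_p)
    hence "(of_nat p ^ n * a, 1) \<in> M0" by (auto simp: M0_def)
    thus ?thesis using pw M1(2) M(2) by blast
  qed
  define \<psi> where "\<psi> x = (SOME z. (x, z) \<in> M)" for x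
  have psi: "(x, \<psi> x) \<in> M" for x unfolding \<psi>_def using total by (rule someI_ex)
  have eq: "\<psi> x = z" if "(x, z) \<in> M" for x z
    using character_graph_unique[OF M(1) psi that] .
  have "cmod (\<psi> x) = 1" for x using character_graph_norm[OF M(1) psi] .
  moreover have "\<psi> (x + y) = \<psi> x * \<psi> y" for x y
    by (intro eq character_graph_add M psi)
  moreover have "\<psi> x = 1" if "nrm x < 1" for x
    using that M1(2) M(2) by (intro eq) (auto simp: M0_def)
  moreover have "\<psi> 1 \<noteq> 1" using eq[of 1 \<zeta>] M1(3) M(2) z1 by auto
  ultimately show ?thesis by blast
qed

section \<open>Units and fractional ideals through the absolute value\<close>

lemma mem_int_units_iff: "(x::'f) \<in> int_units \<longleftrightarrow> nrm x = 1"
proof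
  assume "x \<in> int_units"
  then obtain y where y: "nrm x \<le> 1" "nrm y \<le> 1" "x * y = 1"
    by (auto simp: int_units_def int_ring_def)
  have "1 = nrm x * nrm y" using nrm_mult[of x y] y(3) nrm_1 by simp
  also have "\<dots> \<le> nrm x * 1" using y by (intro mult_left_mono) auto
  finally show "nrm x = 1" using y by simp
next
  assume x: "nrm x = 1"
  hence "x \<noteq> 0" by auto
  hence "x * inverse x = 1" "nrm (inverse x) \<le> 1" using x by (auto simp: nrm_inverse)
  thus "x \<in> int_units" using x by (auto simp: int_units_def int_ring_def)
qed

lemma frac_ideal_0: "frac_ideal 0 = {x::'f. nrm x \<le> 1}"
  by (simp add: frac_ideal_def int_ring_def)

lemma max_ideal_pow_1: "max_ideal_pow (Suc 0) = {x::'f. nrm x < 1}"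
proof (intro equalityI subsetI)
  fix x :: 'f assume "x \<in> max_ideal_pow (Suc 0)"
  then obtain n a b where x: "x = (\<Sum>i<(n::nat). a i * b i)"
    and ab: "\<And>i. i < n \<Longrightarrow> nrm (a i) < 1" "\<And>i. i < n \<Longrightarrow> nrm (b i) \<le> 1"
    by (auto simp: ideal_mult_def max_ideal_def int_ring_def)
  have "nrm (a i * b i) < 1" if "i < n" for i
  proof -
    have "nrm (a i) * nrm (b i) \<le> nrm (a i) * 1" using ab that by (intro mult_left_mono) auto
    thus ?thesis using ab(1)[OF that] by (simp add: nrm_mult)
  qed
  thus "x \<in> {x. nrm x < 1}" unfolding x by (auto intro!: nrm_sum_less)
next
  fix x :: 'f assume "x \<in> {x. nrm x < 1}"
  hence "x = (\<Sum>i<(1::nat). x * 1) \<and> (\<forall>i<(1::nat). x \<in> max_ideal \<and> (1::'f) \<in> int_ring)"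
    by (simp add: max_ideal_def int_ring_def nrm_1)
  thus "x \<in> max_ideal_pow (Suc 0)"
    unfolding max_ideal_pow.simps ideal_mult_def
    by (intro CollectI exI[of _ "1::nat"] exI[of _ "\<lambda>_. x"] exI[of _ "\<lambda>_. 1"])
qed

lemma frac_ideal_1: "frac_ideal 1 = {x::'f. nrm x < 1}"
  by (simp add: frac_ideal_def max_ideal_pow_1[simplified])

text \<open>Among the products with elements of the maximal ideal, the one with the uniformizer w is
  the largest and hence decisive.\<close>

lemma frac_ideal_minus_1:
  assumes w: "0 < nrm (w::'f)" "nrm w < 1" "\<And>x::'f. nrm x < 1 \<Longrightarrow> nrm x \<le> nrm w"
  shows "frac_ideal (-1) = {x::'f. nrm x \<le> 1 / nrm w}"
proof (intro equalityI subsetI)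
  have iff: "x \<in> frac_ideal (-1) \<longleftrightarrow> (\<forall>y. nrm y < 1 \<longrightarrow> nrm (x * y) \<le> 1)" for x :: 'f
    using max_ideal_pow_1 by (auto simp: frac_ideal_def int_ring_def simp del: max_ideal_pow.simps)
  fix x :: 'f
  {
  assume "x \<in> frac_ideal (-1)"
  hence "nrm (x * w) \<le> 1" using w(2) iff by blast
  thus "x \<in> {x. nrm x \<le> 1 / nrm w}" using w(1) by (simp add: nrm_mult pos_le_divide_eq)
  next
  assume x: "x \<in> {x. nrm x \<le> 1 / nrm w}"
  have "nrm (x * y) \<le> 1" if "nrm y < 1" for y
  proof -
    have "nrm x * nrm y \<le> (1 / nrm w) * nrm w"
      using x w(3)[OF that] w(1) by (intro mult_mono) auto
    thus ?thesis using w(1) by (simp add: nrm_mult)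
  qed
  thus "x \<in> frac_ideal (-1)" using iff by blast
  }
qed

text \<open>Serves to put root elements into \<open>Kl n\<close>: they vanish at every position
  where an entry in the n-th power is demanded, so all n are treated alike.\<close>

lemma zero_mem_frac_ideal: "(0::'f) \<in> frac_ideal k"
proof -
  have "(0::'f) \<in> max_ideal_pow n" for n
  proof (cases n)
    case (Suc m)
    have "(0::'f) = (\<Sum>i<(0::nat). 0 * 0)" by simp
    thus ?thesis unfolding Suc max_ideal_pow.simps ideal_mult_def
      by (intro CollectI exI[of _ "0::nat"] exI[of _ "\<lambda>_. 0"]) auto
  qed (simp add: int_ring_def)
  thus ?thesis by (auto simp: frac_ideal_def int_ring_def)
qed

end

section \<open>Character sums over the residue field\<close>

locale unramified_character = local_field p T
  for p and T :: "'f::{field_char_0, metric_space} itself" +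
  fixes \<psi> :: "'f \<Rightarrow> complex"
  assumes psi_norm: "cmod (\<psi> x) = 1"
    and psi_add: "\<psi> (x + y) = \<psi> x * \<psi> y"
    and psi_eq_1: "nrm x < 1 \<Longrightarrow> \<psi> x = 1"
    and psi_1: "\<psi> 1 \<noteq> 1"
begin

lemma psi_neq_0: "\<psi> x \<noteq> 0"
  using psi_norm[of x] by auto

lemma psi_cong: "nrm (x - y) < 1 \<Longrightarrow> \<psi> x = \<psi> y"
  using psi_add[of "x - y" y] psi_eq_1[of "x - y"] by simp

lemma psi_character: "nontrivial_additive_character \<psi>"
proof -
  have "continuous_on UNIV \<psi>"
    unfolding continuous_on_iff
  proof (intro ballI allI impI)
    fix x :: 'f and e :: real assume "e > 0"
    thus "\<exists>d>0. \<forall>y\<in>UNIV. dist y x < d \<longrightarrow> dist (\<psi> y) (\<psi> x) < e"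
      using psi_cong dist_nrm by (intro exI[of _ 1]) auto
  qed
  thus ?thesis
    unfolding nontrivial_additive_character_def
    using psi_norm psi_add psi_1 by blast
qed

text \<open>Orthogonality: for a unit x, shifting c by \<open>inverse x\<close> permutes the
  residues and multiplies the sum by \<open>\<psi> 1 \<noteq> 1\<close>.\<close>

lemma sum_psi:
  assumes x: "nrm x \<le> 1"
  shows "(\<Sum>c\<in>residues. \<psi> (c * x)) = (if nrm x < 1 then of_nat (card residues) else 0)"
proof (cases "nrm x < 1")
  case True
  have "\<psi> (c * x) = 1" if "c \<in> residues" for c
  proof (rule psi_eq_1)
    have "nrm c * nrm x \<le> 1 * nrm x" using residues_nrm_le[OF that] by (intro mult_right_mono) auto
    thus "nrm (c * x) < 1" using True by (simp add: nrm_mult)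
  qed
  thus ?thesis using True by simp
next
  case False
  hence x1: "nrm x = 1" "x \<noteq> 0" using x by auto
  let ?S = "\<Sum>c\<in>residues. \<psi> (c * x)"
  have "(\<Sum>c\<in>residues. \<psi> ((c + inverse x) * x)) = ?S"
    using x1 by (intro sum_residues_shift psi_cong)
      (auto simp: nrm_mult nrm_inverse simp flip: left_diff_distrib)
  moreover have "\<psi> ((c + inverse x) * x) = \<psi> 1 * \<psi> (c * x)" for c
    using x1 by (simp add: ring_distribs psi_add)
  ultimately have "\<psi> 1 * ?S = ?S" by (simp add: sum_distrib_left)
  hence "?S = 0" using psi_1 by (metis mult_cancel_right1)
  thus ?thesis using False by simp
qed

end

section \<open>The group GSp(4)\<close>

lemma vector_4 [simp]:
  "(vector [a, b, c, d] :: 'a::zero^4) $ 1 = a"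
  "(vector [a, b, c, d] :: 'a::zero^4) $ 2 = b"
  "(vector [a, b, c, d] :: 'a::zero^4) $ 3 = c"
  "(vector [a, b, c, d] :: 'a::zero^4) $ 4 = d"
  unfolding vector_def by simp_all

definition sform :: "'a::field^4 \<Rightarrow> 'a^4 \<Rightarrow> 'a" where
  "sform x y = x $ 1 * y $ 4 + x $ 2 * y $ 3 - x $ 3 * y $ 2 - x $ 4 * y $ 1"

text \<open>The defining relation of the group tested on vectors, as \<open>multiplier_iff\<close>
  shows. A relation in m avoids the definite description in \<open>similitude\<close> until
  uniqueness is known.\<close>

definition multiplier :: "'a::field^4^4 \<Rightarrow> 'a \<Rightarrow> bool" where
  "multiplier g m \<longleftrightarrow> (\<forall>x y. sform (g *v x) (g *v y) = m * sform x y)"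

abbreviation unit_vec :: "4 \<Rightarrow> 'a::field^4" where
  "unit_vec i \<equiv> axis i 1"

lemma matrix_mult_unit_vec: "(g *v unit_vec j) $ i = g $ i $ j"
  by (simp add: matrix_vector_mult_def axis_def if_distrib cong: if_cong)

lemma sform_unit_vec:
  "sform (unit_vec 1) y = y $ 4" "sform (unit_vec 2) y = y $ 3"
  "sform (unit_vec 3) y = - y $ 2" "sform (unit_vec 4) y = - y $ 1"
  "sform x (unit_vec 1) = - x $ 4" "sform x (unit_vec 2) = - x $ 3"
  "sform x (unit_vec 3) = x $ 2" "sform x (unit_vec 4) = x $ 1"
  by (simp_all add: sform_def axis_def)

lemma sform_linear:
  "sform (x + x') y = sform x y + sform x' y" "sform x (y + y') = sform x y + sform x y'"
  "sform (c *s x) y = c * sform x y" "sform x (c *s y) = c * sform x y"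
  by (simp_all add: sform_def algebra_simps)

lemma sform_self: "sform x x = 0"
  by (simp add: sform_def)

lemma sform_eq_Jmat: "sform x y = (\<Sum>i\<in>UNIV. x $ i * (Jmat *v y) $ i)"
  by (simp add: sform_def sum_4 Jmat_def matrix_vector_mult_def algebra_simps)

lemma sform_mult_left:
  "sform (g *v x) y = (\<Sum>i\<in>UNIV. x $ i * ((transpose g ** Jmat) *v y) $ i)"
proof -
  have "(\<Sum>i\<in>UNIV. (g *v x) $ i * v $ i) = (\<Sum>i\<in>UNIV. x $ i * (transpose g *v v) $ i)" for v
  proof -
    have "(\<Sum>i\<in>UNIV. (g *v x) $ i * v $ i) = (\<Sum>i\<in>UNIV. \<Sum>j\<in>UNIV. g $ i $ j * x $ j * v $ i)"
      by (simp add: matrix_vector_mult_def sum_distrib_right)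
    also have "\<dots> = (\<Sum>j\<in>UNIV. \<Sum>i\<in>UNIV. g $ i $ j * x $ j * v $ i)"
      by (rule sum.swap)
    finally show ?thesis
      by (simp add: matrix_vector_mult_def transpose_def sum_distrib_left mult_ac)
  qed
  thus ?thesis unfolding sform_eq_Jmat matrix_vector_mul_assoc[symmetric] by blast
qed

lemma mat_mult_vec: "mat c *v v = c *s (v :: 'a::field^4)"
  by (simp add: vec_eq_iff forall_4 sum_4 matrix_vector_mult_def mat_def)

lemma multiplier_iff: "transpose g ** Jmat ** g = mat m ** Jmat \<longleftrightarrow> multiplier g m"
proof -
  have L: "sform (g *v x) (g *v y) = (\<Sum>i\<in>UNIV. x $ i * ((transpose g ** Jmat ** g) *v y) $ i)" for x y
    by (simp add: sform_mult_left matrix_vector_mul_assoc)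
  have "((mat m ** Jmat) *v y) $ i = m * (Jmat *v y) $ i" for y i
    by (simp add: matrix_vector_mul_assoc[symmetric] mat_mult_vec)
  hence R: "m * sform x y = (\<Sum>i\<in>UNIV. x $ i * ((mat m ** Jmat) *v y) $ i)" for x y
    by (simp add: sform_eq_Jmat sum_distrib_left mult_ac)
  have entry: "(\<Sum>i\<in>UNIV. unit_vec k $ i * (M *v unit_vec l) $ i) = M $ k $ l"
    for M :: "'a^4^4" and k l
    unfolding matrix_mult_unit_vec by (simp add: axis_def if_distrib if_distribR cong: if_cong)
  show ?thesis
  proof
    assume "transpose g ** Jmat ** g = mat m ** Jmat"
    thus "multiplier g m" by (simp add: multiplier_def L R)
  next
    assume "multiplier g m"
    hence eq: "(\<Sum>i\<in>UNIV. x $ i * ((transpose g ** Jmat ** g) *v y) $ i)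
        = (\<Sum>i\<in>UNIV. x $ i * ((mat m ** Jmat) *v y) $ i)" for x y
      unfolding multiplier_def L R by blast
    show "transpose g ** Jmat ** g = mat m ** Jmat"
      unfolding vec_eq_iff using eq[of "unit_vec _" "unit_vec _", unfolded entry] by blast
  qed
qed

lemma multiplier_unique:
  assumes "multiplier g m" "multiplier g n"
  shows "m = n"
proof -
  have "m * sform (unit_vec 1) (unit_vec 4) = n * sform (unit_vec 1) (unit_vec 4)"
    using assms unfolding multiplier_def by metis
  thus ?thesis by (simp add: sform_unit_vec)
qed

lemma multiplier_mult:
  "multiplier g m \<Longrightarrow> multiplier h n \<Longrightarrow> multiplier (g ** h) (m * n)"
  by (simp add: multiplier_def matrix_vector_mul_assoc[symmetric])

lemma multiplier_mat: "multiplier (mat c) (c * c)"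
  by (simp add: multiplier_def sform_linear mat_mult_vec)

lemma multiplier_1: "multiplier (mat 1) 1"
  using multiplier_mat[of 1] by simp

lemma sform_nondegenerate:
  assumes "\<And>x. sform x y = 0"
  shows "y = 0"
  using assms[of "unit_vec 1"] assms[of "unit_vec 2"] assms[of "unit_vec 3"]
    assms[of "unit_vec 4"]
  by (simp add: sform_unit_vec vec_eq_iff forall_4)

text \<open>A vector in the kernel of g is orthogonal to everything because m is nonzero, and the
  form is nondegenerate.\<close>

lemma multiplier_invertible:
  assumes "multiplier g m" "m \<noteq> 0"
  shows "invertible g"
proof -
  have "x = 0" if "g *v x = 0" for x
  proof (rule sform_nondegenerate)
    fix z
    have "m * sform z x = sform (g *v z) (g *v x)"
      using assms(1) by (simp add: multiplier_def)
    also have "\<dots> = 0" by (simp add: that sform_def)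
    finally show "sform z x = 0" using assms(2) by simp
  qed
  hence "\<exists>B. B ** g = mat 1" using matrix_left_invertible_ker by blast
  thus ?thesis using invertible_left_inverse by blast
qed

lemma multiplier_neq_0:
  assumes "multiplier g m" "invertible g"
  shows "m \<noteq> 0"
proof
  assume m: "m = 0"
  obtain A where A: "g ** A = mat 1" using assms(2) by (auto simp: invertible_def)
  have "sform (g *v (A *v unit_vec 1)) (g *v (A *v unit_vec 4)) = 0"
    using assms(1) m by (simp add: multiplier_def)
  thus False by (simp add: matrix_vector_mul_assoc A sform_unit_vec(1))
qed

lemma carrier_GSp_iff: "g \<in> carrier GSp \<longleftrightarrow> (\<exists>m. m \<noteq> 0 \<and> multiplier g m)"
proof -
  have "g \<in> carrier GSp \<longleftrightarrow> invertible g \<and> (\<exists>m. multiplier g m)"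
    by (simp add: GSp_def multiplier_iff)
  thus ?thesis using multiplier_invertible multiplier_neq_0 by blast
qed

lemma multiplier_similitude: "g \<in> carrier GSp \<Longrightarrow> multiplier g (similitude g)"
  unfolding similitude_def multiplier_iff carrier_GSp_iff
  by (metis multiplier_unique theI)

lemma similitude_eq: "multiplier g m \<Longrightarrow> similitude g = m"
  unfolding similitude_def multiplier_iff by (metis multiplier_unique the_equality)

lemma similitude_neq_0: "g \<in> carrier GSp \<Longrightarrow> similitude g \<noteq> 0"
  using carrier_GSp_iff similitude_eq by blast

lemma GSp_mult [simp]: "g \<otimes>\<^bsub>GSp\<^esub> h = g ** h"
  and GSp_one [simp]: "\<one>\<^bsub>GSp\<^esub> = mat 1"
  by (simp_all add: GSp_def)

lemma GSp_mem_mult: "g \<in> carrier GSp \<Longrightarrow> h \<in> carrier GSp \<Longrightarrow> g ** h \<in> carrier GSp"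
  unfolding carrier_GSp_iff by (metis multiplier_mult mult_eq_0_iff)

lemma GSp_mem_1: "mat 1 \<in> carrier GSp"
  unfolding carrier_GSp_iff using multiplier_1 by (intro exI[of _ 1]) simp

lemma GSp_invertible: "g \<in> carrier GSp \<Longrightarrow> invertible g"
  by (simp add: GSp_def)

lemma matrix_inv_right: "invertible g \<Longrightarrow> g ** matrix_inv g = mat 1"
  and matrix_inv_left: "invertible g \<Longrightarrow> matrix_inv g ** g = mat 1"
  unfolding invertible_def matrix_inv_def by (metis (mono_tags, lifting) someI_ex)+

lemma multiplier_matrix_inv:
  assumes "multiplier g m" "m \<noteq> 0"
  shows "multiplier (matrix_inv g) (1 / m)"
  unfolding multiplier_def
proof (intro allI)
  fix x y
  have inv: "g ** matrix_inv g = mat 1"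
    using multiplier_invertible[OF assms] by (rule matrix_inv_right)
  have "m * sform (matrix_inv g *v x) (matrix_inv g *v y)
      = sform (g *v (matrix_inv g *v x)) (g *v (matrix_inv g *v y))"
    using assms(1) by (simp add: multiplier_def)
  also have "\<dots> = sform x y" by (simp add: matrix_vector_mul_assoc inv)
  finally show "sform (matrix_inv g *v x) (matrix_inv g *v y) = 1 / m * sform x y"
    using assms(2) by (simp add: field_simps)
qed

lemma GSp_matrix_inv_mem: "g \<in> carrier GSp \<Longrightarrow> matrix_inv g \<in> carrier GSp"
  unfolding carrier_GSp_iff by (metis multiplier_matrix_inv divide_eq_0_iff zero_neq_one)

lemma GSp_inverse_cancel:
  assumes "g \<in> carrier GSp"
  shows "g ** matrix_inv g = mat 1" "matrix_inv g ** g = mat 1"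
    "g ** (matrix_inv g ** A) = A" "matrix_inv g ** (g ** A) = A"
    "A ** g ** matrix_inv g = A" "A ** matrix_inv g ** g = A"
proof -
  show 1: "g ** matrix_inv g = mat 1" "matrix_inv g ** g = mat 1"
    using GSp_invertible[OF assms] by (simp_all add: matrix_inv_right matrix_inv_left)
  show "g ** (matrix_inv g ** A) = A" "matrix_inv g ** (g ** A) = A"
    by (simp_all add: matrix_mul_assoc 1)
  show "A ** g ** matrix_inv g = A" "A ** matrix_inv g ** g = A"
    by (simp_all add: matrix_mul_assoc[symmetric] 1)
qed

lemma group_GSp: "group (GSp :: ('f::{field_char_0, metric_space}^4^4) monoid)"
proof (rule groupI)
  fix x :: "'f^4^4" assume "x \<in> carrier GSp"
  thus "\<exists>y\<in>carrier GSp. y \<otimes>\<^bsub>GSp\<^esub> x = \<one>\<^bsub>GSp\<^esub>"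
    using GSp_matrix_inv_mem GSp_inverse_cancel(2) by fastforce
qed (auto simp: GSp_mem_mult GSp_mem_1 matrix_mul_assoc)

lemma GSp_inv: "g \<in> carrier GSp \<Longrightarrow> inv\<^bsub>GSp\<^esub> g = matrix_inv g"
  by (intro group.inv_equality[OF group_GSp])
     (simp_all add: GSp_inverse_cancel GSp_matrix_inv_mem)

lemma similitude_mult:
  "g \<in> carrier GSp \<Longrightarrow> h \<in> carrier GSp \<Longrightarrow> similitude (g ** h) = similitude g * similitude h"
  by (intro similitude_eq multiplier_mult multiplier_similitude)

lemma similitude_matrix_inv:
  "g \<in> carrier GSp \<Longrightarrow> similitude (matrix_inv g) = 1 / similitude g"
  by (intro similitude_eq multiplier_matrix_inv multiplier_similitude similitude_neq_0)

lemma similitude_1: "similitude (mat 1) = 1"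
  by (intro similitude_eq multiplier_1)

section \<open>Transvections and explicit unipotent, Levi and Weyl elements\<close>

definition transvection :: "'a::field^4 \<Rightarrow> 'a \<Rightarrow> 'a^4^4" where
  "transvection u b = (\<chi> i j. (if i = j then 1 else 0) + b * u $ i * sform (unit_vec j) u)"

lemma transvection_mult: "transvection u b *v w = w + (b * sform w u) *s u"
proof -
  have "(\<Sum>j\<in>UNIV. sform (unit_vec j) u * w $ j) = sform w u"
    by (simp add: sum_4 sform_unit_vec) (simp add: sform_def algebra_simps)
  hence "(\<Sum>j\<in>UNIV. b * u $ i * sform (unit_vec j) u * w $ j) = b * sform w u * u $ i" for i
    by (simp add: mult.assoc flip: sum_distrib_left)
  moreover have "(\<Sum>j\<in>UNIV. (if i = j then 1 else 0) * w $ j) = w $ i" for i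
    by (simp add: if_distrib if_distribR cong: if_cong)
  ultimately show ?thesis
    by (simp add: vec_eq_iff matrix_vector_mult_def transvection_def distrib_right sum.distrib)
qed

lemma multiplier_transvection: "multiplier (transvection u b) 1"
  unfolding multiplier_def transvection_mult
  by (auto simp: sform_linear sform_self) (simp add: sform_def algebra_simps)

lemma transvection_mem_GSp: "transvection u b \<in> carrier GSp"
  unfolding carrier_GSp_iff using multiplier_transvection by (intro exI[of _ 1]) auto

lemma transvection_scale: "transvection (c *s u) b = transvection u (c * c * b)"
  by (simp add: vec_eq_iff transvection_def sform_linear mult_ac)

text \<open>The form changes by the factor m under g, so pairing with u before g is pairing with g u
  after g, divided by m. Statements about root groups thereby become statements about single
  vectors.\<close>

lemma transvection_conjugate:
  assumes "multiplier g m" "m \<noteq> 0"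
  shows "g ** transvection u b = transvection (g *v u) (b / m) ** g"
proof -
  have "(g ** transvection u b) *v w = (transvection (g *v u) (b / m) ** g) *v w" for w
  proof -
    have "sform (g *v w) (g *v u) = m * sform w u" using assms(1) by (simp add: multiplier_def)
    thus ?thesis using assms(2)
      by (simp add: matrix_vector_mul_assoc[symmetric] transvection_mult vec.add vec.scale)
  qed
  thus ?thesis by (simp add: matrix_eq)
qed

text \<open>The unipotent radical of the Klingen parabolic, a Heisenberg group with
  \<open>klingen 0 0 c\<close> central. In these coordinates \<open>klingen a 0 0\<close> and
  \<open>klingen 0 b 0\<close> are one-parameter groups without a cross term in c, whatever the
  residue characteristic.\<close>

definition klingen :: "'a::field \<Rightarrow> 'a \<Rightarrow> 'a \<Rightarrow> 'a^4^4" where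
  "klingen a b c = vector [vector [1, a, b,  c],
                           vector [0, 1, 0,  b],
                           vector [0, 0, 1, -a],
                           vector [0, 0, 0,  1]]"

definition klingen_low :: "'a::field \<Rightarrow> 'a \<Rightarrow> 'a \<Rightarrow> 'a^4^4" where
  "klingen_low a b c = vector [vector [1, 0,  0, 0],
                               vector [a, 1,  0, 0],
                               vector [b, 0,  1, 0],
                               vector [c, b, -a, 1]]"

definition levi :: "'a::field \<Rightarrow> 'a \<Rightarrow> 'a \<Rightarrow> 'a \<Rightarrow> 'a^4^4" where
  "levi a b c d = vector [vector [1, 0, 0, 0],
                          vector [0, a, b, 0],
                          vector [0, c, d, 0],
                          vector [0, 0, 0, 1]]"

text \<open>Exchanges the lines of e_1 and e_4. The parameter allows it to preserve a weighted norm: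
  the choice |w| t^2 = 1 places it in \<open>stab t\<close>.\<close>

definition long_weyl :: "'a::field \<Rightarrow> 'a^4^4" where
  "long_weyl w = vector [vector [0, 0, 0, - 1 / w],
                         vector [0, 1, 0, 0],
                         vector [0, 0, 1, 0],
                         vector [w, 0, 0, 0]]"

definition short_weyl :: "'a::field^4^4" where
  "short_weyl = vector [vector [0, 1, 0, 0],
                        vector [1, 0, 0, 0],
                        vector [0, 0, 0, 1],
                        vector [0, 0, 1, 0]]"

lemmas explicit_defs = klingen_def klingen_low_def levi_def long_weyl_def short_weyl_def

lemma multiplier_explicit:
  "multiplier (klingen a b c) 1"
  "multiplier (klingen_low a b c) 1"
  "x * w - y * z = 1 \<Longrightarrow> multiplier (levi x y z w) 1"
  "v \<noteq> 0 \<Longrightarrow> multiplier (long_weyl v) 1"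
  "multiplier short_weyl 1"
proof -
  assume d: "x * w - y * z = 1"
  have "sform (levi x y z w *v u) (levi x y z w *v v) = u $ 1 * v $ 4 - u $ 4 * v $ 1
      + (x * w - y * z) * (u $ 2 * v $ 3 - u $ 3 * v $ 2)" for u v
    by (simp add: levi_def matrix_vector_mult_def sum_4 sform_def algebra_simps)
  thus "multiplier (levi x y z w) 1" unfolding multiplier_def d by (simp add: sform_def)
qed (auto simp: multiplier_def explicit_defs matrix_vector_mult_def sum_4 sform_def algebra_simps)

lemma klingen_mult: "klingen a b c ** klingen a' b' c' = klingen (a + a') (b + b') (c + c' + a * b' - b * a')"
  by (simp add: vec_eq_iff forall_4 klingen_def matrix_matrix_mult_def sum_4 algebra_simps)

lemma levi_mult:
  "levi x y z w ** levi x' y' z' w' = levi (x * x' + y * z') (x * y' + y * w') (z * x' + w * z') (z * y' + w * w')"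
  by (simp add: vec_eq_iff forall_4 levi_def matrix_matrix_mult_def sum_4 algebra_simps)

text \<open>SL(2) acts on the row (a, b) by right multiplication and fixes the central coordinate
  since the determinant is 1. This action moves the characters of the Klingen radical.\<close>

lemma klingen_levi:
  assumes "x * w - y * z = 1"
  shows "klingen a b c ** levi x y z w = levi x y z w ** klingen (a * x + b * z) (a * y + b * w) c"
proof -
  have *: "x * w = 1 + y * z" using assms by (simp add: algebra_simps)
  have "x * (a * y + b * w) + y * (- (a * x) - b * z) = b"
    "z * (a * y + b * w) + w * (- (a * x) - b * z) = - a"
    using arg_cong[OF *, of "\<lambda>t. b * t"] arg_cong[OF *, of "\<lambda>t. a * t"] by (simp_all add: algebra_simps)
  thus ?thesis
    by (simp add: vec_eq_iff forall_4 levi_def klingen_def matrix_matrix_mult_def sum_4)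
qed

lemma unipotent_decompose:
  "klingen a b c ** levi 1 d 0 1 = vector [vector [1, a, a * d + b, c], vector [0, 1, d, b],
     vector [0, 0, 1, - a], vector [0, 0, 0, 1]]"
  by (simp add: vec_eq_iff forall_4 levi_def klingen_def matrix_matrix_mult_def sum_4)

lemma mat_1_entry: "(mat 1 :: 'a::field^4^4) $ i $ j = (if i = j then 1 else 0)"
  by (simp add: mat_def)

lemma klingen_0: "klingen 0 0 0 = mat 1"
  by (simp add: vec_eq_iff forall_4 klingen_def mat_1_entry)

lemma levi_1: "levi 1 0 0 1 = mat 1"
  by (simp add: vec_eq_iff forall_4 levi_def mat_1_entry)

text \<open>Three long root groups: the center of the Klingen radical, and the upper and lower
  unipotent groups of the SL(2) in the middle block.\<close>

lemma transvection_unit_vec: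
  "transvection (unit_vec 1) b = klingen 0 0 (- b)"
  "transvection (unit_vec 2) b = levi 1 (- b) 0 1"
  "transvection (unit_vec 3) b = levi 1 0 b 1"
  by (simp_all add: vec_eq_iff forall_4 levi_def klingen_def transvection_def sform_unit_vec)
     (simp_all add: axis_def)

section \<open>Lattice norms and their stabilizers\<close>

text \<open>Two values of \<open>t\<close> matter: \<open>t = 1\<close> gives the norm whose stabilizer is \<open>K\<close>, and
  \<open>t = \<bar>\<pi>\<bar>\<^bsup>-1/2\<^esup>\<close> for a uniformizer \<open>\<pi>\<close> gives \<open>K(\<pp>)\<close>.\<close>
definition weight :: "real \<Rightarrow> 4 \<Rightarrow> real" where
  "weight t i = (if i = 1 then t else if i = 4 then 1 / t else 1)"

lemma weight_simps [simp]:
  "weight t 1 = t" "weight t 2 = 1" "weight t 3 = 1" "weight t 4 = 1 / t"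
  by (simp_all add: weight_def)

lemma weight_pos: "t > 0 \<Longrightarrow> weight t i > 0"
  by (simp add: weight_def)

definition vnorm :: "real \<Rightarrow> 'f::{field_char_0, metric_space}^4 \<Rightarrow> real" where
  "vnorm t x = Max (range (\<lambda>i. nrm (x $ i) / weight t i))"

definition stab :: "real \<Rightarrow> ('f::{field_char_0, metric_space}^4^4) set" where
  "stab t = {g \<in> carrier GSp. nrm (similitude g) = 1 \<and> (\<forall>x. vnorm t (g *v x) \<le> vnorm t x)}"

lemma vnorm_le_iff: "t > 0 \<Longrightarrow> vnorm t x \<le> c \<longleftrightarrow> (\<forall>i. nrm (x $ i) \<le> c * weight t i)"
  using weight_pos[of t] by (simp add: vnorm_def pos_divide_le_eq)

lemma nrm_le_vnorm: "t > 0 \<Longrightarrow> nrm (x $ i) \<le> vnorm t x * weight t i"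
  using vnorm_le_iff[of t x "vnorm t x"] by simp

lemma vnorm_attained: "t > 0 \<Longrightarrow> \<exists>i. nrm (x $ i) = vnorm t x * weight t i"
proof -
  assume t: "t > 0"
  have "vnorm t x \<in> range (\<lambda>i. nrm (x $ i) / weight t i)"
    unfolding vnorm_def by (intro Max_in) auto
  then obtain i where "vnorm t x = nrm (x $ i) / weight t i" by blast
  thus ?thesis using weight_pos[OF t, of i] by (intro exI[of _ i]) simp
qed

lemma vnorm_nonneg: "t > 0 \<Longrightarrow> vnorm t x \<ge> 0"
  using nrm_le_vnorm[of t x 2] by (simp add: order_trans[OF zero_le_dist])

lemma vnorm_eq_0: "t > 0 \<Longrightarrow> vnorm t x = 0 \<Longrightarrow> x = 0"
  using vnorm_le_iff[of t x 0] by (simp add: vec_eq_iff)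

lemma vnorm_unit_vec_1: 
  assumes "nrm (1::'f::{field_char_0, metric_space}) = 1" "t > 0"
  shows "vnorm t (unit_vec i :: 'f^4) = 1 / weight t i"
proof (rule antisym)
  show "vnorm t (unit_vec i :: 'f^4) \<le> 1 / weight t i"
    using assms weight_pos[of t] by (auto simp: vnorm_le_iff axis_def less_imp_neq[symmetric] less_imp_le)
  show "1 / weight t i \<le> vnorm t (unit_vec i :: 'f^4)"
    using nrm_le_vnorm[OF assms(2), of "unit_vec i :: 'f^4" i] weight_pos[OF assms(2), of i] assms(1)
    by (simp add: axis_def pos_divide_le_eq)
qed

context local_field
begin

lemma vnorm_unit_vec: "t > 0 \<Longrightarrow> vnorm t (unit_vec i :: 'f^4) = 1 / weight t i"
  by (rule vnorm_unit_vec_1[OF nrm_1])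

lemma vnorm_scale:
  assumes t: "t > 0"
  shows "vnorm t (c *s x :: 'f^4) = nrm c * vnorm t x"
proof (rule antisym)
  show "vnorm t (c *s x) \<le> nrm c * vnorm t x"
    unfolding vnorm_le_iff[OF t]
    by (auto simp: nrm_mult mult.assoc intro!: mult_left_mono nrm_le_vnorm t)
  obtain i where "nrm (x $ i) = vnorm t x * weight t i" using vnorm_attained[OF t] by blast
  hence "(nrm c * vnorm t x) * weight t i \<le> vnorm t (c *s x) * weight t i"
    using nrm_le_vnorm[OF t, of "c *s x" i] by (simp add: nrm_mult mult.assoc)
  thus "nrm c * vnorm t x \<le> vnorm t (c *s x)" using weight_pos[OF t, of i] by simp
qed

lemma nrm_mult_le_weights:
  assumes t: "t > 0" and w: "weight t i * weight t j = 1"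
  shows "nrm (x $ i * y $ j :: 'f) \<le> vnorm t x * vnorm t y"
proof -
  have "nrm (x $ i) * nrm (y $ j) \<le> (vnorm t x * weight t i) * (vnorm t y * weight t j)"
    using weight_pos[OF t] vnorm_nonneg[OF t]
    by (intro mult_mono nrm_le_vnorm t mult_nonneg_nonneg) (auto intro: less_imp_le)
  also have "\<dots> = vnorm t x * vnorm t y * (weight t i * weight t j)" by (simp only: mult_ac)
  finally show ?thesis by (simp add: w nrm_mult)
qed

lemma nrm_sform_le: "t > 0 \<Longrightarrow> nrm (sform x y :: 'f) \<le> vnorm t x * vnorm t y"
  unfolding sform_def by (intro nrm_diff_le nrm_add_le nrm_mult_le_weights) auto

text \<open>The positions 1, 4 and 2, 3 paired by the form have weights with product 1, so the norm
  is its own dual: pairing with a unit vector tests one coordinate of y against exactly its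
  weight.\<close>

lemma vnorm_le_dual:
  assumes t: "t > 0" and le: "\<And>x. nrm (sform x y :: 'f) \<le> c * vnorm t x"
  shows "vnorm t y \<le> c"
  unfolding vnorm_le_iff[OF t] forall_4
  using le[of "unit_vec 1"] le[of "unit_vec 2"] le[of "unit_vec 3"] le[of "unit_vec 4"] t
  by (simp add: sform_unit_vec vnorm_unit_vec nrm_minus)

text \<open>The columns of g are the images of the unit vectors, whose norms are
  \<open>1 / weight t j\<close>. This translates the stabilizer into entrywise bounds, the form in
  which K and K(p) are given.\<close>

lemma vnorm_mult_le_iff:
  assumes t: "t > 0"
  shows "(\<forall>x. vnorm t (g *v x) \<le> vnorm t x) \<longleftrightarrow> (\<forall>i j. nrm (g $ i $ j :: 'f) \<le> weight t i / weight t j)"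
proof
  assume le: "\<forall>x. vnorm t (g *v x) \<le> vnorm t x"
  show "\<forall>i j. nrm (g $ i $ j) \<le> weight t i / weight t j"
  proof (intro allI)
    fix i j
    have "nrm (g $ i $ j) \<le> vnorm t (g *v unit_vec j) * weight t i"
      using nrm_le_vnorm[OF t, of "g *v unit_vec j" i] by (simp only: matrix_mult_unit_vec)
    also have "\<dots> \<le> vnorm t (unit_vec j :: 'f^4) * weight t i"
      using le weight_pos[OF t, of i] by (intro mult_right_mono) auto
    finally show "nrm (g $ i $ j) \<le> weight t i / weight t j" by (simp add: vnorm_unit_vec[OF t])
  qed
next
  assume le: "\<forall>i j. nrm (g $ i $ j) \<le> weight t i / weight t j"
  show "\<forall>x. vnorm t (g *v x) \<le> vnorm t x"
    unfolding vnorm_le_iff[OF t]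
  proof (intro allI)
    fix x i
    have "nrm (g $ i $ j * x $ j) \<le> vnorm t x * weight t i" for j
    proof -
      have "nrm (g $ i $ j) * nrm (x $ j) \<le> (weight t i / weight t j) * (vnorm t x * weight t j)"
        using le weight_pos[OF t] by (intro mult_mono nrm_le_vnorm t) (auto simp: less_imp_le)
      thus ?thesis using weight_pos[OF t, of j] by (simp add: nrm_mult mult_ac)
    qed
    thus "nrm ((g *v x) $ i) \<le> vnorm t x * weight t i"
      unfolding matrix_vector_mult_def using vnorm_nonneg[OF t, of x] weight_pos[OF t, of i]
      by (auto intro!: nrm_sum_le)
  qed
qed

lemma unit_multiplier_iff:
  "(\<exists>m. multiplier g m \<and> nrm (m::'f) = 1) \<longleftrightarrow> g \<in> carrier GSp \<and> nrm (similitude g) = 1"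
proof
  assume "\<exists>m. multiplier g m \<and> nrm m = 1"
  then obtain m where m: "multiplier g m" "nrm m = 1" by blast
  hence "m \<noteq> 0" by auto
  thus "g \<in> carrier GSp \<and> nrm (similitude g) = 1"
    using m carrier_GSp_iff similitude_eq by metis
next
  assume "g \<in> carrier GSp \<and> nrm (similitude g) = 1"
  thus "\<exists>m. multiplier g m \<and> nrm m = 1" using multiplier_similitude by blast
qed

lemma stab_iff:
  "t > 0 \<Longrightarrow> g \<in> stab t \<longleftrightarrow> (\<exists>m. multiplier g m \<and> nrm m = 1) \<and>
     (\<forall>i j. nrm (g $ i $ j :: 'f) \<le> weight t i / weight t j)"
  unfolding stab_def vnorm_mult_le_iff[symmetric] mem_Collect_eq unit_multiplier_iff by blast

lemma stab_GSp: "g \<in> stab t \<Longrightarrow> g \<in> carrier GSp"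
  by (simp add: stab_def)

lemma stab_1: "mat 1 \<in> (stab t :: ('f^4^4) set)"
  by (simp add: stab_def GSp_mem_1 similitude_1 nrm_1)

lemma stab_mult: "g \<in> stab t \<Longrightarrow> h \<in> stab t \<Longrightarrow> g ** h \<in> (stab t :: ('f^4^4) set)"
  by (auto simp: stab_def GSp_mem_mult similitude_mult nrm_mult matrix_vector_mul_assoc[symmetric]
      intro: order_trans)

text \<open>Up to a unit, pairing x with the preimage of y is pairing g x with y; by self-duality of
  the norm a bound for g is therefore a bound for its inverse.\<close>

lemma stab_matrix_inv:
  assumes t: "t > 0" and g: "g \<in> stab t"
  shows "matrix_inv g \<in> (stab t :: ('f^4^4) set)"
proof -
  have G: "g \<in> carrier GSp" and mu: "nrm (similitude g) = 1"
    and le: "\<And>x. vnorm t (g *v x) \<le> vnorm t x"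
    using g by (auto simp: stab_def)
  have "vnorm t (matrix_inv g *v y) \<le> vnorm t y" for y
  proof (rule vnorm_le_dual[OF t])
    fix x
    have "sform (g *v x) y = sform (g *v x) (g *v (matrix_inv g *v y))"
      by (simp add: matrix_vector_mul_assoc GSp_inverse_cancel[OF G])
    also have "\<dots> = similitude g * sform x (matrix_inv g *v y)"
      using multiplier_similitude[OF G] by (simp add: multiplier_def)
    finally have "nrm (sform x (matrix_inv g *v y)) = nrm (sform (g *v x) y)"
      by (simp add: nrm_mult mu)
    also have "\<dots> \<le> vnorm t (g *v x) * vnorm t y" by (rule nrm_sform_le[OF t])
    also have "\<dots> \<le> vnorm t x * vnorm t y"
      by (intro mult_right_mono le vnorm_nonneg t)
    finally show "nrm (sform x (matrix_inv g *v y)) \<le> vnorm t y * vnorm t x"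
      by (simp add: mult.commute)
  qed
  thus ?thesis
    by (simp add: stab_def GSp_matrix_inv_mem[OF G] similitude_matrix_inv[OF G] nrm_divide nrm_1 mu)
qed

lemma vnorm_stab:
  assumes t: "t > 0" and g: "g \<in> stab t"
  shows "vnorm t (g *v x :: 'f^4) = vnorm t x"
proof (rule antisym)
  show "vnorm t (g *v x) \<le> vnorm t x" using g by (simp add: stab_def)
  have "vnorm t (matrix_inv g *v (g *v x)) \<le> vnorm t (g *v x)"
    using stab_matrix_inv[OF t g] by (simp add: stab_def)
  thus "vnorm t x \<le> vnorm t (g *v x)"
    by (simp add: matrix_vector_mul_assoc GSp_inverse_cancel[OF stab_GSp[OF g]])
qed

lemma stab_explicit:
  fixes a b c :: 'f
  assumes t: "t > 0"
  shows "nrm a \<le> t \<Longrightarrow> nrm b \<le> t \<Longrightarrow> nrm c \<le> t * t \<Longrightarrow> klingen a b c \<in> stab t"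
    and "nrm a \<le> 1 / t \<Longrightarrow> nrm b \<le> 1 / t \<Longrightarrow> nrm c \<le> 1 / (t * t) \<Longrightarrow> klingen_low a b c \<in> stab t"
    and "x * w - y * z = 1 \<Longrightarrow> nrm x \<le> 1 \<Longrightarrow> nrm y \<le> 1 \<Longrightarrow> nrm z \<le> 1 \<Longrightarrow> nrm w \<le> 1 \<Longrightarrow>
      levi x y z w \<in> (stab t :: ('f^4^4) set)"
    and "nrm v * (t * t) = 1 \<Longrightarrow> long_weyl v \<in> (stab t :: ('f^4^4) set)"
    and "short_weyl \<in> (stab 1 :: ('f^4^4) set)"
proof -
  assume v: "nrm v * (t * t) = 1"
  hence "v \<noteq> 0" by auto
  moreover have "nrm v = 1 / (t * t)" using v t by (simp add: field_simps)
  ultimately show "long_weyl v \<in> (stab t :: ('f^4^4) set)"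
    using t multiplier_explicit(4)[of v] nrm_1
    by (auto simp: stab_iff forall_4 long_weyl_def nrm_divide nrm_minus intro!: exI[of _ 1])
qed (use t nrm_1 multiplier_explicit(1-3,5) in
    \<open>auto simp: stab_iff forall_4 klingen_def klingen_low_def levi_def short_weyl_def nrm_minus
      intro!: exI[of _ 1]\<close>)

text \<open>After division by a coordinate at which the norm is attained, the other coordinates
  satisfy just the bounds allowed in unipotent elements of the stabilizer, so such elements carry a
  unit vector there. Weyl elements first bring the extremal position to 1 or 2; v supplies the long
  one.\<close>

lemma orbit_of_unit_vec:
  fixes u :: "'f^4"
  assumes t: "t > 0" and v: "nrm (v::'f) * (t * t) = 1" and u: "u \<noteq> 0"
  shows "\<exists>h\<in>stab t. \<exists>c. \<exists>i\<in>{1,2}. u = c *s (h *v unit_vec i)"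
proof -
  define P where "P = (\<lambda>u :: 'f^4. \<exists>h\<in>stab t. \<exists>c. \<exists>i\<in>{1,2}. u = c *s (h *v unit_vec i))"
  have move: "P x" if g: "g \<in> stab t" and "P (g *v x)" for g x
  proof -
    obtain h c i where h: "h \<in> stab t" "i \<in> {1,2}" "g *v x = c *s (h *v unit_vec i)"
      using \<open>P (g *v x)\<close> unfolding P_def by blast
    have "x = matrix_inv g *v (g *v x)"
      by (simp add: matrix_vector_mul_assoc GSp_inverse_cancel[OF stab_GSp[OF g]])
    also have "\<dots> = c *s ((matrix_inv g ** h) *v unit_vec i)"
      unfolding h(3) by (simp add: vec.scale matrix_vector_mul_assoc)
    finally show ?thesis unfolding P_def
      using stab_mult[OF stab_matrix_inv[OF t g] h(1)] h(2) by blast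
  qed
  have bound: "nrm (x $ j / x $ i) \<le> weight t j / weight t i"
    if "x \<noteq> 0" "nrm (x $ i) = vnorm t x * weight t i" for x :: "'f^4" and i j
  proof -
    have pos: "vnorm t x > 0" using vnorm_eq_0[OF t, of x] vnorm_nonneg[OF t, of x] that(1) by fastforce
    thus ?thesis using nrm_le_vnorm[OF t, of x j] weight_pos[OF t, of i]
      by (simp add: nrm_divide that(2) divide_le_eq mult_ac)
  qed
  have nz: "x $ i \<noteq> 0" if "x \<noteq> 0" "nrm (x $ i) = vnorm t x * weight t i" for x :: "'f^4" and i
    using vnorm_eq_0[OF t, of x] weight_pos[OF t, of i] that by auto
  have P1: "P x" if x: "x \<noteq> 0" "nrm (x $ 1) = vnorm t x * weight t 1" for x
  proof -
    note nz = nz[OF x]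
    have "klingen_low (x $ 2 / x $ 1) (x $ 3 / x $ 1) (x $ 4 / x $ 1) \<in> stab t"
      using bound[OF x, of 2] bound[OF x, of 3] bound[OF x, of 4] by (intro stab_explicit t) auto
    moreover have "x = x $ 1 *s (klingen_low (x $ 2 / x $ 1) (x $ 3 / x $ 1) (x $ 4 / x $ 1) *v unit_vec 1)"
      using nz unfolding vec_eq_iff vector_smult_component matrix_mult_unit_vec
      by (simp add: forall_4 klingen_low_def)
    ultimately show ?thesis unfolding P_def by blast
  qed
  have P2: "P x" if x: "x \<noteq> 0" "nrm (x $ 2) = vnorm t x * weight t 2" for x
  proof -
    note nz = nz[OF x]
    define a b c where "a = x $ 1 / x $ 2" and "b = x $ 3 / x $ 2" and "c = x $ 4 / x $ 2"
    have abc: "nrm a \<le> t" "nrm b \<le> 1" "nrm c \<le> 1 / t"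
      using bound[OF x, of 1] bound[OF x, of 3] bound[OF x, of 4] by (simp_all add: a_def b_def c_def)
    have "nrm a * nrm c \<le> t * (1 / t)" using abc t by (intro mult_mono) auto
    hence ac: "nrm (a * c) \<le> 1" using t by (simp add: nrm_mult)
    \<comment> \<open>Applied to e_2 from right to left, the factors insert b + a c in position 3, c
      in position 4 and a in position 1. The last factor also subtracts a c from position 3, which
      is why a c is added beforehand.\<close>
    define h where "h = klingen a 0 0 ** (klingen_low 0 c 0 ** levi 1 0 (b + a * c) 1)"
    have "h \<in> stab t" unfolding h_def using abc t ac
      by (intro stab_mult stab_explicit t) (auto simp: nrm_1 intro!: nrm_add_le)
    moreover have "h *v unit_vec 2 = vector [a, 1, b, c]"
      unfolding vec_eq_iff matrix_mult_unit_vec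
      by (simp add: h_def forall_4 klingen_def klingen_low_def levi_def matrix_matrix_mult_def sum_4)
    hence "x = x $ 2 *s (h *v unit_vec 2)"
      using nz by (simp add: vec_eq_iff forall_4 a_def b_def c_def)
    ultimately show ?thesis unfolding P_def by blast
  qed
  have nonzero: "g *v u \<noteq> 0" if "g \<in> stab t" for g
    using vnorm_stab[OF t that, of u] vnorm_eq_0[OF t, of u] u
    by (auto simp: vnorm_unit_vec vnorm_le_iff[OF t] matrix_vector_mul_assoc)
       (metis vnorm_scale[OF t] nrm_1 dist_self mult_zero_left vector_smult_lzero)
  obtain k where k: "nrm (u $ k) = vnorm t u * weight t k" using vnorm_attained[OF t] by blast
  have "P u"
  proof -
    consider "k = 1" | "k = 2" | "k = 3" | "k = 4" using exhaust_4 by blast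
    thus ?thesis
    proof cases
      case 1 thus ?thesis using P1 u k by blast
    next
      case 2 thus ?thesis using P2 u k by blast
    next
      case 3
      define g :: "'f^4^4" where "g = levi 0 1 (-1) 0"
      have g: "g \<in> stab t" unfolding g_def by (intro stab_explicit t) (auto simp: nrm_1 nrm_minus)
      have "(g *v u) $ 2 = u $ 3" by (simp add: g_def levi_def matrix_vector_mult_def sum_4)
      hence "P (g *v u)" using k 3 by (intro P2 nonzero g) (simp add: vnorm_stab[OF t g])
      thus ?thesis by (rule move[OF g])
    next
      case 4
      define g :: "'f^4^4" where "g = long_weyl v"
      have g: "g \<in> stab t" unfolding g_def by (intro stab_explicit t v)
      have v': "nrm v = 1 / (t * t)" using v t by (simp add: field_simps)
      have "(g *v u) $ 1 = - (u $ 4 / v)" by (simp add: g_def long_weyl_def matrix_vector_mult_def sum_4)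
      hence "nrm ((g *v u) $ 1) = vnorm t u * t" using k 4 v' t by (simp add: nrm_minus nrm_divide)
      hence "P (g *v u)" by (intro P1 nonzero g) (simp add: vnorm_stab[OF t g])
      thus ?thesis by (rule move[OF g])
    qed
  qed
  thus ?thesis by (simp add: P_def)
qed

text \<open>Conjugation by g turns the transvections along e_j into those along g e_j, and g e_j = c
  h e_i with h in the stabilizer. If the squared norm of g e_j is at least the norm of the
  multiplier, integral coefficients along e_j reach every b in the stated range, under which
  \<open>transvection (unit_vec i) b\<close> lies in \<open>stab t\<close>.\<close>

lemma conjugate_of_root_group:
  assumes t: "t > 0" and v: "nrm (v::'f) * (t * t) = 1" and g: "g \<in> carrier GSp"
  shows "\<exists>h\<in>stab t. \<exists>i\<in>{1,2}. \<forall>b. nrm (b::'f) * (vnorm t (unit_vec i :: 'f^4))\<^sup>2 \<le> 1 \<longrightarrow>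
    (\<exists>j\<in>{2,3}. \<exists>b'. nrm b' \<le> 1 \<and>
      (h ** transvection (unit_vec i) b ** matrix_inv h) ** g = g ** transvection (unit_vec j) b')"
proof -
  define m where "m = similitude g"
  have m: "multiplier g m" "m \<noteq> 0"
    unfolding m_def using multiplier_similitude[OF g] similitude_neq_0[OF g] .
  have "m = sform (g *v unit_vec 2) (g *v unit_vec 3)"
    using m(1) by (simp add: multiplier_def sform_unit_vec)
  hence le: "nrm m \<le> vnorm t (g *v unit_vec 2) * vnorm t (g *v unit_vec 3)"
    using nrm_sform_le[OF t] by simp
  \<comment> \<open>The two vectors pair to m, so the longer one has squared norm at least that of
    m.\<close>
  obtain j where j: "j \<in> {2,3}" "nrm m \<le> (vnorm t (g *v unit_vec j))\<^sup>2"
  proof (cases "vnorm t (g *v unit_vec 2) \<le> vnorm t (g *v unit_vec 3)")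
    case True
    hence "vnorm t (g *v unit_vec 2) * vnorm t (g *v unit_vec 3) \<le> (vnorm t (g *v unit_vec 3))\<^sup>2"
      unfolding power2_eq_square by (intro mult_right_mono vnorm_nonneg t)
    thus ?thesis using le that[of 3] by simp
  next
    case False
    hence "vnorm t (g *v unit_vec 2) * vnorm t (g *v unit_vec 3) \<le> (vnorm t (g *v unit_vec 2))\<^sup>2"
      unfolding power2_eq_square by (intro mult_left_mono vnorm_nonneg t) auto
    thus ?thesis using le that[of 2] by simp
  qed
  have "g *v unit_vec j \<noteq> 0"
  proof
    assume "g *v unit_vec j = 0"
    hence "vnorm t (g *v unit_vec j) \<le> 0" using t by (simp add: vnorm_le_iff)
    hence "vnorm t (g *v unit_vec j) = 0" using vnorm_nonneg[OF t] by (rule antisym)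
    thus False using j(2) m(2) by simp
  qed
  then obtain h c i where h: "h \<in> stab t" "i \<in> {1,2}" "g *v unit_vec j = c *s (h *v unit_vec i)"
    using orbit_of_unit_vec[OF t v] by blast
  define s where "s = similitude h"
  have G: "h \<in> carrier GSp" using stab_GSp[OF h(1)] .
  have s: "multiplier h s" "s \<noteq> 0" "nrm s = 1"
    unfolding s_def using multiplier_similitude[OF G] similitude_neq_0[OF G] h(1) by (auto simp: stab_def)
  let ?n = "vnorm t (unit_vec i :: 'f^4)"
  have cn: "nrm m \<le> (nrm c * ?n)\<^sup>2"
    using j(2) unfolding h(3) by (simp add: vnorm_scale[OF t] vnorm_stab[OF t h(1)])
  have c0: "c \<noteq> 0" using cn m(2) by auto
  have "\<exists>b'. nrm b' \<le> 1 \<and>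
      (h ** transvection (unit_vec i) b ** matrix_inv h) ** g = g ** transvection (unit_vec j) b'"
    if b: "nrm b * ?n\<^sup>2 \<le> 1" for b
  proof (intro exI conjI)
    \<comment> \<open>The solution of c^2 ?b / m = b / s: a scalar on the vector enters
      quadratically, and m and s are the multipliers of g and h.\<close>
    let ?b = "b * m / (s * c * c)"
    have "nrm b * nrm m \<le> nrm b * (nrm c * ?n)\<^sup>2" using cn by (intro mult_left_mono) auto
    also have "\<dots> = (nrm b * ?n\<^sup>2) * (nrm c * nrm c)" by (simp add: power2_eq_square)
    also have "\<dots> \<le> 1 * (nrm c * nrm c)" using b by (intro mult_right_mono) auto
    finally show "nrm ?b \<le> 1" using c0 by (simp add: nrm_mult nrm_divide s divide_le_eq)
    have "g ** transvection (unit_vec j) ?b = transvection (c *s (h *v unit_vec i)) (?b / m) ** g"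
      using transvection_conjugate[OF m] by (simp add: h(3))
    also have "transvection (c *s (h *v unit_vec i)) (?b / m) = transvection (h *v unit_vec i) (b / s)"
      using c0 m(2) by (simp add: transvection_scale)
    also have "\<dots> = transvection (h *v unit_vec i) (b / s) ** (h ** matrix_inv h)"
      by (simp add: GSp_inverse_cancel[OF G])
    also have "\<dots> = h ** transvection (unit_vec i) b ** matrix_inv h"
      by (simp add: transvection_conjugate[OF s(1,2)] matrix_mul_assoc)
    finally show "(h ** transvection (unit_vec i) b ** matrix_inv h) ** g = g ** transvection (unit_vec j) ?b"
      by simp
  qed
  thus ?thesis using h(1,2) j(1) by blast
qed

lemma GSp0_iff: "g \<in> GSp0 \<longleftrightarrow> (\<exists>m. multiplier g m \<and> nrm (m::'f) = 1)"
  unfolding GSp0_def mem_Collect_eq mem_int_units_iff unit_multiplier_iff ..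

lemma transvection_mem_Kl:
  assumes "j \<in> {2, 3}" "nrm (b::'f) \<le> 1"
  shows "transvection (unit_vec j) b \<in> Kl n"
  using assms multiplier_transvection[of "unit_vec j" b] nrm_1
  by (auto simp: Kl_def GSp0_iff pattern_def forall_4 transvection_unit_vec levi_def frac_ideal_0
      zero_mem_frac_ideal nrm_minus)

lemma Kmax_eq_stab: "Kmax = (stab 1 :: ('f^4^4) set)"
proof -
  have "weight 1 i = 1" for i by (simp add: weight_def)
  thus ?thesis by (auto simp: Kmax_def pattern_def GSp0_iff stab_iff frac_ideal_0)
qed

text \<open>With s^2 = |w| the ratios of weights are 1, s, 1/s, s^2 and 1/s^2. No norm lies strictly
  between |w| and 1 or between 1 and 1/|w|, so the bounds s and 1/s say the same as membership in
  the maximal ideal and in o.\<close>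

lemma Kpara_eq_stab:
  assumes w: "0 < nrm (w::'f)" "nrm w < 1" "\<And>x::'f. nrm x < 1 \<Longrightarrow> nrm x \<le> nrm w"
  shows "Kpara = (stab (1 / sqrt (nrm w)) :: ('f^4^4) set)"
proof -
  define r where "r = nrm w"
  define s where "s = sqrt r"
  have r: "0 < r" "r < 1" "r = s * s" "0 < s" "s < 1" "r \<le> s"
    using w(1,2) by (auto simp: r_def s_def intro!: sqrt_le_D) (simp add: real_le_rsqrt power2_eq_square mult_left_le)
  have a: "nrm x \<le> 1 \<longleftrightarrow> nrm x \<le> 1 / s" for x :: 'f
  proof
    assume "nrm x \<le> 1" moreover have "1 \<le> 1 / s" using r by simp
    ultimately show "nrm x \<le> 1 / s" by linarith
  next
    assume "nrm x \<le> 1 / s"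
    hence "nrm x * r \<le> (1 / s) * r" using r by (intro mult_right_mono) auto
    also have "\<dots> = s" using r by simp
    finally have "nrm (x * w) < 1" using r(5) unfolding nrm_mult r_def[symmetric] by linarith
    hence "nrm x * r \<le> r" using w(3)[of "x * w"] unfolding nrm_mult r_def[symmetric] by simp
    thus "nrm x \<le> 1" using r(1) by simp
  qed
  have b: "nrm x < 1 \<longleftrightarrow> nrm x \<le> s" for x :: 'f
    using w(3)[of x] r(5,6) unfolding r_def[symmetric] by (intro iffI) simp_all
  have c: "nrm x < 1 \<longleftrightarrow> nrm x \<le> s * s" for x :: 'f
    using w(3)[of x] r(2,3) unfolding r_def[symmetric] by (intro iffI) simp_all
  have d: "nrm x \<le> 1 / r \<longleftrightarrow> nrm x \<le> 1 / (s * s)" for x :: 'f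
    using r by simp
  note f1 = frac_ideal_1 and f0 = frac_ideal_0 and f_1 = frac_ideal_minus_1[OF w, folded r_def]
  have "g \<in> Kpara \<longleftrightarrow> g \<in> stab (1 / s)" for g :: "'f^4^4"
  proof -
    have "g \<in> pattern (vector [vector [0, 0, 0, -1], vector [1, 0, 0,  0], vector [1, 0, 0,  0],
        vector [1, 1, 1,  0]]) \<longleftrightarrow> (\<forall>i j. nrm (g $ i $ j) \<le> weight (1 / s) i / weight (1 / s) j)"
      using r(4) by (simp add: pattern_def forall_4 f0 f1 f_1)
        (simp add: a[symmetric] b[symmetric] c[symmetric] d[symmetric])
    thus ?thesis using r(4) by (auto simp: Kpara_def GSp0_iff stab_iff)
  qed
  thus ?thesis unfolding s_def r_def by blast
qed

end

section \<open>Eigenvectors in cuspidal representations\<close>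

context local_field
begin

lemma Kmax_plus_iff:
  "g \<in> Kmax_plus \<longleftrightarrow> g \<in> stab 1 \<and> (\<forall>i j. nrm (g $ i $ j - mat 1 $ i $ j :: 'f) < 1)"
  by (simp add: Kmax_plus_def Kmax_eq_stab pattern_def frac_ideal_1)

lemma stab_1_iff:
  "g \<in> stab 1 \<longleftrightarrow> (\<exists>m. multiplier g m \<and> nrm m = 1) \<and> (\<forall>i j. nrm (g $ i $ j :: 'f) \<le> 1)"
proof -
  have "weight 1 i = 1" for i by (simp add: weight_def)
  thus ?thesis by (simp add: stab_iff)
qed

lemma klingen_mem_stab_1:
  "nrm (a::'f) \<le> 1 \<Longrightarrow> nrm b \<le> 1 \<Longrightarrow> nrm c \<le> 1 \<Longrightarrow> klingen a b c \<in> stab 1"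
  by (rule stab_explicit) auto

lemma levi_mem_stab_1:
  "x * w - y * z = 1 \<Longrightarrow> nrm (x::'f) \<le> 1 \<Longrightarrow> nrm y \<le> 1 \<Longrightarrow> nrm z \<le> 1 \<Longrightarrow> nrm w \<le> 1 \<Longrightarrow>
    levi x y z w \<in> stab 1"
  by (rule stab_explicit) auto

lemma klingen_mem_Kmax_plus:
  "nrm (a::'f) < 1 \<Longrightarrow> nrm b < 1 \<Longrightarrow> nrm c < 1 \<Longrightarrow> klingen a b c \<in> Kmax_plus"
  using klingen_mem_stab_1[of a b c]
  by (simp add: Kmax_plus_iff) (simp add: forall_4 klingen_def mat_1_entry nrm_minus)

lemma levi_mem_Kmax_plus:
  "nrm (d::'f) < 1 \<Longrightarrow> levi 1 d 0 1 \<in> Kmax_plus"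
  using levi_mem_stab_1[of 1 1 d 0]
  by (simp add: Kmax_plus_iff nrm_1) (simp add: forall_4 levi_def mat_1_entry)

end

text \<open>A representation of GSp(4) over the residue field, carried as an action of K that is
  trivial on K^+, so that matrices over F can be used throughout. Cuspidality appears as the absence
  of vectors fixed by the Klingen or the Siegel radical.\<close>

locale Kmax_action = unramified_character p T \<psi>
  for p and T :: "'f::{field_char_0, metric_space} itself" and \<psi> +
  fixes W :: "'w::complex_space set" and A :: "'f^4^4 \<Rightarrow> 'w \<Rightarrow> 'w"
  assumes W: "complex_space.subspace W"
    and A_mem: "g \<in> stab 1 \<Longrightarrow> w \<in> W \<Longrightarrow> A g w \<in> W"
    and A_linear: "g \<in> stab 1 \<Longrightarrow> linear_on W (A g)"
    and A_mult: "g \<in> stab 1 \<Longrightarrow> h \<in> stab 1 \<Longrightarrow> w \<in> W \<Longrightarrow> A (g ** h) w = A g (A h w)"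
    and A_plus: "g \<in> Kmax_plus \<Longrightarrow> w \<in> W \<Longrightarrow> A g w = w"
    and klingen_cuspidal: "w \<in> W \<Longrightarrow>
      (\<And>a b c. nrm a \<le> 1 \<Longrightarrow> nrm b \<le> 1 \<Longrightarrow> nrm c \<le> 1 \<Longrightarrow> A (klingen a b c) w = w) \<Longrightarrow> w = 0"
    and siegel_cuspidal: "w \<in> W \<Longrightarrow>
      (\<And>b c d. nrm b \<le> 1 \<Longrightarrow> nrm c \<le> 1 \<Longrightarrow> nrm d \<le> 1 \<Longrightarrow>
        A (klingen 0 b c ** levi 1 d 0 1) w = w) \<Longrightarrow> w = 0"
begin

lemma A_add: "g \<in> stab 1 \<Longrightarrow> v \<in> W \<Longrightarrow> w \<in> W \<Longrightarrow> A g (v + w) = A g v + A g w"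
  and A_scale: "g \<in> stab 1 \<Longrightarrow> w \<in> W \<Longrightarrow> A g (scaleC a w) = scaleC a (A g w)"
  using A_linear unfolding linear_on_def by blast+

lemma W_0: "0 \<in> W"
  and W_add: "v \<in> W \<Longrightarrow> w \<in> W \<Longrightarrow> v + w \<in> W"
  and W_scale: "w \<in> W \<Longrightarrow> scaleC a w \<in> W"
  using W unfolding complex_space.subspace_def by blast+

lemma A_0: "g \<in> stab 1 \<Longrightarrow> A g 0 = 0"
  using A_scale[of g 0 0] W_0 by simp

lemma A_sum:
  assumes "g \<in> stab 1" "\<And>i. i \<in> I \<Longrightarrow> f i \<in> W"
  shows "A g (\<Sum>i\<in>I. f i) = (\<Sum>i\<in>I. A g (f i))"
  using assms
proof (induction I rule: infinite_finite_induct)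
  case (insert x F)
  have "sum f F \<in> W" using insert by (intro complex_space.subspace_sum W) auto
  thus ?case using insert by (simp add: A_add)
qed (simp_all add: A_0)

lemma A_1: "w \<in> W \<Longrightarrow> A (mat 1) w = w"
  by (rule A_plus) (simp_all add: Kmax_plus_iff stab_1)

lemma A_neq_0:
  assumes g: "g \<in> stab 1" and w: "w \<in> W" "w \<noteq> 0"
  shows "A g w \<noteq> 0"
proof
  assume "A g w = 0"
  hence "A (matrix_inv g ** g) w = 0"
    using A_mult[OF stab_matrix_inv[OF _ g] g w(1)] A_0[OF stab_matrix_inv[OF _ g]] by simp
  thus False using w A_1[OF w(1)] by (simp add: GSp_inverse_cancel[OF stab_GSp[OF g]])
qed

lemma eigenspace_subspace:
  assumes "\<And>i. i \<in> I \<Longrightarrow> G i \<in> stab 1"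
  shows "complex_space.subspace {w \<in> W. \<forall>i\<in>I. A (G i) w = scaleC (z i) w}"
  unfolding complex_space.subspace_def using assms
  by (auto simp: W_0 W_add W_scale A_0 A_add A_scale complex_space.scale_right_distrib mult.commute)

text \<open>Projecting to the characters \<open>x \<mapsto> \<psi>(cx)\<close> and summing over \<open>c\<close> returns a multiple of \<open>w\<close>,
  so some projection is nonzero.\<close>
lemma eigenvector_exists:
  assumes V: "complex_space.subspace V" "V \<subseteq> W"
    and G: "\<And>x. nrm x \<le> 1 \<Longrightarrow> G x \<in> stab 1"
    and G_add: "\<And>x y. G (x + y) = G x ** G y"
    and G_plus: "\<And>x. nrm x < 1 \<Longrightarrow> G x \<in> Kmax_plus"
    and inv: "\<And>x w. nrm x \<le> 1 \<Longrightarrow> w \<in> V \<Longrightarrow> A (G x) w \<in> V"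
    and w: "w \<in> V" "w \<noteq> 0"
  shows "\<exists>c w'. nrm c \<le> 1 \<and> w' \<in> V \<and> w' \<noteq> 0 \<and>
    (\<forall>y. nrm y \<le> 1 \<longrightarrow> A (G y) w' = scaleC (\<psi> (c * y)) w')"
proof -
  have wW: "w \<in> W" using w V by blast
  note R1 = residues_nrm_le
  define E where "E c = (\<Sum>x\<in>residues. scaleC (\<psi> (- (c * x))) (A (G x) w))" for c
  have EV: "E c \<in> V" for c
    unfolding E_def
    by (intro complex_space.subspace_sum complex_space.subspace_scale V inv R1 w)
  have eigen: "A (G y) (E c) = scaleC (\<psi> (c * y)) (E c)" if y: "nrm y \<le> 1" and c: "nrm c \<le> 1" for c y
  proof -
    define g where "g x = scaleC (\<psi> (- (c * x))) (A (G x) w)" for x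
    \<comment> \<open>The summand sees only the class of x: \<open>G\<close> maps the maximal ideal
      into K^+, and \<open>\<psi>\<close> is trivial on the maximal ideal.\<close>
    have per: "g x = g x'" if x: "nrm x \<le> 1" "nrm x' \<le> 1" "nrm (x - x') < 1" for x x'
    proof -
      have "nrm c * nrm (x' - x) \<le> 1 * nrm (x' - x)" using c by (intro mult_right_mono) auto
      hence "nrm (c * (x' - x)) < 1" using x(3) by (simp add: nrm_mult nrm_diff_commute)
      hence "\<psi> (- (c * x)) = \<psi> (- (c * x'))" by (intro psi_cong) (simp add: algebra_simps)
      moreover have "A (G x) w = A (G x') (A (G (x - x')) w)"
        using G_add[of x' "x - x'"] A_mult[OF G[OF x(2)] G[of "x - x'"] wW] x(3) by simp
      ultimately show ?thesis using A_plus[OF G_plus[OF x(3)] wW] by (simp add: g_def)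
    qed
    have "A (G y) (E c) = (\<Sum>x\<in>residues. A (G y) (scaleC (\<psi> (- (c * x))) (A (G x) w)))"
      unfolding E_def by (intro A_sum G y W_scale A_mem R1 wW)
    also have "\<dots> = (\<Sum>x\<in>residues. scaleC (\<psi> (c * y)) (g (x + y)))"
    proof (rule sum.cong[OF refl])
      fix x assume x: "x \<in> residues"
      have "A (G y) (scaleC (\<psi> (- (c * x))) (A (G x) w)) = scaleC (\<psi> (- (c * x))) (A (G (x + y)) w)"
        using R1[OF x] y wW
        by (simp add: A_scale A_mem G A_mult[symmetric] G_add[symmetric] add.commute)
      moreover have "\<psi> (- (c * x)) = \<psi> (c * y) * \<psi> (- (c * (x + y)))"
        by (simp add: algebra_simps flip: psi_add)
      ultimately show "A (G y) (scaleC (\<psi> (- (c * x))) (A (G x) w)) = scaleC (\<psi> (c * y)) (g (x + y))"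
        by (simp add: g_def)
    qed
    also have "\<dots> = scaleC (\<psi> (c * y)) (\<Sum>x\<in>residues. g (x + y))"
      by (simp add: complex_space.scale_sum_right)
    also have "(\<Sum>x\<in>residues. g (x + y)) = (\<Sum>x\<in>residues. g x)"
      by (rule sum_residues_shift[OF per y])
    finally show ?thesis by (simp add: E_def g_def)
  qed
  have "(\<Sum>c\<in>residues. E c) = (\<Sum>x\<in>residues. \<Sum>c\<in>residues. scaleC (\<psi> (- (c * x))) (A (G x) w))"
    unfolding E_def by (rule sum.swap)
  also have "\<dots> = (\<Sum>x\<in>residues. scaleC (\<Sum>c\<in>residues. \<psi> (c * (- x))) (A (G x) w))"
    by (simp add: complex_space.scale_sum_left)
  \<comment> \<open>Orthogonality leaves the zero class alone; its representative acts trivially,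
    being in the maximal ideal.\<close>
  also have "\<dots> = (\<Sum>x\<in>residues. if x = rep 0 then scaleC (of_nat (card residues)) w else 0)"
  proof (rule sum.cong[OF refl])
    fix x assume x: "x \<in> residues"
    have iff: "nrm x < 1 \<longleftrightarrow> x = rep 0" using rep_eq_iff[of x 0] rep_residues[OF x] by simp
    show "scaleC (\<Sum>c\<in>residues. \<psi> (c * (- x))) (A (G x) w) =
        (if x = rep 0 then scaleC (of_nat (card residues)) w else 0)"
      using sum_psi[of "- x"] R1[OF x] A_plus[OF G_plus wW, of x]
      unfolding iff[symmetric] by (auto simp: nrm_minus)
  qed
  also have "\<dots> = scaleC (of_nat (card residues)) w"
    using finite_residues by (simp add: residues_def)
  also have "\<dots> \<noteq> 0" using w(2) card_residues_pos by (simp add: complex_space.scale_eq_0_iff)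
  finally obtain c where c: "c \<in> residues" "E c \<noteq> 0" by (metis (mono_tags) sum.neutral)
  thus ?thesis using EV eigen R1 by blast
qed

text \<open>On vectors fixed by the center the radical acts through an abelian group. Its two
  coordinate subgroups are diagonalized in turn, and the eigenspace of the first is stable under the
  second because commutators are central.\<close>

lemma klingen_eigenvector:
  assumes w: "w \<in> W" "w \<noteq> 0" and fixed: "\<And>c. nrm c \<le> 1 \<Longrightarrow> A (klingen 0 0 c) w = w"
  shows "\<exists>a0 b0 v. nrm a0 \<le> 1 \<and> nrm b0 \<le> 1 \<and> v \<in> W \<and> v \<noteq> 0 \<and>
    (\<forall>a b c. nrm a \<le> 1 \<longrightarrow> nrm b \<le> 1 \<longrightarrow> nrm c \<le> 1 \<longrightarrow>
      A (klingen a b c) v = scaleC (\<psi> (a0 * a + b0 * b)) v)"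
proof -
  note K = klingen_mem_stab_1
  have o_mult: "nrm (x * y) \<le> 1" if "nrm x \<le> 1" "nrm y \<le> 1" for x y :: 'f
    using mult_mono[OF that] by (simp add: nrm_mult)
  define V1 where "V1 = {w \<in> W. \<forall>c\<in>{c. nrm c \<le> 1}. A (klingen 0 0 c) w = scaleC 1 w}"
  have "\<exists>a0 v. nrm a0 \<le> 1 \<and> v \<in> V1 \<and> v \<noteq> 0 \<and>
    (\<forall>y. nrm y \<le> 1 \<longrightarrow> A (klingen y 0 0) v = scaleC (\<psi> (a0 * y)) v)"
  proof (rule eigenvector_exists)
    show "complex_space.subspace V1" unfolding V1_def by (rule eigenspace_subspace) (simp add: K)
    fix x :: 'f and v assume x: "nrm x \<le> 1" and v: "v \<in> V1"
    have "A (klingen 0 0 c) (A (klingen x 0 0) v) = A (klingen x 0 0) v" if c: "nrm c \<le> 1" for c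
    proof -
      have "A (klingen 0 0 c ** klingen x 0 0) v = A (klingen x 0 0 ** klingen 0 0 c) v"
        by (simp add: klingen_mult)
      thus ?thesis using v x c by (simp add: V1_def K A_mult)
    qed
    thus "A (klingen x 0 0) v \<in> V1" using v x by (simp add: V1_def A_mem K)
  qed (use w fixed in \<open>auto simp: V1_def K klingen_mult klingen_mem_Kmax_plus\<close>)
  then obtain a0 v1 where a0: "nrm a0 \<le> 1" and v1: "v1 \<in> V1" "v1 \<noteq> 0"
    "\<And>y. nrm y \<le> 1 \<Longrightarrow> A (klingen y 0 0) v1 = scaleC (\<psi> (a0 * y)) v1" by blast
  define V2 where "V2 = {w \<in> W. \<forall>i\<in>{x. nrm (fst x) \<le> 1 \<and> nrm (snd x) \<le> 1}.
    A (klingen (fst i) 0 (snd i)) w = scaleC (\<psi> (a0 * fst i)) w}"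
  have v1V2: "v1 \<in> V2"
  proof -
    have "A (klingen a 0 c) v1 = scaleC (\<psi> (a0 * a)) v1" if "nrm a \<le> 1" "nrm c \<le> 1" for a c
    proof -
      have "A (klingen a 0 c) v1 = A (klingen a 0 0 ** klingen 0 0 c) v1"
        by (simp add: klingen_mult)
      thus ?thesis using v1 that by (simp add: V1_def K A_mult)
    qed
    thus ?thesis using v1 by (simp add: V1_def V2_def)
  qed
  have "\<exists>b0 v. nrm b0 \<le> 1 \<and> v \<in> V2 \<and> v \<noteq> 0 \<and>
    (\<forall>y. nrm y \<le> 1 \<longrightarrow> A (klingen 0 y 0) v = scaleC (\<psi> (b0 * y)) v)"
  proof (rule eigenvector_exists)
    show "complex_space.subspace V2" unfolding V2_def by (rule eigenspace_subspace) (simp add: K)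
    fix x :: 'f and v assume x: "nrm x \<le> 1" and v: "v \<in> V2"
    have "A (klingen a 0 c) (A (klingen 0 x 0) v) = scaleC (\<psi> (a0 * a)) (A (klingen 0 x 0) v)"
      if ac: "nrm a \<le> 1" "nrm c \<le> 1" for a c
    proof -
      \<comment> \<open>Moving \<open>klingen 0 x 0\<close> to the left adds 2 a x to the central
        coordinate, which stays integral.\<close>
      have c': "nrm (c + (a * x + a * x)) \<le> 1" using ac x by (intro nrm_add_le o_mult)
      have "A (klingen a 0 c ** klingen 0 x 0) v = A (klingen 0 x 0 ** klingen a 0 (c + (a * x + a * x))) v"
        by (simp add: klingen_mult ac_simps)
      thus ?thesis using v x ac c' by (simp add: V2_def K A_mult A_scale)
    qed
    thus "A (klingen 0 x 0) v \<in> V2" using v x by (simp add: V2_def A_mem K)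
  qed (use v1 v1V2 in \<open>auto simp: V2_def K klingen_mult klingen_mem_Kmax_plus\<close>)
  then obtain b0 v where b0: "nrm b0 \<le> 1" and v: "v \<in> V2" "v \<noteq> 0"
    "\<And>y. nrm y \<le> 1 \<Longrightarrow> A (klingen 0 y 0) v = scaleC (\<psi> (b0 * y)) v" by blast
  have vW: "v \<in> W" using v by (simp add: V2_def)
  have "A (klingen a b c) v = scaleC (\<psi> (a0 * a + b0 * b)) v"
    if "nrm a \<le> 1" "nrm b \<le> 1" "nrm c \<le> 1" for a b c
  proof -
    have c': "nrm (c + a * b) \<le> 1" using that by (intro nrm_add_le o_mult)
    have "A (klingen a b c) v = A (klingen 0 b 0 ** klingen a 0 (c + a * b)) v"
      by (simp add: klingen_mult ac_simps)
    also have "\<dots> = A (klingen 0 b 0) (scaleC (\<psi> (a0 * a)) v)"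
      using v(1) that c' vW by (simp add: V2_def A_mult K)
    also have "\<dots> = scaleC (\<psi> (a0 * a)) (scaleC (\<psi> (b0 * b)) v)"
      using v(3) that vW by (simp add: A_scale K)
    finally show ?thesis by (simp add: psi_add)
  qed
  thus ?thesis using a0 b0 vW v(2) by blast
qed

text \<open>The standard form of the character is (c0, 0) with c0 a unit. It is stable under
  \<open>levi 1 d 0 1\<close>, which changes b by a multiple of a and leaves a alone, so its
  eigenspace can be decomposed under that group. On the Siegel radical a = 0, so only d0 is visible
  there.\<close>

lemma whittaker_vector:
  assumes w: "w \<in> W" "w \<noteq> 0" and fixed: "\<And>c. nrm c \<le> 1 \<Longrightarrow> A (klingen 0 0 c) w = w"
  shows "\<exists>c0 d0 v. nrm c0 = 1 \<and> nrm d0 = 1 \<and> v \<in> W \<and> v \<noteq> 0 \<and>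
    (\<forall>a b c d. nrm a \<le> 1 \<longrightarrow> nrm b \<le> 1 \<longrightarrow> nrm c \<le> 1 \<longrightarrow> nrm d \<le> 1 \<longrightarrow>
      A (klingen a b c ** levi 1 d 0 1) v = scaleC (\<psi> (c0 * a + d0 * d)) v)"
proof -
  note K = klingen_mem_stab_1 and L = levi_mem_stab_1
  have o_mult: "nrm (x * y) \<le> 1" if "nrm x \<le> 1" "nrm y \<le> 1" for x y :: 'f
    using mult_mono[OF that] by (simp add: nrm_mult)
  have p_mult: "nrm (x * y) < 1" if "nrm x < 1" "nrm y \<le> 1" for x y :: 'f
    using mult_left_mono[OF that(2), of "nrm x"] that by (simp add: nrm_mult)
  obtain a0 b0 v where ab: "nrm a0 \<le> 1" "nrm b0 \<le> 1" and v: "v \<in> W" "v \<noteq> 0"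
    "\<And>a b c. nrm a \<le> 1 \<Longrightarrow> nrm b \<le> 1 \<Longrightarrow> nrm c \<le> 1 \<Longrightarrow>
      A (klingen a b c) v = scaleC (\<psi> (a0 * a + b0 * b)) v"
    using klingen_eigenvector[OF assms] by blast
  have "\<not> (nrm a0 < 1 \<and> nrm b0 < 1)"
  proof
    assume "nrm a0 < 1 \<and> nrm b0 < 1"
    hence "A (klingen a b c) v = v" if "nrm a \<le> 1" "nrm b \<le> 1" "nrm c \<le> 1" for a b c
      using that v(3)[OF that] by (simp add: psi_eq_1 nrm_add_less p_mult)
    thus False using klingen_cuspidal v(1,2) by blast
  qed
  hence unit: "nrm a0 = 1 \<or> nrm b0 = 1" using ab by linarith
  \<comment> \<open>Pairing (a0, b0) with the rows (x, y) and (z, u) has to give (c0, 0). Dividing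
    by whichever of a0, b0 is a unit keeps the matrix integral.\<close>
  obtain x y z u c0 where m: "x * u - y * z = 1" "nrm x \<le> 1" "nrm y \<le> 1" "nrm z \<le> 1" "nrm u \<le> 1"
    "a0 * x + b0 * y = c0" "a0 * z + b0 * u = 0" "nrm c0 = 1"
  proof (cases "nrm a0 = 1")
    case True
    hence "a0 \<noteq> 0" by auto
    thus ?thesis using that[of 1 1 0 "- b0 / a0" a0] True ab
      by (simp add: nrm_1 nrm_minus nrm_divide)
  next
    case False
    hence b: "nrm b0 = 1" using unit by blast
    hence "b0 \<noteq> 0" by auto
    thus ?thesis using that[of 0 "a0 / b0" 1 "- 1" b0] b ab
      by (simp add: nrm_1 nrm_minus nrm_divide)
  qed
  define v' where "v' = A (levi x y z u) v"
  have Lm: "levi x y z u \<in> stab 1" using m by (intro L) auto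
  have v': "v' \<in> W" "v' \<noteq> 0"
    unfolding v'_def using A_mem[OF Lm v(1)] A_neq_0[OF Lm v(1,2)] by blast+
  have v'_eig: "A (klingen a b c) v' = scaleC (\<psi> (c0 * a)) v'"
    if abc: "nrm a \<le> 1" "nrm b \<le> 1" "nrm c \<le> 1" for a b c
  proof -
    have le: "nrm (a * x + b * z) \<le> 1" "nrm (a * y + b * u) \<le> 1"
      using abc m by (auto intro!: nrm_add_le o_mult)
    have "A (klingen a b c) v' = A (levi x y z u) (A (klingen (a * x + b * z) (a * y + b * u) c) v)"
      unfolding v'_def using abc le v(1) Lm
      by (simp add: A_mult[symmetric] K klingen_levi[OF m(1)])
    also have "\<dots> = scaleC (\<psi> (a0 * (a * x + b * z) + b0 * (a * y + b * u))) v'"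
      using v(1,3) le abc Lm by (simp add: A_scale v'_def)
    also have "a0 * (a * x + b * z) + b0 * (a * y + b * u) = (a0 * x + b0 * y) * a + (a0 * z + b0 * u) * b"
      by (simp add: algebra_simps)
    finally show ?thesis by (simp add: m)
  qed
  define V where "V = {w \<in> W. \<forall>i\<in>{(a, b, c). nrm a \<le> 1 \<and> nrm b \<le> 1 \<and> nrm c \<le> 1}.
    A ((\<lambda>(a, b, c). klingen a b c) i) w = scaleC (\<psi> (c0 * fst i)) w}"
  have VD: "A (klingen a b c) u = scaleC (\<psi> (c0 * a)) u"
    if "u \<in> V" "nrm a \<le> 1" "nrm b \<le> 1" "nrm c \<le> 1" for u a b c
    using that by (auto simp: V_def)
  have VI: "u \<in> V" if "u \<in> W" "\<And>a b c. nrm a \<le> 1 \<Longrightarrow> nrm b \<le> 1 \<Longrightarrow> nrm c \<le> 1 \<Longrightarrow>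
      A (klingen a b c) u = scaleC (\<psi> (c0 * a)) u" for u
    using that by (auto simp: V_def)
  have VW: "V \<subseteq> W" by (auto simp: V_def)
  have U: "levi 1 d 0 1 \<in> stab 1" if "nrm d \<le> 1" for d :: 'f
    using that by (intro L) (auto simp: nrm_1)
  have "\<exists>d0 v. nrm d0 \<le> 1 \<and> v \<in> V \<and> v \<noteq> 0 \<and>
    (\<forall>y. nrm y \<le> 1 \<longrightarrow> A (levi 1 y 0 1) v = scaleC (\<psi> (d0 * y)) v)"
  proof (rule eigenvector_exists)
    show "complex_space.subspace V" unfolding V_def by (rule eigenspace_subspace) (auto simp: K)
    show "v' \<in> V" using VI v' v'_eig by blast
    fix d :: 'f and v assume d: "nrm d \<le> 1" and v: "v \<in> V"
    have vW: "v \<in> W" using v VW by blast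
    show "A (levi 1 d 0 1) v \<in> V"
    proof (rule VI)
      show "A (levi 1 d 0 1) v \<in> W" by (intro A_mem U d vW)
      fix a b c :: 'f assume abc: "nrm a \<le> 1" "nrm b \<le> 1" "nrm c \<le> 1"
      have le: "nrm (a * d + b) \<le> 1" using abc d by (intro nrm_add_le o_mult)
      have "A (klingen a b c) (A (levi 1 d 0 1) v) = A (levi 1 d 0 1) (A (klingen a (a * d + b) c) v)"
        using abc le vW U[OF d] by (simp add: A_mult[symmetric] K klingen_levi)
      also have "\<dots> = A (levi 1 d 0 1) (scaleC (\<psi> (c0 * a)) v)"
        using VD[OF v abc(1) le abc(3)] by simp
      finally show "A (klingen a b c) (A (levi 1 d 0 1) v) = scaleC (\<psi> (c0 * a)) (A (levi 1 d 0 1) v)"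
        using U[OF d] vW by (simp add: A_scale)
    qed
  qed (use VW v' U in \<open>auto simp: levi_mult levi_mem_Kmax_plus add.commute\<close>)
  then obtain d0 v2 where d0: "nrm d0 \<le> 1" and v2: "v2 \<in> V" "v2 \<noteq> 0"
    "\<And>y. nrm y \<le> 1 \<Longrightarrow> A (levi 1 y 0 1) v2 = scaleC (\<psi> (d0 * y)) v2" by blast
  have v2W: "v2 \<in> W" using v2 VW by blast
  have eig: "A (klingen a b c ** levi 1 d 0 1) v2 = scaleC (\<psi> (c0 * a + d0 * d)) v2"
    if abc: "nrm a \<le> 1" "nrm b \<le> 1" "nrm c \<le> 1" "nrm d \<le> 1" for a b c d
    using v2W VD[OF v2(1) abc(1-3)] v2(3)[OF abc(4)] abc
    by (simp add: A_mult K U A_scale psi_add mult.commute)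
  have "nrm d0 = 1"
  proof (rule ccontr)
    assume "nrm d0 \<noteq> 1"
    hence "nrm d0 < 1" using d0 by simp
    hence "A (klingen 0 b c ** levi 1 d 0 1) v2 = v2"
      if "nrm b \<le> 1" "nrm c \<le> 1" "nrm d \<le> 1" for b c d
      using eig[of 0 b c d] that by (simp add: psi_eq_1 p_mult)
    thus False using siegel_cuspidal v2W v2(2) by blast
  qed
  thus ?thesis using m(8) v2W v2(2) eig by blast
qed

end

section \<open>Whittaker functionals on induced representations\<close>

lemma multiplier_in_GSp: "multiplier g 1 \<Longrightarrow> g \<in> carrier GSp"
  unfolding carrier_GSp_iff by (intro exI[of _ 1]) simp

lemma mat_commute:
  fixes g :: "'a::field^4^4"
  shows "mat c ** g = g ** mat c"
proof -
  have "(mat c ** g) *v x = (g ** mat c) *v x" for x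
    by (simp add: matrix_vector_mul_assoc[symmetric] mat_mult_vec vec.scale)
  thus ?thesis by (simp add: matrix_eq)
qed

lemma mat_mult_mat: "mat a ** mat b = (mat (a * b) :: 'a::field^4^4)"
  by (simp add: matrix_eq matrix_vector_mul_assoc[symmetric] mat_mult_vec)

lemma mat_mem_GSp: "c \<noteq> 0 \<Longrightarrow> mat c \<in> carrier GSp"
  unfolding carrier_GSp_iff using multiplier_mat[of c] by (intro exI[of _ "c * c"]) simp

text \<open>An element that commutes with the transvection along \<open>u\<close> has \<open>u\<close> as an eigenvector.\<close>
lemma center_GSp: "center_of (GSp :: ('f::{field_char_0, metric_space}^4^4) monoid) = {mat c | c. c \<noteq> 0}"
proof (intro equalityI subsetI)
  fix z :: "'f^4^4" assume "z \<in> center_of GSp"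
  hence z: "z \<in> carrier GSp" and comm: "\<And>g. g \<in> carrier GSp \<Longrightarrow> z ** g = g ** z"
    by (auto simp: center_of_def)
  have eig: "\<exists>c. z *v u = c *s u" if u: "u \<noteq> 0" for u
  proof -
    obtain w where w: "sform w u \<noteq> 0" using sform_nondegenerate[of u] u by blast
    have "(z ** transvection u 1) *v w = (transvection u 1 ** z) *v w"
      using comm[OF transvection_mem_GSp] by simp
    hence "sform w u *s (z *v u) = sform (z *v w) u *s u"
      by (simp add: matrix_vector_mul_assoc[symmetric] transvection_mult vec.add vec.scale)
    hence "z *v u = (sform (z *v w) u / sform w u) *s u"
      using w by (simp add: vec_eq_iff field_simps)
    thus ?thesis by blast
  qed
  have nz: "unit_vec i \<noteq> (0 :: 'f^4)" "unit_vec 1 + unit_vec i \<noteq> (0 :: 'f^4)" for i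
  proof -
    have "unit_vec i $ i \<noteq> (0 :: 'f)" by (simp add: axis_def)
    thus "unit_vec i \<noteq> (0 :: 'f^4)" by (metis zero_index)
    have "(unit_vec 1 + unit_vec i) $ 1 \<noteq> (0 :: 'f)" by (simp add: axis_def)
    thus "unit_vec 1 + unit_vec i \<noteq> (0 :: 'f^4)" by (metis zero_index)
  qed
  obtain c where c: "\<And>i. z *v unit_vec i = c i *s unit_vec i" using eig[OF nz(1)] by metis
  have "c i = c 1" for i
  proof (cases "i = 1")
    case False
    obtain d where "z *v (unit_vec 1 + unit_vec i) = d *s (unit_vec 1 + unit_vec i)"
      using eig[OF nz(2)] by blast
    hence "c 1 *s unit_vec 1 + c i *s unit_vec i = d *s (unit_vec 1 + unit_vec i)"
      by (simp add: vec.add c)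
    hence "c 1 = d" "c i = d" using False by (auto simp: vec_eq_iff axis_def dest: spec[of _ 1] spec[of _ i])
    thus ?thesis by simp
  qed simp
  hence "z *v unit_vec i = c 1 *s unit_vec i" for i by (metis c)
  hence "z = mat (c 1)"
    by (simp add: vec_eq_iff matrix_mult_unit_vec[symmetric, of z] mat_def) (simp add: axis_def)
  moreover have "c 1 \<noteq> 0"
  proof
    assume "c 1 = 0"
    hence "sform (z *v unit_vec 1) (z *v unit_vec 4) = 0" by (simp add: c) (simp add: sform_def)
    thus False using multiplier_similitude[OF z] similitude_neq_0[OF z]
      by (simp add: multiplier_def sform_unit_vec(1))
  qed
  ultimately show "z \<in> {mat c | c. c \<noteq> 0}" by blast
next
  fix z :: "'f^4^4" assume "z \<in> {mat c | c. c \<noteq> 0}"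
  thus "z \<in> center_of GSp" by (auto simp: center_of_def mat_mem_GSp mat_commute)
qed

section \<open>The group of upper unipotent matrices\<close>

lemma levi_klingen: "levi 1 d 0 1 ** klingen a b c = klingen a (b - a * d) c ** levi 1 d 0 1"
  by (simp add: vec_eq_iff forall_4 levi_def klingen_def matrix_matrix_mult_def sum_4)

definition unipotent :: "('f::{field_char_0, metric_space}^4^4) set" where
  "unipotent = supported_on borel_pos (carrier GSp)"

text \<open>Pairing column 4 with columns 2 and 3 expresses the entries (3,4) and (1,3) through the
  others, which leaves four free coordinates.\<close>

lemma unipotent_decomposition:
  assumes n: "n \<in> unipotent"
  shows "n = klingen (n $ 1 $ 2) (n $ 2 $ 4) (n $ 1 $ 4) ** levi 1 (n $ 2 $ 3) 0 1"
proof -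
  obtain m where m: "multiplier n m" using n by (auto simp: unipotent_def supported_on_def carrier_GSp_iff)
  have supp: "n $ i $ j = mat 1 $ i $ j" if "(i, j) \<notin> borel_pos" for i j
    using n that by (simp add: unipotent_def supported_on_def)
  have diag: "n $ 1 $ 1 = 1" "n $ 2 $ 2 = 1" "n $ 3 $ 3 = 1" "n $ 4 $ 4 = 1"
    "n $ 2 $ 1 = 0" "n $ 3 $ 1 = 0" "n $ 4 $ 1 = 0" "n $ 3 $ 2 = 0" "n $ 4 $ 2 = 0" "n $ 4 $ 3 = 0"
    by (simp_all add: supp mat_1_entry)
  have eq: "sform (n *v unit_vec i) (n *v unit_vec j) = m * sform (unit_vec i) (unit_vec j)" for i j
    using m by (simp add: multiplier_def)
  have "n $ 1 $ 2 + n $ 3 $ 4 = 0"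
    using eq[of 2 4] unfolding sform_unit_vec(2) unfolding sform_def matrix_mult_unit_vec
    by (simp add: diag axis_def)
  hence 34: "n $ 3 $ 4 = - (n $ 1 $ 2)" by (simp add: eq_neg_iff_add_eq_0 add.commute)
  have "n $ 1 $ 3 + n $ 2 $ 3 * n $ 3 $ 4 - n $ 2 $ 4 = 0"
    using eq[of 3 4] unfolding sform_unit_vec(3) unfolding sform_def matrix_mult_unit_vec
    by (simp add: diag axis_def)
  hence 13: "n $ 1 $ 3 = n $ 1 $ 2 * n $ 2 $ 3 + n $ 2 $ 4" by (simp add: 34 algebra_simps)
  show ?thesis
    unfolding unipotent_decompose by (simp add: vec_eq_iff forall_4 diag 34 13)
qed

lemma klingen_levi_mem_unipotent: "klingen a b c ** levi 1 d 0 1 \<in> unipotent"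
proof -
  have "klingen a b c ** levi 1 d 0 1 \<in> carrier GSp"
    by (intro GSp_mem_mult multiplier_in_GSp multiplier_explicit) simp
  thus ?thesis unfolding unipotent_def supported_on_def mem_Collect_eq
    by (intro conjI) (simp_all add: unipotent_decompose forall_4 mat_1_entry)
qed

lemma unipotent_GSp: "n \<in> unipotent \<Longrightarrow> n \<in> carrier GSp"
  by (simp add: unipotent_def supported_on_def)

lemma unipotent_mult:
  assumes "n \<in> unipotent" "m \<in> unipotent"
  shows "n ** m \<in> unipotent" "(n ** m) $ 1 $ 2 = n $ 1 $ 2 + m $ 1 $ 2"
    "(n ** m) $ 2 $ 3 = n $ 2 $ 3 + m $ 2 $ 3"
proof -
  obtain a b c d where n: "n = klingen a b c ** levi 1 d 0 1"
    using unipotent_decomposition[OF assms(1)] by blast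
  obtain a' b' c' d' where m: "m = klingen a' b' c' ** levi 1 d' 0 1"
    using unipotent_decomposition[OF assms(2)] by blast
  have "n ** m = klingen a b c ** (levi 1 d 0 1 ** klingen a' b' c') ** levi 1 d' 0 1"
    by (simp add: n m matrix_mul_assoc)
  also have "\<dots> = (klingen a b c ** klingen a' (b' - a' * d) c') ** (levi 1 d 0 1 ** levi 1 d' 0 1)"
    by (simp add: levi_klingen matrix_mul_assoc)
  finally have nm: "n ** m = (klingen a b c ** klingen a' (b' - a' * d) c') ** (levi 1 d 0 1 ** levi 1 d' 0 1)" .
  show "n ** m \<in> unipotent" unfolding nm klingen_mult levi_mult
    using klingen_levi_mem_unipotent by simp
  show "(n ** m) $ 1 $ 2 = n $ 1 $ 2 + m $ 1 $ 2" "(n ** m) $ 2 $ 3 = n $ 2 $ 3 + m $ 2 $ 3"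
    unfolding nm klingen_mult levi_mult unfolding n m
    using unipotent_decompose[of _ _ _ "d + d'"] by (simp_all add: unipotent_decompose add.commute)
qed

lemma unipotent_matrix_inv:
  assumes "n \<in> unipotent"
  shows "matrix_inv n \<in> unipotent"
proof -
  obtain a b c d where n: "n = klingen a b c ** levi 1 d 0 1"
    using unipotent_decomposition[OF assms] by blast
  define m where "m = levi 1 (- d) 0 1 ** klingen (- a) (- b) (- c)"
  have "m \<in> unipotent" unfolding m_def levi_klingen by (rule klingen_levi_mem_unipotent)
  moreover have "matrix_inv n = m"
  proof -
    have "n ** m = klingen a b c ** (levi 1 d 0 1 ** levi 1 (- d) 0 1) ** klingen (- a) (- b) (- c)"
      by (simp add: n m_def matrix_mul_assoc)
    also have "\<dots> = mat 1" by (simp add: levi_mult levi_1 klingen_mult klingen_0)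
    finally have "matrix_inv n ** (n ** m) = matrix_inv n" by simp
    thus ?thesis by (simp add: GSp_inverse_cancel[OF unipotent_GSp[OF assms]])
  qed
  ultimately show ?thesis by simp
qed

lemma unipotent_1: "mat 1 \<in> unipotent"
  using klingen_levi_mem_unipotent[of 0 0 0 0] by (simp add: klingen_0 levi_1)

lemma multiplier_unipotent:
  assumes "n \<in> unipotent"
  shows "multiplier n 1"
proof -
  obtain a b c d where n: "n = klingen a b c ** levi 1 d 0 1"
    using unipotent_decomposition[OF assms] by blast
  have "multiplier n (1 * 1)" unfolding n by (intro multiplier_mult multiplier_explicit) simp
  thus ?thesis by simp
qed

section \<open>Congruence subgroups and finiteness of coset spaces\<close>

context local_field
begin

definition small :: "'f^4^4 \<Rightarrow> bool" where
  "small M \<longleftrightarrow> (\<forall>i j. nrm (M $ i $ j) < 1)"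

lemma small_mult:
  assumes "\<And>i j. nrm (M $ i $ j :: 'f) < 1 / C" "\<And>i j. nrm (h $ i $ j) \<le> C" "C > 0"
  shows "small (M ** h)"
  unfolding small_def matrix_matrix_mult_def
proof (simp, intro allI nrm_sum_less)
  fix i j k
  have "nrm (M $ i $ k) * nrm (h $ k $ j) \<le> nrm (M $ i $ k) * C"
    using assms(2) by (intro mult_left_mono) auto
  also have "\<dots> < 1" using assms(1)[of i k] assms(3) by (simp add: pos_less_divide_eq)
  finally show "nrm (M $ i $ k * h $ k $ j) < 1" by (simp add: nrm_mult)
qed simp

lemma small_mult_integral: "small M \<Longrightarrow> h \<in> stab 1 \<Longrightarrow> small (M ** h)"
  by (rule small_mult[of _ 1]) (auto simp: small_def stab_1_iff)

lemma small_add: "small M \<Longrightarrow> small N \<Longrightarrow> small (M + N)"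
  by (auto simp: small_def intro: nrm_add_less)

text \<open>A matrix of the group congruent to 1 is integral, and its multiplier, read off from
  columns 1 and 4, is congruent to 1 and hence a unit. So K^+ is cut out by a visibly open
  condition.\<close>

lemma mem_Kmax_plus_iff: "g \<in> Kmax_plus \<longleftrightarrow> g \<in> carrier GSp \<and> small (g - mat 1)"
proof (intro iffI conjI)
  assume g: "g \<in> carrier GSp \<and> small (g - mat 1)"
  have close: "nrm (g $ i $ j - mat 1 $ i $ j) < 1" for i j using g by (simp add: small_def)
  have int: "nrm (g $ i $ j) \<le> 1" for i j
    using nrm_add_le[of "g $ i $ j - mat 1 $ i $ j" 1 "mat 1 $ i $ j"] close[of i j] nrm_1
    by (auto simp: mat_1_entry split: if_splits)
  have d: "nrm (g $ i $ i - 1) < 1" for i using close[of i i] by (simp add: mat_1_entry)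
  have off: "nrm (g $ i $ j) < 1" if "i \<noteq> j" for i j using close[of i j] that by (simp add: mat_1_entry)
  have pm: "nrm (x * y) < 1" if "nrm x < 1" "nrm y \<le> 1" for x y :: 'f
    using mult_left_mono[OF that(2), of "nrm x"] that by (simp add: nrm_mult)
  let ?m = "similitude g"
  have "?m = sform (g *v unit_vec 1) (g *v unit_vec 4)"
    using multiplier_similitude[of g] conjunct1[OF g] by (simp add: multiplier_def sform_unit_vec(1))
  also have "\<dots> = g $ 1 $ 1 * g $ 4 $ 4 + g $ 2 $ 1 * g $ 3 $ 4 - g $ 3 $ 1 * g $ 2 $ 4 - g $ 4 $ 1 * g $ 1 $ 4"
    unfolding sform_def matrix_mult_unit_vec ..
  finally have "?m - 1 = (g $ 1 $ 1 - 1) * g $ 4 $ 4 + (g $ 4 $ 4 - 1)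
      + g $ 2 $ 1 * g $ 3 $ 4 - g $ 3 $ 1 * g $ 2 $ 4 - g $ 4 $ 1 * g $ 1 $ 4"
    by (simp add: algebra_simps)
  also have "nrm \<dots> < 1" by (intro nrm_diff_less nrm_add_less pm d off int) auto
  finally have "nrm (1 - ?m) < nrm (1::'f)" by (simp add: nrm_1 nrm_diff_commute[of 1])
  hence "nrm ?m = 1" using nrm_eq_of_close[of 1 ?m] by (simp add: nrm_1)
  hence "\<exists>m. multiplier g m \<and> nrm m = 1" using multiplier_similitude g by blast
  thus "g \<in> Kmax_plus" using int close by (simp add: Kmax_plus_iff stab_1_iff)
qed (auto simp: Kmax_plus_iff small_def stab_GSp)

lemma Kmax_plus_stab: "g \<in> Kmax_plus \<Longrightarrow> g \<in> (stab 1 :: ('f^4^4) set)"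
  by (simp add: Kmax_plus_iff)

lemma matrix_diff_mult: "(A - B) ** C = A ** C - B ** (C :: 'f^4^4)"
  by (simp add: vec_eq_iff matrix_matrix_mult_def left_diff_distrib sum_subtractf)

lemma Kmax_plus_mult:
  assumes "g \<in> Kmax_plus" "h \<in> Kmax_plus"
  shows "g ** h \<in> (Kmax_plus :: ('f^4^4) set)"
proof -
  have "g ** h - mat 1 = (g - mat 1) ** h + (h - mat 1)" by (simp add: matrix_diff_mult)
  moreover have "small ((g - mat 1) ** h + (h - mat 1))"
    using assms Kmax_plus_stab[OF assms(2)]
    by (intro small_add small_mult_integral) (simp_all add: mem_Kmax_plus_iff)
  ultimately have "small (g ** h - mat 1)" by (simp only:)
  thus ?thesis using assms by (simp add: mem_Kmax_plus_iff GSp_mem_mult)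
qed

lemma small_minus: "small (M - N) \<Longrightarrow> small (N - M)"
  by (simp add: small_def nrm_diff_commute)

lemma Kmax_plus_of_close:
  assumes "g \<in> carrier GSp" "h \<in> stab 1" "small (g - h)"
  shows "g ** matrix_inv h \<in> Kmax_plus"
proof -
  have "(g - h) ** matrix_inv h = g ** matrix_inv h - mat 1"
    by (simp add: matrix_diff_mult GSp_inverse_cancel[OF stab_GSp[OF assms(2)]])
  thus ?thesis
    using small_mult_integral[OF assms(3) stab_matrix_inv[OF _ assms(2)]] assms stab_GSp[OF assms(2)]
    by (simp add: mem_Kmax_plus_iff GSp_mem_mult GSp_matrix_inv_mem)
qed

lemma Kmax_plus_1: "mat 1 \<in> (Kmax_plus :: ('f^4^4) set)"
  by (simp add: mem_Kmax_plus_iff GSp_mem_1 small_def)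

lemma Kmax_plus_matrix_inv: "g \<in> Kmax_plus \<Longrightarrow> matrix_inv g \<in> (Kmax_plus :: ('f^4^4) set)"
  using Kmax_plus_of_close[OF GSp_mem_1 Kmax_plus_stab] by (simp add: mem_Kmax_plus_iff small_minus)

lemma subgroup_GSpI:
  assumes "H \<subseteq> carrier (GSp :: ('f^4^4) monoid)" "mat 1 \<in> H" "\<And>g h. g \<in> H \<Longrightarrow> h \<in> H \<Longrightarrow> g ** h \<in> H"
    "\<And>g. g \<in> H \<Longrightarrow> matrix_inv g \<in> H"
  shows "subgroup H GSp"
  by (rule group.subgroupI[OF group_GSp]) (use assms GSp_inv[OF subsetD[OF assms(1)]] in auto)

lemma subgroup_Kmax_plus: "subgroup Kmax_plus (GSp :: ('f^4^4) monoid)"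
  by (rule subgroup_GSpI)
     (auto simp: Kmax_plus_1 Kmax_plus_mult Kmax_plus_matrix_inv stab_GSp[OF Kmax_plus_stab])

lemma subgroup_stab: "t > 0 \<Longrightarrow> subgroup (stab t) (GSp :: ('f^4^4) monoid)"
  by (rule subgroup_GSpI) (auto simp: stab_1 stab_mult stab_matrix_inv stab_GSp)

lemma nrm_entry_diff_le_dist: "nrm (g $ i $ j - h $ i $ j :: 'f) \<le> dist g h"
  using order_trans[OF dist_vec_nth_le[of "g $ i" j "h $ i"] dist_vec_nth_le[of g i h]]
  by (simp add: dist_nrm[of "g $ i $ j"])

lemma openin_Kmax_plus: "openin (top_of_set (carrier GSp)) (Kmax_plus :: ('f^4^4) set)"
  unfolding openin_euclidean_subtopology_iff
proof (intro conjI ballI)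
  fix g :: "'f^4^4" assume g: "g \<in> Kmax_plus"
  have "h \<in> Kmax_plus" if "h \<in> carrier GSp" "dist h g < 1" for h
  proof -
    have "small (h - g)"
      unfolding small_def using nrm_entry_diff_le_dist[of h _ _ g] that(2) by (auto intro: le_less_trans)
    hence "small ((h - g) + (g - mat 1))" using g by (intro small_add) (simp_all add: mem_Kmax_plus_iff)
    thus ?thesis using that(1) by (simp add: mem_Kmax_plus_iff)
  qed
  thus "\<exists>e>0. \<forall>x'\<in>carrier GSp. dist x' g < e \<longrightarrow> x' \<in> Kmax_plus" by (intro exI[of _ 1]) auto
qed (auto simp: mem_Kmax_plus_iff)

text \<open>Since c d^{-1} - 1 = (c - d) d^{-1}, every c within 1/B of d lies in the coset K d,
  where B bounds the entries of d^{-1}. Such balls cover C.\<close>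

lemma compact_covered_by_cosets:
  assumes C: "compact C" "C \<subseteq> carrier (GSp :: ('f^4^4) monoid)"
  shows "\<exists>D. finite D \<and> D \<subseteq> C \<and> (\<forall>c\<in>C. \<exists>d\<in>D. c ** matrix_inv d \<in> stab 1)"
proof -
  have "\<exists>e>0. \<forall>c\<in>carrier GSp. dist c d < e \<longrightarrow> c ** matrix_inv d \<in> stab 1"
    if d: "d \<in> carrier GSp" for d :: "'f^4^4"
  proof -
    define B where "B = 1 + (\<Sum>i\<in>UNIV. \<Sum>j\<in>UNIV. nrm (matrix_inv d $ i $ j))"
    have B: "nrm (matrix_inv d $ i $ j) \<le> B" for i j
    proof -
      have "nrm (matrix_inv d $ i $ j) \<le> (\<Sum>j\<in>UNIV. nrm (matrix_inv d $ i $ j))"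
        by (rule member_le_sum) auto
      also have "\<dots> \<le> (\<Sum>i\<in>UNIV. \<Sum>j\<in>UNIV. nrm (matrix_inv d $ i $ j))"
        by (rule member_le_sum) (auto intro: sum_nonneg)
      finally show ?thesis by (simp add: B_def)
    qed
    have B1: "B > 0" unfolding B_def by (intro add_pos_nonneg sum_nonneg) auto
    have "c ** matrix_inv d \<in> stab 1" if c: "c \<in> carrier GSp" "dist c d < 1 / B" for c
    proof -
      have "small ((c - d) ** matrix_inv d)"
        by (rule small_mult[OF _ B B1])
           (use nrm_entry_diff_le_dist[of c _ _ d] c(2) in \<open>auto intro: le_less_trans\<close>)
      hence "small (c ** matrix_inv d - mat 1)" by (simp add: matrix_diff_mult GSp_inverse_cancel[OF d])
      thus ?thesis using c d
        by (intro Kmax_plus_stab) (simp add: mem_Kmax_plus_iff GSp_mem_mult GSp_matrix_inv_mem)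
    qed
    thus ?thesis using B1 by (intro exI[of _ "1 / B"]) auto
  qed
  then obtain e where e: "\<And>d. d \<in> carrier GSp \<Longrightarrow> e d > 0"
    "\<And>d c. d \<in> carrier GSp \<Longrightarrow> c \<in> carrier GSp \<Longrightarrow> dist c d < e d \<Longrightarrow> c ** matrix_inv d \<in> (stab 1 :: ('f^4^4) set)"
    by metis
  have cover: "C \<subseteq> (\<Union>d\<in>C. ball d (e d))"
  proof
    fix d assume d: "d \<in> C"
    hence "d \<in> ball d (e d)" using e(1) C(2) by auto
    thus "d \<in> (\<Union>d\<in>C. ball d (e d))" using d by blast
  qed
  obtain D where D: "D \<subseteq> C" "finite D" "C \<subseteq> (\<Union>d\<in>D. ball d (e d))"
    by (rule compactE_image[OF C(1) open_ball cover])
  have "\<exists>d\<in>D. c ** matrix_inv d \<in> stab 1" if c: "c \<in> C" for c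
  proof -
    obtain d where "d \<in> D" "c \<in> ball d (e d)" using D(3) c by blast
    hence d: "d \<in> D" "dist c d < e d" by (simp_all add: dist_commute)
    hence "c ** matrix_inv d \<in> stab 1" using D(1) C(2) c by (intro e(2)) auto
    thus ?thesis using d(1) by blast
  qed
  thus ?thesis using D(1,2) by blast
qed

lemma mem_ZK_iff: "g \<in> ZK \<longleftrightarrow> (\<exists>c k. (c::'f) \<noteq> 0 \<and> k \<in> stab 1 \<and> g = mat c ** k)"
  unfolding ZK_def center_GSp Kmax_eq_stab set_mult_def by auto

lemma ZK_GSp: "g \<in> ZK \<Longrightarrow> g \<in> carrier (GSp :: ('f^4^4) monoid)"
  unfolding mem_ZK_iff using GSp_mem_mult mat_mem_GSp stab_GSp by blast

lemma stab_ZK: "g \<in> stab 1 \<Longrightarrow> g \<in> (ZK :: ('f^4^4) set)"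
  unfolding mem_ZK_iff by (intro exI[of _ 1] exI[of _ g]) simp

lemma ZK_mult:
  assumes "g \<in> ZK" "h \<in> ZK"
  shows "g ** h \<in> (ZK :: ('f^4^4) set)"
proof -
  obtain a k b l where *: "a \<noteq> 0" "b \<noteq> 0" "k \<in> stab 1" "l \<in> stab 1" "g = mat a ** k" "h = mat b ** l"
    using assms unfolding mem_ZK_iff by blast
  have "g ** h = mat a ** (k ** mat b) ** l" by (simp add: * matrix_mul_assoc)
  also have "\<dots> = (mat a ** mat b) ** (k ** l)"
    by (simp only: mat_commute[of b k, symmetric] matrix_mul_assoc)
  finally show ?thesis unfolding mem_ZK_iff mat_mult_mat using * stab_mult[of k 1 l]
    by (intro exI[of _ "a * b"] exI[of _ "k ** l"]) simp
qed

lemma ZK_matrix_inv: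
  assumes "g \<in> ZK"
  shows "matrix_inv g \<in> (ZK :: ('f^4^4) set)"
proof -
  obtain a k where *: "a \<noteq> 0" "k \<in> stab 1" "g = mat a ** k"
    using assms unfolding mem_ZK_iff by blast
  note c = GSp_inverse_cancel[OF stab_GSp[OF *(2)]] GSp_inverse_cancel[OF ZK_GSp[OF assms]]
  have "g ** (mat (1 / a) ** matrix_inv k) = mat a ** (k ** mat (1 / a)) ** matrix_inv k"
    by (simp add: * matrix_mul_assoc)
  also have "\<dots> = mat a ** mat (1 / a) ** (k ** matrix_inv k)"
    by (simp only: mat_commute[of "1 / a" k, symmetric] matrix_mul_assoc)
  also have "\<dots> = mat 1" using *(1) by (simp add: c(1) mat_mult_mat)
  finally have "matrix_inv g ** (g ** (mat (1 / a) ** matrix_inv k)) = matrix_inv g" by simp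
  hence "matrix_inv g = mat (1 / a) ** matrix_inv k" by (simp add: c)
  thus ?thesis unfolding mem_ZK_iff using * stab_matrix_inv[OF _ *(2)]
    by (intro exI[of _ "1 / a"] exI[of _ "matrix_inv k"]) simp
qed

text \<open>Unipotent matrices have multiplier 1 and elements of K a unit multiplier, so the central
  factor a satisfies |a|^2 = 1.\<close>

lemma ZK_cap_unipotent:
  assumes "g \<in> ZK" "g \<in> unipotent"
  shows "g \<in> (stab 1 :: ('f^4^4) set)"
proof -
  obtain a k where *: "a \<noteq> 0" "k \<in> stab 1" "g = mat a ** k"
    using assms unfolding mem_ZK_iff by blast
  have k: "multiplier k (similitude k)" "nrm (similitude k) = 1"
    using multiplier_similitude[OF stab_GSp[OF *(2)]] *(2) by (auto simp: stab_def)
  have "multiplier g (a * a * similitude k)" unfolding *(3) by (intro multiplier_mult multiplier_mat k)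
  hence "a * a * similitude k = 1" using multiplier_unique multiplier_unipotent[OF assms(2)] by blast
  hence "nrm a * nrm a * nrm (similitude k) = 1" by (metis nrm_mult nrm_1)
  hence "nrm a * nrm a = 1" by (simp add: k)
  hence a: "nrm a = 1" by (metis abs_of_nonneg power2_eq_1_iff power2_eq_square zero_le_dist abs_1 abs_minus)
  have "g $ i $ j = a * k $ i $ j" for i j
    unfolding *(3) matrix_mult_unit_vec[symmetric]
    by (simp add: matrix_vector_mul_assoc[symmetric] mat_mult_vec)
  hence "nrm (g $ i $ j) \<le> 1" for i j using *(2) a by (simp add: nrm_mult stab_1_iff)
  thus ?thesis using multiplier_unipotent[OF assms(2)] nrm_1 unfolding stab_1_iff by blast
qed

text \<open>Here the inducing representation is trivial through K^+, and so are the characters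
  \<open>uchar\<close> with unit coefficients. The summand of the Whittaker functional is therefore
  constant on each \<open>ucoset n\<close>.\<close>

definition U1 :: "('f^4^4) set" where
  "U1 = unipotent \<inter> Kmax_plus"

definition ucoset :: "'f^4^4 \<Rightarrow> ('f^4^4) set" where
  "ucoset n = (\<lambda>u. u ** n) ` U1"

lemma U1_mult: "u \<in> U1 \<Longrightarrow> v \<in> U1 \<Longrightarrow> u ** v \<in> U1"
  and U1_matrix_inv: "u \<in> U1 \<Longrightarrow> matrix_inv u \<in> U1"
  and U1_1: "mat 1 \<in> U1"
  by (auto simp: U1_def unipotent_mult unipotent_matrix_inv unipotent_1 Kmax_plus_mult
      Kmax_plus_matrix_inv Kmax_plus_1)

lemma U1_GSp: "u \<in> U1 \<Longrightarrow> u \<in> carrier GSp"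
  by (simp add: U1_def unipotent_GSp)

lemma ucoset_absorb:
  assumes v: "v \<in> U1"
  shows "ucoset (v ** n) = ucoset n"
proof
  show "ucoset (v ** n) \<subseteq> ucoset n"
    unfolding ucoset_def using U1_mult[OF _ v] by (auto simp: matrix_mul_assoc)
  show "ucoset n \<subseteq> ucoset (v ** n)"
  proof
    fix m assume "m \<in> ucoset n"
    then obtain u where u: "u \<in> U1" "m = u ** n" by (auto simp: ucoset_def)
    have "m = (u ** matrix_inv v) ** (v ** n)"
      by (simp add: u(2) matrix_mul_assoc GSp_inverse_cancel[OF U1_GSp[OF v]])
    thus "m \<in> ucoset (v ** n)"
      unfolding ucoset_def using U1_mult[OF u(1) U1_matrix_inv[OF v]] by blast
  qed
qed

lemma ucoset_translate: "(\<lambda>m. m ** k) ` ucoset n = ucoset (n ** k)"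
  by (simp add: ucoset_def image_image matrix_mul_assoc)

text \<open>The coset of an integral unipotent matrix is determined by its entries modulo the
  maximal ideal, for which there are finitely many possibilities.\<close>

lemma finite_ucosets_integral: "finite (ucoset ` (unipotent \<inter> stab 1))"
proof -
  define E :: "'f^4^4 \<Rightarrow> 4 \<times> 4 \<Rightarrow> 'f" where "E v = (\<lambda>(i, j). rep (v $ i $ j))" for v
  let ?S = "unipotent \<inter> stab 1 :: ('f^4^4) set"
  have "E ` ?S \<subseteq> UNIV \<rightarrow>\<^sub>E residues" by (auto simp: E_def residues_def stab_1_iff)
  moreover have "finite (UNIV \<rightarrow>\<^sub>E residues :: (4 \<times> 4 \<Rightarrow> 'f) set)"
    by (intro finite_PiE finite_residues) auto
  ultimately have fin: "finite (E ` ?S)" by (rule finite_subset)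
  have eq: "ucoset v = ucoset w" if vw: "v \<in> ?S" "w \<in> ?S" "E v = E w" for v w
  proof -
    have "rep (v $ i $ j) = rep (w $ i $ j)" for i j
      using fun_cong[OF vw(3), of "(i, j)"] by (simp add: E_def)
    hence "small (v - w)" by (simp add: small_def rep_eq_iff)
    hence "v ** matrix_inv w \<in> Kmax_plus"
      using vw by (intro Kmax_plus_of_close) (auto intro: unipotent_GSp)
    hence "v ** matrix_inv w \<in> U1"
      using vw by (simp add: U1_def unipotent_mult unipotent_matrix_inv)
    from ucoset_absorb[OF this, of w] show ?thesis
      using vw by (simp add: GSp_inverse_cancel[OF unipotent_GSp])
  qed
  have "ucoset ` ?S \<subseteq> (\<lambda>e. ucoset (SOME v. v \<in> ?S \<and> E v = e)) ` (E ` ?S)"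
  proof
    fix X assume "X \<in> ucoset ` ?S"
    then obtain v where v: "v \<in> ?S" "X = ucoset v" by blast
    define w where "w = (SOME w. w \<in> ?S \<and> E w = E v)"
    have "\<exists>w. w \<in> ?S \<and> E w = E v" using v(1) by blast
    hence "w \<in> ?S \<and> E w = E v" unfolding w_def by (rule someI_ex)
    hence "X = ucoset w" using eq[of v w] v by simp
    thus "X \<in> (\<lambda>e. ucoset (SOME v. v \<in> ?S \<and> E v = e)) ` (E ` ?S)"
      unfolding w_def using v(1) by blast
  qed
  thus ?thesis using fin finite_surj by blast
qed

text \<open>C meets finitely many cosets K d, so S is covered by finitely many sets of n with n
  d^{-1} in ZK. Two members of such a set differ by a unipotent element of ZK, which is integral;
  each set lies in one translate of the integral unipotent matrices.\<close>

lemma finite_ucosets_of_compact_support: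
  assumes C: "compact C" "C \<subseteq> carrier (GSp :: ('f^4^4) monoid)"
    and S: "S \<subseteq> unipotent" "\<And>n. n \<in> S \<Longrightarrow> \<exists>z\<in>ZK. \<exists>c\<in>C. n = z ** c"
  shows "finite (ucoset ` S)"
proof -
  obtain D where D: "finite D" "D \<subseteq> C" "\<And>c. c \<in> C \<Longrightarrow> \<exists>d\<in>D. c ** matrix_inv d \<in> stab 1"
    using compact_covered_by_cosets[OF C] by blast
  define S' where "S' d = {n \<in> unipotent. n ** matrix_inv d \<in> ZK}" for d :: "'f^4^4"
  have "S \<subseteq> (\<Union>d\<in>D. S' d)"
  proof
    fix n assume n: "n \<in> S"
    obtain z c where zc: "z \<in> ZK" "c \<in> C" "n = z ** c" using S(2)[OF n] by blast
    obtain d where d: "d \<in> D" "c ** matrix_inv d \<in> stab 1" using D(3)[OF zc(2)] by blast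
    have "z ** (c ** matrix_inv d) \<in> ZK" by (intro ZK_mult zc stab_ZK d)
    hence "n \<in> S' d" using n S(1) by (auto simp: S'_def zc(3) matrix_mul_assoc)
    thus "n \<in> (\<Union>d\<in>D. S' d)" using d(1) by blast
  qed
  hence sub: "ucoset ` S \<subseteq> (\<Union>d\<in>D. ucoset ` S' d)" by blast
  have "finite (ucoset ` S' d)" if d: "d \<in> D" for d
  proof (cases "S' d = {}")
    case False
    then obtain m where m: "m \<in> S' d" by blast
    have G: "d \<in> carrier GSp" "m \<in> carrier GSp"
      using d D(2) C(2) m unipotent_GSp by (auto simp: S'_def)
    have "ucoset ` S' d \<subseteq> (\<lambda>X. (\<lambda>k. k ** m) ` X) ` (ucoset ` (unipotent \<inter> stab 1))"
    proof
      fix X assume "X \<in> ucoset ` S' d"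
      then obtain n where n: "n \<in> S' d" "X = ucoset n" by blast
      define v where "v = n ** matrix_inv m"
      have "(n ** matrix_inv d) ** matrix_inv (m ** matrix_inv d) \<in> ZK"
      proof (rule ZK_mult[OF _ ZK_matrix_inv])
        show "n ** matrix_inv d \<in> ZK" "m ** matrix_inv d \<in> ZK" using n m by (simp_all add: S'_def)
      qed
      moreover have "matrix_inv (m ** matrix_inv d) = d ** matrix_inv m"
      proof -
        let ?x = "m ** matrix_inv d"
        have x: "?x \<in> carrier GSp" by (intro GSp_mem_mult GSp_matrix_inv_mem G)
        have "?x ** (d ** matrix_inv m) = mat 1"
          by (simp add: matrix_mul_assoc GSp_inverse_cancel G)
        hence "matrix_inv ?x ** (?x ** (d ** matrix_inv m)) = matrix_inv ?x" by simp
        thus ?thesis unfolding GSp_inverse_cancel(4)[OF x] by simp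
      qed
      ultimately have "v \<in> ZK"
        by (simp add: v_def matrix_mul_assoc GSp_inverse_cancel G)
      moreover have vu: "v \<in> unipotent"
        using n m by (auto simp: v_def S'_def intro: unipotent_mult unipotent_matrix_inv)
      ultimately have "v \<in> unipotent \<inter> stab 1" using ZK_cap_unipotent by blast
      moreover have "X = (\<lambda>k. k ** m) ` ucoset v"
        unfolding ucoset_translate by (simp add: v_def n(2) GSp_inverse_cancel G)
      ultimately show "X \<in> (\<lambda>X. (\<lambda>k. k ** m) ` X) ` (ucoset ` (unipotent \<inter> stab 1))" by blast
    qed
    thus ?thesis using finite_ucosets_integral finite_surj by blast
  qed simp
  thus ?thesis using sub D(1) finite_subset by blast
qed

end

section \<open>Compact induction and the Whittaker functional\<close>

lemma sub_GSp_simps [simp]: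
  "g \<otimes>\<^bsub>sub_GSp H\<^esub> h = g ** h" "\<one>\<^bsub>sub_GSp H\<^esub> = mat 1" "carrier (sub_GSp H) = H"
  by (simp_all add: GSp_def)

lemma is_rep_sub_GSp:
  assumes "is_rep (sub_GSp H) \<sigma>"
  shows "complex_space.subspace (rspace \<sigma>)"
    "g \<in> H \<Longrightarrow> v \<in> rspace \<sigma> \<Longrightarrow> act \<sigma> g v \<in> rspace \<sigma>"
    "g \<in> H \<Longrightarrow> linear_on (rspace \<sigma>) (act \<sigma> g)"
    "v \<in> rspace \<sigma> \<Longrightarrow> act \<sigma> (mat 1) v = v"
    "g \<in> H \<Longrightarrow> h \<in> H \<Longrightarrow> v \<in> rspace \<sigma> \<Longrightarrow> act \<sigma> (g ** h) v = act \<sigma> g (act \<sigma> h v)"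
  using assms by (auto simp: is_rep_def)

lemma linear_on_scale: "linear_on V T \<Longrightarrow> v \<in> V \<Longrightarrow> T (scaleC a v) = scaleC a (T v)"
  by (simp_all add: linear_on_def)

lemma linear_on_0: "linear_on V T \<Longrightarrow> complex_space.subspace V \<Longrightarrow> T 0 = 0"
  using linear_on_scale[of V T 0 0] complex_space.subspace_0[of V] by simp

text \<open>Extend from the line through w. Equivariance of the Whittaker functional will come from
  the sum over cosets, so any such form on the inducing space will do.\<close>

lemma linear_functional_exists:
  fixes w :: "'w::complex_space"
  assumes "w \<noteq> 0"
  shows "\<exists>\<phi> :: 'w \<Rightarrow> complex. (\<forall>x y. \<phi> (x + y) = \<phi> x + \<phi> y) \<and> (\<forall>a x. \<phi> (scaleC a x) = a * \<phi> x) \<and> \<phi> w = 1"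
proof -
  interpret vp: vector_space_pair "scaleC :: complex \<Rightarrow> 'w \<Rightarrow> 'w" "scaleC :: complex \<Rightarrow> complex \<Rightarrow> complex"
    by unfold_locales
  have "\<not> complex_space.dependent {w}" using assms by (simp add: complex_space.dependent_single)
  then obtain \<phi> where \<phi>: "Vector_Spaces.linear scaleC scaleC \<phi>" "\<phi> w = (1::complex)"
    using vp.linear_independent_extend[of "{w}" "\<lambda>_. 1"] by auto
  thus ?thesis
    using vp.linear_add[OF \<phi>(1)] vp.linear_scale[OF \<phi>(1)]
    by (intro exI[of _ \<phi>]) (simp add: scaleC_complex_def)
qed

lemma cInd_rspace_iff:
  "f \<in> rspace (cInd GSp H \<sigma>) \<longleftrightarrow> (\<forall>g\<in>carrier GSp. f g \<in> rspace \<sigma>) \<and> (\<forall>g. g \<notin> carrier GSp \<longrightarrow> f g = 0) \<and>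
     (\<forall>h\<in>H. \<forall>g\<in>carrier GSp. f (h ** g) = act \<sigma> h (f g)) \<and>
     (\<exists>U. subgroup U GSp \<and> openin (top_of_set (carrier GSp)) U \<and>
        (\<forall>u\<in>U. \<forall>g\<in>carrier GSp. f (g ** u) = f g)) \<and>
     (\<exists>C. compact C \<and> C \<subseteq> carrier GSp \<and> {g \<in> carrier GSp. f g \<noteq> 0} \<subseteq> H <#>\<^bsub>GSp\<^esub> C)"
  by (simp add: cInd_def)

lemma cInd_act: "act (cInd GSp H \<sigma>) g f x = (if x \<in> carrier GSp then f (x ** g) else 0)"
  by (simp add: cInd_def)

context unramified_character
begin

definition uchar :: "'f \<Rightarrow> 'f \<Rightarrow> 'f^4^4 \<Rightarrow> complex" where
  "uchar c d n = \<psi> (c * n $ 1 $ 2 + d * n $ 2 $ 3)"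

lemma uchar_mult: "n \<in> unipotent \<Longrightarrow> m \<in> unipotent \<Longrightarrow> uchar c d (n ** m) = uchar c d n * uchar c d m"
  by (simp add: uchar_def unipotent_mult algebra_simps flip: psi_add)

lemma uchar_neq_0: "uchar c d n \<noteq> 0"
  by (simp add: uchar_def psi_neq_0)

lemma uchar_U1:
  assumes "nrm c = 1" "nrm d = 1" "u \<in> U1"
  shows "uchar c d u = 1"
proof -
  have "nrm (u $ i $ j) < 1" if "i \<noteq> j" for i j
  proof -
    have "nrm (u $ i $ j - mat 1 $ i $ j) < 1"
      using assms(3) by (simp add: U1_def Kmax_plus_iff)
    thus ?thesis using that by (simp add: mat_1_entry)
  qed
  hence "nrm (u $ 1 $ 2) < 1" "nrm (u $ 2 $ 3) < 1" by simp_all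
  thus ?thesis unfolding uchar_def using assms
    by (intro psi_eq_1 nrm_add_less) (simp_all add: nrm_mult)
qed

text \<open>Nonvanishing is tested on the function supported on ZK with value \<open>w0\<close> at
  1. The upper unipotent group meets ZK only in integral matrices, and there the eigencharacter of
  \<open>w0\<close> cancels the weight, so the functional counts the integral cosets of
  \<open>U1\<close>.\<close>

lemma generic_cInd_ZK:
  fixes \<sigma> :: "('f^4^4, 'w::complex_space) rep"
  assumes rep: "is_rep (sub_GSp ZK) \<sigma>"
    and plus: "\<And>g w. g \<in> Kmax_plus \<Longrightarrow> w \<in> rspace \<sigma> \<Longrightarrow> act \<sigma> g w = w"
    and cd: "nrm c0 = 1" "nrm d0 = 1"
    and w0: "w0 \<in> rspace \<sigma>" "w0 \<noteq> 0"
    and eig: "\<And>n. n \<in> unipotent \<Longrightarrow> n \<in> stab 1 \<Longrightarrow> act \<sigma> n w0 = scaleC (uchar c0 d0 n) w0"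
  shows "generic (cInd GSp ZK \<sigma>)"
proof -
  note rep = is_rep_sub_GSp[OF rep]
  let ?R = "rspace (cInd GSp ZK \<sigma>)"
  let ?U = "ucoset ` unipotent"
  obtain \<phi> :: "'w \<Rightarrow> complex" where \<phi>: "\<And>x y. \<phi> (x + y) = \<phi> x + \<phi> y" "\<And>a x. \<phi> (scaleC a x) = a * \<phi> x" "\<phi> w0 = 1"
    using linear_functional_exists[OF w0(2)] by blast
  have \<phi>0: "\<phi> 0 = 0" using \<phi>(2)[of 0 0] by simp
  define \<theta> where "\<theta> = uchar c0 d0"
  \<comment> \<open>The Whittaker functional is \<open>l f = \<Sum> \<theta>(n)\<^sup>-\<^sup>1 \<phi>(f(n))\<close> over \<open>n \<in> U\<^sub>1 \<setminus> U\<close>. The summand \<open>q f\<close> is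
    constant on cosets, so \<open>the_elem\<close> reads off its value, and only finitely many cosets contribute.\<close>
  define q where "q f n = inverse (\<theta> n) * \<phi> (f n)" for f :: "'f^4^4 \<Rightarrow> 'w" and n
  define val where "val f X = the_elem (q f ` X)" for f X
  define l where "l f = infsum (val f) ?U" for f
  have val: "val f (ucoset n) = q f n"
    if n: "n \<in> unipotent" and f: "\<And>u. u \<in> U1 \<Longrightarrow> f (u ** n) = f n" for f n
  proof -
    have "q f (u ** n) = q f n" if u: "u \<in> U1" for u
    proof -
      have "u \<in> unipotent" using u by (simp add: U1_def)
      thus ?thesis using n uchar_U1[OF cd u] by (simp add: q_def \<theta>_def uchar_mult f[OF u])
    qed
    hence "q f ` ucoset n = {q f n}" using U1_1 by (auto simp: ucoset_def image_image)
    thus ?thesis by (simp add: val_def)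
  qed
  have inv: "f (u ** n) = f n" if "f \<in> ?R" "n \<in> unipotent" "u \<in> U1" for f n u
  proof -
    have "u \<in> Kmax_plus" using that(3) by (simp add: U1_def)
    moreover have "n \<in> carrier GSp" using that(2) by (rule unipotent_GSp)
    ultimately show ?thesis
      using that(1) plus[of u "f n"] stab_ZK[OF Kmax_plus_stab[of u]] by (simp add: cInd_rspace_iff)
  qed
  have valR: "val f (ucoset n) = q f n" if "f \<in> ?R" "n \<in> unipotent" for f n
    using that by (intro val inv)
  \<comment> \<open>The support is compact modulo ZK, so \<open>infsum\<close> is in fact a finite
    sum and may be split termwise.\<close>
  have summable: "val f summable_on ?U" if f: "f \<in> ?R" for f
  proof (rule finite_nonzero_values_imp_summable_on)
    obtain C where C: "compact C" "C \<subseteq> carrier GSp" "{g \<in> carrier GSp. f g \<noteq> 0} \<subseteq> ZK <#>\<^bsub>GSp\<^esub> C"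
      using f unfolding cInd_rspace_iff by blast
    let ?S = "{n \<in> unipotent. f n \<noteq> 0}"
    have "finite (ucoset ` ?S)"
    proof (rule finite_ucosets_of_compact_support[OF C(1,2)])
      fix n assume "n \<in> ?S"
      hence "n \<in> ZK <#>\<^bsub>GSp\<^esub> C" using C(3) unipotent_GSp by blast
      thus "\<exists>z\<in>ZK. \<exists>c\<in>C. n = z ** c" by (simp add: set_mult_def)
    qed blast
    moreover have "{X \<in> ?U. val f X \<noteq> 0} \<subseteq> ucoset ` ?S"
    proof
      fix X assume X: "X \<in> {X \<in> ?U. val f X \<noteq> 0}"
      then obtain n where n: "n \<in> unipotent" "X = ucoset n" by blast
      have "q f n \<noteq> 0" using X unfolding n(2) by (simp add: valR f n(1))
      hence "n \<in> ?S" using n(1) by (auto simp: q_def \<phi>0)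
      thus "X \<in> ucoset ` ?S" using n(2) by blast
    qed
    ultimately show "finite {X \<in> ?U. val f X \<noteq> 0}" by (rule rev_finite_subset)
  qed
  have "linear_on ?R l"
    unfolding linear_on_def
  proof (intro conjI ballI allI)
    fix f g assume fg: "f \<in> ?R" "g \<in> ?R"
    have "l (f + g) = infsum (\<lambda>X. val f X + val g X) ?U"
      unfolding l_def
    proof (rule infsum_cong)
      fix X assume "X \<in> ?U"
      then obtain n where n: "n \<in> unipotent" "X = ucoset n" by blast
      have "val (f + g) X = q (f + g) n"
        unfolding n(2) by (rule val[OF n(1)]) (simp add: inv[OF fg(1) n(1)] inv[OF fg(2) n(1)])
      thus "val (f + g) X = val f X + val g X"
        unfolding n(2) valR[OF fg(1) n(1)] valR[OF fg(2) n(1)]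
        by (simp add: q_def \<phi> ring_distribs)
    qed
    thus "l (f + g) = l f + l g"
      unfolding l_def by (simp add: infsum_add summable fg)
  next
    fix a f assume f: "f \<in> ?R"
    have "l (scaleC a f) = infsum (\<lambda>X. a * val f X) ?U"
      unfolding l_def
    proof (rule infsum_cong)
      fix X assume "X \<in> ?U"
      then obtain n where n: "n \<in> unipotent" "X = ucoset n" by blast
      have "val (scaleC a f) X = q (scaleC a f) n"
        unfolding n(2) by (rule val[OF n(1)]) (simp add: inv[OF f n(1)] scaleC_fun_def)
      thus "val (scaleC a f) X = a * val f X"
        unfolding n(2) valR[OF f n(1)] by (simp add: q_def \<phi> scaleC_fun_def)
    qed
    thus "l (scaleC a f) = scaleC a (l f)"
      unfolding l_def by (simp add: infsum_cmult_right' scaleC_complex_def)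
  qed
  moreover have "l (act (cInd GSp ZK \<sigma>) k f) = \<theta> k * l f"
    if k: "k \<in> unipotent" and f: "f \<in> ?R" for k f
  proof -
    define sh where "sh X = (\<lambda>m. m ** k) ` X" for X :: "('f^4^4) set"
    have sh: "sh (ucoset n) = ucoset (n ** k)" for n by (simp add: sh_def ucoset_translate)
    \<comment> \<open>Right translation by k permutes the cosets; reindexing along it produces the
      factor \<open>\<theta> k\<close>.\<close>
    have bij: "bij_betw sh ?U ?U"
    proof (rule bij_betw_byWitness[where f' = "\<lambda>X. (\<lambda>m. m ** matrix_inv k) ` X"])
      show "\<forall>X\<in>?U. (\<lambda>m. m ** matrix_inv k) ` sh X = X" "\<forall>X\<in>?U. sh ((\<lambda>m. m ** matrix_inv k) ` X) = X"
        by (simp_all add: sh_def image_image GSp_inverse_cancel[OF unipotent_GSp[OF k]])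
      show "sh ` ?U \<subseteq> ?U" using k by (auto simp: sh unipotent_mult)
      show "(\<lambda>X. (\<lambda>m. m ** matrix_inv k) ` X) ` ?U \<subseteq> ?U"
        using unipotent_matrix_inv[OF k] by (auto simp: ucoset_translate unipotent_mult)
    qed
    have "l (act (cInd GSp ZK \<sigma>) k f) = infsum (\<lambda>X. \<theta> k * val f (sh X)) ?U"
      unfolding l_def
    proof (rule infsum_cong)
      fix X assume "X \<in> ?U"
      then obtain n where n: "n \<in> unipotent" "X = ucoset n" by blast
      have nk: "n ** k \<in> unipotent" using n(1) k by (rule unipotent_mult)
      have un: "u ** n \<in> carrier GSp" if "u \<in> U1" for u
        using U1_GSp[OF that] unipotent_GSp[OF n(1)] by (rule GSp_mem_mult)
      have "val (act (cInd GSp ZK \<sigma>) k f) X = q (act (cInd GSp ZK \<sigma>) k f) n"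
        unfolding n(2)
        by (rule val[OF n(1)])
           (simp add: cInd_act un unipotent_GSp[OF n(1)] inv[OF f nk] flip: matrix_mul_assoc)
      also have "\<dots> = \<theta> k * q f (n ** k)"
        using uchar_neq_0 by (simp add: q_def cInd_act unipotent_GSp[OF n(1)] \<theta>_def uchar_mult n(1) k)
      also have "q f (n ** k) = val f (sh X)"
        unfolding n(2) sh by (rule valR[OF f nk, symmetric])
      finally show "val (act (cInd GSp ZK \<sigma>) k f) X = \<theta> k * val f (sh X)" .
    qed
    also have "\<dots> = \<theta> k * infsum (\<lambda>X. val f (sh X)) ?U" by (rule infsum_cmult_right')
    also have "infsum (\<lambda>X. val f (sh X)) ?U = l f"
      unfolding l_def by (rule infsum_reindex_bij_betw[OF bij])
    finally show ?thesis .
  qed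
  ultimately have whittaker: "whittaker_functional \<psi> c0 d0 (cInd GSp ZK \<sigma>) l"
    by (simp add: whittaker_functional_def \<theta>_def uchar_def unipotent_def)
  define f0 where "f0 g = (if g \<in> ZK then act \<sigma> g w0 else 0)" for g
  have f0R: "f0 \<in> ?R"
    unfolding cInd_rspace_iff
  proof (intro conjI ballI allI impI)
    fix g :: "'f^4^4"
    show "f0 g \<in> rspace \<sigma>"
      using rep(2) w0 complex_space.subspace_0[OF rep(1)] by (simp add: f0_def)
    show "f0 g = 0" if "g \<notin> carrier GSp" using that ZK_GSp by (auto simp: f0_def)
  next
    fix h g :: "'f^4^4" assume hg: "h \<in> ZK" "g \<in> carrier GSp"
    show "f0 (h ** g) = act \<sigma> h (f0 g)"
    proof (cases "g \<in> ZK")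
      case True
      thus ?thesis using hg ZK_mult rep(5) w0(1) by (simp add: f0_def)
    next
      case False
      have "h ** g \<notin> ZK"
      proof
        assume "h ** g \<in> ZK"
        from ZK_mult[OF ZK_matrix_inv[OF hg(1)] this] have "matrix_inv h ** (h ** g) \<in> ZK" .
        thus False using False by (simp add: GSp_inverse_cancel[OF ZK_GSp[OF hg(1)]])
      qed
      thus ?thesis using False linear_on_0[OF rep(3)[OF hg(1)] rep(1)] by (simp add: f0_def)
    qed
  next
    have "f0 (g ** u) = f0 g" if u: "u \<in> Kmax_plus" for u g :: "'f^4^4"
    proof -
      have uZ: "u \<in> ZK" using u by (intro stab_ZK Kmax_plus_stab)
      have "g ** u \<in> ZK \<longleftrightarrow> g \<in> ZK"
      proof
        assume "g ** u \<in> ZK"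
        from ZK_mult[OF this ZK_matrix_inv[OF uZ]] have "g ** u ** matrix_inv u \<in> ZK" .
        thus "g \<in> ZK" by (simp add: GSp_inverse_cancel[OF ZK_GSp[OF uZ]])
      qed (simp add: ZK_mult uZ)
      thus ?thesis using rep(5)[of g u w0] uZ w0(1) plus[OF u w0(1)] by (simp add: f0_def)
    qed
    thus "\<exists>U. subgroup U GSp \<and> openin (top_of_set (carrier GSp)) U \<and> (\<forall>u\<in>U. \<forall>g\<in>carrier GSp. f0 (g ** u) = f0 g)"
      using subgroup_Kmax_plus openin_Kmax_plus by blast
  next
    show "\<exists>C. compact C \<and> C \<subseteq> carrier GSp \<and> {g \<in> carrier GSp. f0 g \<noteq> 0} \<subseteq> ZK <#>\<^bsub>GSp\<^esub> C"
      by (intro exI[of _ "{mat 1}"]) (auto simp: GSp_mem_1 f0_def set_mult_def split: if_splits)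
  qed
  let ?Uint = "ucoset ` (unipotent \<inter> stab 1)"
  have outside: "val f0 X = 0" if X: "X \<in> ?U - ?Uint" for X
  proof -
    obtain n where n: "n \<in> unipotent" "X = ucoset n" using X by blast
    hence "n \<notin> ZK" using X ZK_cap_unipotent by blast
    thus "val f0 X = 0"
      unfolding n(2) valR[OF f0R n(1)] by (simp add: q_def f0_def \<phi>0)
  qed
  have inside: "val f0 X = 1" if X: "X \<in> ?Uint" for X
  proof -
    obtain n where n: "n \<in> unipotent" "n \<in> stab 1" "X = ucoset n" using X by blast
    thus "val f0 X = 1"
      unfolding n(3) valR[OF f0R n(1)] using uchar_neq_0
      by (simp add: q_def f0_def stab_ZK eig \<theta>_def \<phi>)
  qed
  have "l f0 = infsum (\<lambda>X. 1) ?Uint"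
    unfolding l_def by (rule infsum_cong_neutral) (blast, erule outside, simp add: inside)
  also have "\<dots> = of_nat (card ?Uint)" using finite_ucosets_integral by simp
  also have "\<dots> \<noteq> 0"
    using finite_ucosets_integral unipotent_1 stab_1 by (auto simp: card_eq_0_iff)
  finally have "l f0 \<noteq> 0" .
  moreover have "c0 \<noteq> 0" "d0 \<noteq> 0" using cd by auto
  ultimately show ?thesis
    unfolding generic_def using psi_character whittaker f0R by blast
qed

end

section \<open>Vectors fixed by Klingen subgroups\<close>

text \<open>Cuspidality speaks of cosets in H/N; inflation lets it be tested on the representatives
  h u h^{-1}, acting through the representation of H itself.\<close>

lemma no_fixed_vectors:
  assumes infl: "is_inflation (sub_GSp H) N \<sigma> \<rho>" and cusp: "cuspidal_wrt R \<rho>"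
    and R: "quotient_conjugates H N U \<subseteq> R" and HG: "H \<subseteq> carrier GSp" and h: "h \<in> H"
    and conj: "\<And>u. u \<in> U \<Longrightarrow> h ** u ** matrix_inv h \<in> H"
    and v: "v \<in> rspace \<sigma>" and fixed: "\<And>u. u \<in> U \<Longrightarrow> act \<sigma> (h ** u ** matrix_inv h) v = v"
  shows "v = 0"
proof -
  let ?X = "(\<lambda>u. N #>\<^bsub>GSp\<^esub> (h \<otimes>\<^bsub>GSp\<^esub> u \<otimes>\<^bsub>GSp\<^esub> inv\<^bsub>GSp\<^esub> h)) ` U"
  have "?X \<in> R" using R h unfolding quotient_conjugates_def by blast
  hence "fixed_vectors \<rho> ?X = {0}" using cusp by (simp add: cuspidal_wrt_def)
  moreover have "v \<in> fixed_vectors \<rho> ?X"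
  proof -
    have act: "act \<sigma> k v = act \<rho> (N #>\<^bsub>GSp\<^esub> k) v" if "k \<in> H" for k
      using infl v that by (simp add: is_inflation_def r_coset_def)
    have "act \<rho> (N #>\<^bsub>GSp\<^esub> (h ** u ** matrix_inv h)) v = v" if "u \<in> U" for u
      using act[OF conj[OF that]] fixed[OF that] by simp
    moreover have "h \<in> carrier GSp" using h HG by blast
    moreover have "v \<in> rspace \<rho>" using infl v by (simp add: is_inflation_def)
    ultimately show ?thesis by (simp add: fixed_vectors_def GSp_inv)
  qed
  ultimately show ?thesis by blast
qed

lemma inflation_trivial:
  assumes infl: "is_inflation (sub_GSp H) N \<sigma> \<rho>" and N: "subgroup N GSp" "N \<subseteq> H"
    and one: "act \<sigma> (mat 1) v = v" and g: "g \<in> N" and v: "v \<in> rspace \<sigma>"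
  shows "act \<sigma> g v = v"
proof -
  have m1: "mat 1 \<in> N" using subgroup.one_closed[OF N(1)] by simp
  have "N #>\<^bsub>GSp\<^esub> g = N" "N #>\<^bsub>GSp\<^esub> mat 1 = N"
    using subgroup.rcos_const[OF N(1) group_GSp] g m1 by blast+
  moreover have "act \<sigma> k v = act \<rho> (N #>\<^bsub>GSp\<^esub> k) v" if "k \<in> H" for k
    using infl v that by (simp add: is_inflation_def r_coset_def)
  ultimately show ?thesis using one g m1 N(2) by (metis subsetD)
qed

lemma fixed_vectors_isomorphic:
  assumes T: "linear_on (rspace \<pi>) T" "bij_betw T (rspace \<pi>) (rspace \<rho>)"
    "\<forall>g\<in>carrier G. \<forall>v\<in>rspace \<pi>. T (act \<pi> g v) = act \<rho> g (T v)"
    and H: "H \<subseteq> carrier G" and v: "v \<in> fixed_vectors \<pi> H"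
  shows "T v \<in> fixed_vectors \<rho> H"
proof -
  have "T v \<in> rspace \<rho>" using T(2) v by (auto simp: fixed_vectors_def bij_betw_def)
  moreover have "act \<rho> h (T v) = T v" if "h \<in> H" for h
    using bspec[OF bspec[OF T(3), of h], of v] H v that by (auto simp: fixed_vectors_def)
  ultimately show ?thesis by (simp add: fixed_vectors_def)
qed

lemma generic_isomorphic:
  assumes rep: "is_rep GSp \<pi>" and T: "linear_on (rspace \<pi>) T" "bij_betw T (rspace \<pi>) (rspace \<rho>)"
    "\<forall>g\<in>carrier GSp. \<forall>v\<in>rspace \<pi>. T (act \<pi> g v) = act \<rho> g (T v)"
    and gen: "generic \<rho>"
  shows "generic \<pi>"
proof -
  obtain \<psi> c1 c2 l w where l: "nontrivial_additive_character \<psi>" "c1 \<noteq> 0" "c2 \<noteq> 0"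
    "whittaker_functional \<psi> c1 c2 \<rho> l" "w \<in> rspace \<rho>" "l w \<noteq> 0"
    using gen unfolding generic_def by blast
  have mem: "T v \<in> rspace \<rho>" if "v \<in> rspace \<pi>" for v
    using T(2) that by (auto simp: bij_betw_def)
  have "whittaker_functional \<psi> c1 c2 \<pi> (l \<circ> T)"
    using l(4) T(1,3) mem unfolding whittaker_functional_def linear_on_def supported_on_def by simp
  moreover have "w \<in> T ` rspace \<pi>" using T(2) l(5) by (simp add: bij_betw_def)
  then obtain v where "v \<in> rspace \<pi>" "T v = w" by blast
  ultimately show ?thesis using l unfolding generic_def by fastforce
qed

lemma Kl_GSp: "Kl n \<subseteq> carrier GSp"
  by (auto simp: Kl_def GSp0_def)

lemma klingen_pos_decomposition:
  assumes "u \<in> supported_on klingen_pos H" "H \<subseteq> carrier GSp"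
  shows "u = klingen (u $ 1 $ 2) (u $ 2 $ 4) (u $ 1 $ 4)"
proof -
  have "u \<in> unipotent" using assms by (auto simp: unipotent_def supported_on_def)
  moreover have "u $ 2 $ 3 = 0" using assms(1) by (simp add: supported_on_def mat_1_entry)
  ultimately show ?thesis using unipotent_decomposition[of u] by (simp add: levi_1)
qed

lemma siegel_pos_decomposition:
  assumes "u \<in> supported_on siegel_pos H" "H \<subseteq> carrier GSp"
  shows "u = klingen 0 (u $ 2 $ 4) (u $ 1 $ 4) ** levi 1 (u $ 2 $ 3) 0 1"
proof -
  have "u \<in> unipotent" using assms by (auto simp: unipotent_def supported_on_def)
  moreover have "u $ 1 $ 2 = 0" using assms(1) by (simp add: supported_on_def mat_1_entry)
  ultimately show ?thesis using unipotent_decomposition[of u] by simp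
qed

lemma root_14_eq_transvection:
  assumes "u \<in> supported_on {(1,4)} H"
  shows "u = transvection (unit_vec 1) (- u $ 1 $ 4)"
  using assms unfolding supported_on_def mem_Collect_eq
  by (simp add: vec_eq_iff forall_4 transvection_unit_vec klingen_def mat_1_entry)

lemma root_23_eq_transvection:
  assumes "u \<in> supported_on {(2,3)} H"
  shows "u = transvection (unit_vec 2) (- u $ 2 $ 3)"
  using assms unfolding supported_on_def mem_Collect_eq
  by (simp add: vec_eq_iff forall_4 transvection_unit_vec levi_def mat_1_entry)

context local_field
begin

lemma transvection_mem_stab:
  assumes t: "t > 0" and i: "i \<in> {1, 2}" and b: "nrm (b::'f) * (vnorm t (unit_vec i :: 'f^4))\<^sup>2 \<le> 1"
  shows "transvection (unit_vec i) b \<in> stab t"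
proof (cases "i = 1")
  case True
  hence "nrm b \<le> t * t" using b t by (simp add: vnorm_unit_vec power2_eq_square pos_divide_le_eq)
  thus ?thesis using True stab_explicit(1)[OF t, of 0 0 "- b"] t
    by (simp add: transvection_unit_vec nrm_minus)
next
  case False
  hence "i = 2" using i by simp
  moreover from this have "nrm b \<le> 1" using b t by (simp add: vnorm_unit_vec)
  ultimately show ?thesis using stab_explicit(3)[OF t, of 1 1 "- b" 0]
    by (simp add: transvection_unit_vec nrm_minus nrm_1)
qed

text \<open>For k in the conjugated root group, k g = g u with u in Kl(p^n). Equivariance on the
  left gives \<open>f (k ** g) = act \<sigma> k (f g)\<close>, and invariance on the right gives
  \<open>f (g ** u) = f g\<close>.\<close>

lemma Kl_fixed_root_group:
  assumes t: "t > 0" and v: "nrm (v::'f) * (t * t) = 1" and H: "stab t \<subseteq> H"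
    and f: "f \<in> fixed_vectors (cInd GSp H \<sigma>) (Kl n)" and g: "g \<in> carrier (GSp :: ('f^4^4) monoid)"
  shows "\<exists>h\<in>stab t. \<exists>i\<in>{1,2}. \<forall>b. nrm (b::'f) * (vnorm t (unit_vec i :: 'f^4))\<^sup>2 \<le> 1 \<longrightarrow>
    act \<sigma> (h ** transvection (unit_vec i) b ** matrix_inv h) (f g) = f g"
proof -
  have fR: "f \<in> rspace (cInd GSp H \<sigma>)" and fix_f: "\<And>k. k \<in> Kl n \<Longrightarrow> act (cInd GSp H \<sigma>) k f = f"
    using f by (auto simp: fixed_vectors_def)
  obtain h i where h: "h \<in> stab t" "i \<in> {1,2}"
    and conj: "\<And>b. nrm (b::'f) * (vnorm t (unit_vec i :: 'f^4))\<^sup>2 \<le> 1 \<Longrightarrow>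
      \<exists>j\<in>{2,3}. \<exists>b'. nrm b' \<le> 1 \<and>
      (h ** transvection (unit_vec i) b ** matrix_inv h) ** g = g ** transvection (unit_vec j) b'"
    using conjugate_of_root_group[OF t v g] by blast
  have "act \<sigma> (h ** transvection (unit_vec i) b ** matrix_inv h) (f g) = f g"
    if b: "nrm b * (vnorm t (unit_vec i :: 'f^4))\<^sup>2 \<le> 1" for b
  proof -
    let ?k = "h ** transvection (unit_vec i) b ** matrix_inv h"
    have "?k \<in> stab t" by (intro stab_mult stab_matrix_inv h t transvection_mem_stab b)
    hence "f (?k ** g) = act \<sigma> ?k (f g)" using fR g H by (auto simp: cInd_rspace_iff)
    moreover obtain j b' where j: "j \<in> {2,3}" "nrm b' \<le> 1" "?k ** g = g ** transvection (unit_vec j) b'"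
      using conj[OF b] by blast
    have "f (g ** transvection (unit_vec j) b') = f g"
      using fun_cong[OF fix_f[OF transvection_mem_Kl[OF j(1,2)]], of g] g by (simp add: cInd_act)
    ultimately show ?thesis by (simp add: j(3))
  qed
  thus ?thesis using h by blast
qed

text \<open>The orbit of e_1 leads to the root group at (1,4) and that of e_2 to the one at (2,3),
  one for each of the two GL(2) blocks of the reductive quotient.\<close>

lemma cInd_Kpara_no_fixed_vectors:
  fixes \<tau> :: "('f^4^4, 'w::complex_space) rep"
  assumes datum: "inducing_datum_Kpara \<tau>"
    and f: "f \<in> fixed_vectors (cInd GSp (normalizer GSp Kpara) \<tau>) (Kl n)"
  shows "f = 0"
proof -
  obtain w :: 'f where w: "0 < nrm w" "nrm w < 1" "\<And>x::'f. nrm x < 1 \<Longrightarrow> nrm x \<le> nrm w"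
    using uniformizer_exists by blast
  define t where "t = 1 / sqrt (nrm w)"
  have t: "t > 0" and wt: "nrm w * (t * t) = 1" using w(1) by (simp_all add: t_def)
  have K: "Kpara = (stab t :: ('f^4^4) set)" using Kpara_eq_stab[OF w] by (simp add: t_def)
  have norm: "(stab t :: ('f^4^4) set) \<subseteq> normalizer GSp Kpara"
    using subgroup.subset[OF normal_imp_subgroup[OF group.subgroup_in_normalizer[OF group_GSp subgroup_stab[OF t]]]]
    unfolding K by simp
  obtain \<rho> where \<rho>: "cuspidal_wrt radicals_Kpara \<rho>" "is_inflation (sub_GSp Kpara) Kpara_plus \<tau> \<rho>"
    using datum unfolding inducing_datum_Kpara_def by blast
  have fR: "f \<in> rspace (cInd GSp (normalizer GSp Kpara) \<tau>)" using f by (simp add: fixed_vectors_def)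
  have "f g = 0" if g: "g \<in> carrier GSp" for g
  proof -
    have fg: "f g \<in> rspace \<tau>" using fR g by (simp add: cInd_rspace_iff)
    obtain h i where h: "h \<in> stab t" "i \<in> {1,2}"
      and fixed: "\<And>b. nrm (b::'f) * (vnorm t (unit_vec i :: 'f^4))\<^sup>2 \<le> 1 \<Longrightarrow>
        act \<tau> (h ** transvection (unit_vec i) b ** matrix_inv h) (f g) = f g"
      using Kl_fixed_root_group[OF t wt norm f g] by blast
    define S :: "(4 \<times> 4) set" where "S = (if i = 1 then {(1,4)} else {(2,3)})"
    have radicals: "quotient_conjugates Kpara Kpara_plus (supported_on S Kpara) \<subseteq> (radicals_Kpara :: ('f^4^4) set set set)"
      unfolding radicals_Kpara_def S_def by auto
    show ?thesis
    proof (rule no_fixed_vectors[OF \<rho>(2,1) radicals _ _ _ fg])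
      show "Kpara \<subseteq> carrier (GSp :: ('f^4^4) monoid)" "h \<in> Kpara" using stab_GSp h(1) by (auto simp: K)
      fix u :: "'f^4^4" assume u: "u \<in> supported_on S Kpara"
      hence us: "u \<in> stab t" by (simp add: supported_on_def K)
      thus "h ** u ** matrix_inv h \<in> Kpara" unfolding K by (intro stab_mult stab_matrix_inv h t)
      have le: "nrm (u $ j $ k) \<le> weight t j / weight t k" for j k using us by (simp add: stab_iff[OF t])
      show "act \<tau> (h ** u ** matrix_inv h) (f g) = f g"
      proof (cases "i = 1")
        case True
        hence "u = transvection (unit_vec 1) (- u $ 1 $ 4)" using u root_14_eq_transvection by (simp add: S_def)
        moreover have "nrm (- u $ 1 $ 4) * (vnorm t (unit_vec 1 :: 'f^4))\<^sup>2 \<le> 1"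
          using le[of 1 4] t by (simp add: vnorm_unit_vec power2_eq_square pos_divide_le_eq nrm_minus)
        ultimately show ?thesis using fixed[of "- u $ 1 $ 4"] True by simp
      next
        case False
        hence i: "i = 2" using h(2) by simp
        hence "u = transvection (unit_vec 2) (- u $ 2 $ 3)" using u root_23_eq_transvection by (simp add: S_def)
        moreover have "nrm (- u $ 2 $ 3) * (vnorm t (unit_vec 2 :: 'f^4))\<^sup>2 \<le> 1"
          using le[of 2 3] t by (simp add: vnorm_unit_vec nrm_minus)
        ultimately show ?thesis using fixed[of "- u $ 2 $ 3"] i by simp
      qed
    qed
  qed
  moreover have "f g = 0" if "g \<notin> carrier GSp" for g using fR that by (simp add: cInd_rspace_iff)
  ultimately show ?thesis by (auto simp: fun_eq_iff)
qed

end

context unramified_character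
begin

lemma cInd_ZK_generic_of_fixed_vector:
  fixes \<sigma> :: "('f^4^4, 'w::complex_space) rep"
  assumes datum: "inducing_datum_Kmax \<sigma>"
    and f: "f \<in> fixed_vectors (cInd GSp ZK \<sigma>) (Kl n)" "f \<noteq> 0"
  shows "generic (cInd GSp ZK \<sigma>)"
proof -
  have rep: "is_rep (sub_GSp ZK) \<sigma>" using datum by (simp add: inducing_datum_Kmax_def smooth_rep_def)
  obtain \<rho> where \<rho>: "cuspidal_wrt radicals_Kmax \<rho>" "is_inflation (sub_GSp Kmax) Kmax_plus \<sigma> \<rho>"
    using datum unfolding inducing_datum_Kmax_def by blast
  note rep' = is_rep_sub_GSp[OF rep]
  have KG: "Kmax \<subseteq> carrier (GSp :: ('f^4^4) monoid)" using stab_GSp by (auto simp: Kmax_eq_stab)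
  have plus: "act \<sigma> g w = w" if "g \<in> Kmax_plus" "w \<in> rspace \<sigma>" for g w
  proof (rule inflation_trivial[OF \<rho>(2) subgroup_Kmax_plus _ _ that])
    show "Kmax_plus \<subseteq> (Kmax :: ('f^4^4) set)" by (auto simp: Kmax_eq_stab Kmax_plus_stab)
    show "act \<sigma> (mat 1) w = w" by (rule rep'(4)[OF that(2)])
  qed
  have cusp: "w = 0" if S: "S \<in> {siegel_pos, klingen_pos, borel_pos}" and w: "w \<in> rspace \<sigma>"
    and fixed: "\<And>u. u \<in> supported_on S Kmax \<Longrightarrow> act \<sigma> u w = w" for S w
  proof -
    have "quotient_conjugates Kmax Kmax_plus (supported_on S Kmax) \<subseteq> (radicals_Kmax :: ('f^4^4) set set set)"
      unfolding radicals_Kmax_def using S by blast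
    moreover have "mat 1 \<in> (Kmax :: ('f^4^4) set)" by (simp add: Kmax_eq_stab stab_1)
    moreover have "mat 1 ** u ** matrix_inv (mat 1) = u" for u :: "'f^4^4"
      using GSp_inverse_cancel(1)[OF GSp_mem_1, where 'a = 'f] by simp
    ultimately show ?thesis
      using no_fixed_vectors[OF \<rho>(2,1) _ KG _ _ w, of "supported_on S Kmax" "mat 1"] fixed
      by (simp add: supported_on_def)
  qed
  interpret Kmax_action p T \<psi> "rspace \<sigma>" "act \<sigma>"
  proof
    show "complex_space.subspace (rspace \<sigma>)" by (rule rep'(1))
    show "act \<sigma> g w \<in> rspace \<sigma>" if "g \<in> stab 1" "w \<in> rspace \<sigma>" for g w
      by (rule rep'(2)[OF stab_ZK[OF that(1)] that(2)])
    show "linear_on (rspace \<sigma>) (act \<sigma> g)" if "g \<in> stab 1" for g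
      by (rule rep'(3)[OF stab_ZK[OF that]])
    show "act \<sigma> (g ** h) w = act \<sigma> g (act \<sigma> h w)" if "g \<in> stab 1" "h \<in> stab 1" "w \<in> rspace \<sigma>" for g h w
      by (rule rep'(5)[OF stab_ZK[OF that(1)] stab_ZK[OF that(2)] that(3)])
    show "act \<sigma> g w = w" if "g \<in> Kmax_plus" "w \<in> rspace \<sigma>" for g w using plus that .
    show "w = 0" if w: "w \<in> rspace \<sigma>" and fixed: "\<And>a b c. nrm a \<le> 1 \<Longrightarrow> nrm b \<le> 1 \<Longrightarrow> nrm c \<le> 1 \<Longrightarrow>
        act \<sigma> (klingen a b c) w = w" for w
    proof (rule cusp[of klingen_pos])
      fix u :: "'f^4^4" assume u: "u \<in> supported_on klingen_pos Kmax"
      have "nrm (u $ i $ j) \<le> 1" for i j using u by (simp add: supported_on_def Kmax_eq_stab stab_1_iff)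
      hence "act \<sigma> (klingen (u $ 1 $ 2) (u $ 2 $ 4) (u $ 1 $ 4)) w = w" by (intro fixed)
      thus "act \<sigma> u w = w" using klingen_pos_decomposition[OF u KG] by simp
    qed (use w in auto)
    show "w = 0" if w: "w \<in> rspace \<sigma>" and fixed: "\<And>b c d. nrm b \<le> 1 \<Longrightarrow> nrm c \<le> 1 \<Longrightarrow> nrm d \<le> 1 \<Longrightarrow>
        act \<sigma> (klingen 0 b c ** levi 1 d 0 1) w = w" for w
    proof (rule cusp[of siegel_pos])
      fix u :: "'f^4^4" assume u: "u \<in> supported_on siegel_pos Kmax"
      have "nrm (u $ i $ j) \<le> 1" for i j using u by (simp add: supported_on_def Kmax_eq_stab stab_1_iff)
      hence "act \<sigma> (klingen 0 (u $ 2 $ 4) (u $ 1 $ 4) ** levi 1 (u $ 2 $ 3) 0 1) w = w" by (intro fixed)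
      thus "act \<sigma> u w = w" using siegel_pos_decomposition[OF u KG] by simp
    qed (use w in auto)
  qed
  have fR: "f \<in> rspace (cInd GSp ZK \<sigma>)" using f(1) by (simp add: fixed_vectors_def)
  obtain g where "f g \<noteq> 0" using f(2) by (auto simp: fun_eq_iff)
  hence g: "g \<in> carrier GSp" "f g \<noteq> 0" "f g \<in> rspace \<sigma>" using fR by (auto simp: cInd_rspace_iff)
  \<comment> \<open>For K all weights are 1, so \<open>v = 1\<close> meets the condition on the long
    Weyl element.\<close>
  have ex: "\<exists>h\<in>stab 1. \<exists>i\<in>{1,2}. \<forall>b. nrm (b::'f) * (vnorm 1 (unit_vec i :: 'f^4))\<^sup>2 \<le> 1 \<longrightarrow>
      act \<sigma> (h ** transvection (unit_vec i) b ** matrix_inv h) (f g) = f g"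
    by (rule Kl_fixed_root_group[where v = 1, OF _ _ _ f(1) g(1)]) (simp_all add: nrm_1 stab_ZK subsetI)
  obtain h i where h: "h \<in> stab 1" "i \<in> {1,2}"
    and fixed: "\<And>b. nrm (b::'f) * (vnorm 1 (unit_vec i :: 'f^4))\<^sup>2 \<le> 1 \<Longrightarrow>
      act \<sigma> (h ** transvection (unit_vec i) b ** matrix_inv h) (f g) = f g"
    using ex by blast
  have v1: "vnorm 1 (unit_vec i :: 'f^4) = 1" using h(2) by (auto simp: vnorm_unit_vec)
  \<comment> \<open>Inside K the vectors e_1 and e_2 lie in one orbit: \<open>short_weyl\<close>
    carries the root group of e_2 to that of e_1, the center of the Klingen radical.\<close>
  define x where "x = (if i = 1 then mat 1 else short_weyl :: 'f^4^4)"
  have x: "x \<in> stab 1" using stab_explicit(5)[OF zero_less_one] by (simp add: x_def stab_1)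
  have conj: "klingen 0 0 c ** x = x ** transvection (unit_vec i) (- c)" for c
    using h(2) by (auto simp: x_def transvection_unit_vec vec_eq_iff forall_4 klingen_def levi_def
        short_weyl_def matrix_matrix_mult_def sum_4 mat_1_entry)
  define w where "w = act \<sigma> (x ** matrix_inv h) (f g)"
  have k: "x ** matrix_inv h \<in> stab 1" by (intro stab_mult stab_matrix_inv x h) simp
  have w: "w \<in> rspace \<sigma>" "w \<noteq> 0" unfolding w_def by (intro A_mem k g A_neq_0)+
  have "act \<sigma> (klingen 0 0 c) w = w" if c: "nrm c \<le> 1" for c
  proof -
    let ?u = "transvection (unit_vec i) (- c)"
    have tu: "h ** ?u ** matrix_inv h \<in> stab 1"
      by (intro stab_mult stab_matrix_inv h transvection_mem_stab) (simp_all add: v1 nrm_minus c)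
    have "klingen 0 0 c ** (x ** matrix_inv h) = x ** ?u ** matrix_inv h"
      by (simp add: matrix_mul_assoc conj)
    also have "\<dots> = (x ** matrix_inv h) ** (h ** ?u ** matrix_inv h)"
      by (simp add: matrix_mul_assoc GSp_inverse_cancel[OF stab_GSp[OF h(1)]])
    finally have "act \<sigma> (klingen 0 0 c) w = act \<sigma> ((x ** matrix_inv h) ** (h ** ?u ** matrix_inv h)) (f g)"
      unfolding w_def using klingen_mem_stab_1[of 0 0 c] c k g(3) by (simp add: A_mult[symmetric])
    also have "\<dots> = act \<sigma> (x ** matrix_inv h) (act \<sigma> (h ** ?u ** matrix_inv h) (f g))"
      by (rule A_mult[OF k tu g(3)])
    also have "act \<sigma> (h ** ?u ** matrix_inv h) (f g) = f g"
      by (rule fixed) (simp add: v1 nrm_minus c)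
    finally show ?thesis by (simp add: w_def)
  qed
  from whittaker_vector[OF w this] obtain c0 d0 v where cd: "nrm c0 = 1" "nrm d0 = 1"
    and v: "v \<in> rspace \<sigma>" "v \<noteq> 0"
    and eig: "\<And>a b c d. nrm a \<le> 1 \<Longrightarrow> nrm b \<le> 1 \<Longrightarrow> nrm c \<le> 1 \<Longrightarrow> nrm d \<le> 1 \<Longrightarrow>
      act \<sigma> (klingen a b c ** levi 1 d 0 1) v = scaleC (\<psi> (c0 * a + d0 * d)) v"
    by blast
  show ?thesis
  proof (rule generic_cInd_ZK[OF rep plus cd v])
    fix m :: "'f^4^4" assume m: "m \<in> unipotent" "m \<in> stab 1"
    have "nrm (m $ i $ j) \<le> 1" for i j using m(2) by (simp add: stab_1_iff)
    hence "act \<sigma> (klingen (m $ 1 $ 2) (m $ 2 $ 4) (m $ 1 $ 4) ** levi 1 (m $ 2 $ 3) 0 1) v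
        = scaleC (uchar c0 d0 m) v"
      unfolding uchar_def by (intro eig)
    thus "act \<sigma> m v = scaleC (uchar c0 d0 m) v"
      using unipotent_decomposition[OF m(1)] by simp
  qed
qed

end

theorem corollary4p9:
  fixes \<pi> :: "('f::{field_char_0, metric_space}^4^4, 'v::complex_space) rep"
  assumes "finite_extension_of_Qp p TYPE('f)"
    and "depth_zero_supercuspidal TYPE('w::complex_space) \<pi>"
    and "\<not> generic \<pi>"
  shows "\<forall>n. fixed_vectors \<pi> (Kl n) = {0}"
proof
  fix n
  interpret local_field p "TYPE('f)" by (unfold_locales) (rule assms(1))
  obtain \<psi> :: "'f \<Rightarrow> complex" where "\<forall>x. cmod (\<psi> x) = 1" "\<forall>x y. \<psi> (x + y) = \<psi> x * \<psi> y"
    "\<forall>x. nrm x < 1 \<longrightarrow> \<psi> x = 1" "\<psi> 1 \<noteq> 1"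
    using unramified_character_exists by blast
  then interpret unramified_character p "TYPE('f)" \<psi> by unfold_locales auto
  have rep: "is_rep GSp \<pi>"
    using assms(2) by (simp add: depth_zero_supercuspidal_def smooth_rep_def)
  hence sub: "complex_space.subspace (rspace \<pi>)" by (simp add: is_rep_def)
  have zero: "0 \<in> fixed_vectors \<pi> (Kl n)"
  proof -
    have "act \<pi> k 0 = 0" if "k \<in> Kl n" for k
      using rep that Kl_GSp by (intro linear_on_0[OF _ sub]) (auto simp: is_rep_def)
    thus ?thesis using complex_space.subspace_0[OF sub] by (simp add: fixed_vectors_def)
  qed
  have transport: "v = 0"
    if T: "linear_on (rspace \<pi>) T" "bij_betw T (rspace \<pi>) (rspace \<rho>)"
      "\<forall>g\<in>carrier GSp. \<forall>v\<in>rspace \<pi>. T (act \<pi> g v) = act \<rho> g (T v)"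
      and none: "\<And>f. f \<in> fixed_vectors \<rho> (Kl n) \<Longrightarrow> f = 0" and v: "v \<in> fixed_vectors \<pi> (Kl n)"
    for T and \<rho> :: "('f^4^4, 'f^4^4 \<Rightarrow> 'w) rep" and v
  proof -
    have "T v = 0" by (rule none[OF fixed_vectors_isomorphic[OF T Kl_GSp v]])
    hence "T v = T 0" using linear_on_0[OF T(1) sub] by simp
    thus "v = 0" using T(2) v complex_space.subspace_0[OF sub]
      by (auto simp: fixed_vectors_def bij_betw_def dest: inj_onD)
  qed
  have "v = 0" if v: "v \<in> fixed_vectors \<pi> (Kl n)" for v
  proof -
    consider (max) \<sigma> :: "('f^4^4, 'w) rep" where "inducing_datum_Kmax \<sigma>"
        "isomorphic_reps GSp \<pi> (cInd GSp ZK \<sigma>)"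
      | (para) \<tau> :: "('f^4^4, 'w) rep" where "inducing_datum_Kpara \<tau>"
        "isomorphic_reps GSp \<pi> (cInd GSp (normalizer GSp Kpara) \<tau>)"
      using assms(2) unfolding depth_zero_supercuspidal_def by blast
    thus ?thesis
    proof cases
      case max
      then obtain T where T: "linear_on (rspace \<pi>) T" "bij_betw T (rspace \<pi>) (rspace (cInd GSp ZK \<sigma>))"
        "\<forall>g\<in>carrier GSp. \<forall>v\<in>rspace \<pi>. T (act \<pi> g v) = act (cInd GSp ZK \<sigma>) g (T v)"
        unfolding isomorphic_reps_def by blast
      have "\<not> generic (cInd GSp ZK \<sigma>)" using generic_isomorphic[OF rep T] assms(3) by blast
      hence "f = 0" if "f \<in> fixed_vectors (cInd GSp ZK \<sigma>) (Kl n)" for f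
        using cInd_ZK_generic_of_fixed_vector[OF max(1) that] by blast
      thus ?thesis using transport[OF T _ v] by blast
    next
      case para
      then obtain T where T: "linear_on (rspace \<pi>) T"
        "bij_betw T (rspace \<pi>) (rspace (cInd GSp (normalizer GSp Kpara) \<tau>))"
        "\<forall>g\<in>carrier GSp. \<forall>v\<in>rspace \<pi>.
          T (act \<pi> g v) = act (cInd GSp (normalizer GSp Kpara) \<tau>) g (T v)"
        unfolding isomorphic_reps_def by blast
      show ?thesis by (rule transport[OF T _ v]) (rule cInd_Kpara_no_fixed_vectors[OF para(1)])
    qed
  qed
  thus "fixed_vectors \<pi> (Kl n) = {0}" using zero by blast
qed

end
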